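(* Let $p \in [1,\infty]$. For every $\phi \in \mathcal{M}^p$, the mild solution $x(\cdot;\phi)$ of the linear retarded functional differential equation $\dot{x}(t) = Lx_t$ $(t \ge 0)$ under the initial condition $x_0 = \phi$ is locally absolutely continuous on $[0,\infty)$. Furthermore, the following statements hold: (1) $x(\cdot;\phi)|_{[0,\infty)} \colon [0,\infty) \to \mathbb{K}^n$ is differentiable almost everywhere and its derivative belongs to $\mathcal{L}^p_{\mathrm{loc}}([0,\infty),\mathbb{K}^n)$. (2) There exists a function $f(\cdot;\phi) \in \mathcal{L}^p_{\mathrm{loc}}([0,\infty),\mathbb{K}^n)$ vanishing on $[r,\infty)$ such that $$\dot{x}(t;\phi) = \int_{-t}^0 \mathrm{d}\eta(\theta)\, x(t+\theta;\phi) + f(t;\phi) \qquad (\text{a.e. } t \ge 0)$$ holds.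
   Context: Let $n \ge 1$ be an integer, $\mathbb{K} = \mathbb{R}$ or $\mathbb{C}$, $r > 0$ a constant, and $|\cdot|$ a fixed norm on $\mathbb{K}^n$. Let $C := C([-r,0],\mathbb{K}^n)$ be the Banach space of continuous functions with the supremum norm, and let $L \colon C \to \mathbb{K}^n$ be a given continuous linear map. The function $\eta \colon (-\infty,0] \to M_n(\mathbb{K})$ is a matrix-valued function such that $\eta$ is of bounded variation on $[-r,0]$, $\eta$ is constant on $(-\infty,-r]$, and $L\psi = \int_{-r}^0 \mathrm{d}\eta(\theta)\,\psi(\theta)$ for all $\psi \in C$. (Such $\eta$ exists by the Riesz representation theorem.) Integrals $\int_a^b \mathrm{d}\eta(\theta)\, h(\theta)$ are Riemann--Stieltjes integrals of a vector-valued function $h$ with respect to the matrix-valued function $\eta$, i.e. limits of $\sum_k [\eta(\theta_k)-\eta(\theta_{k-1})]h(\tau_k)$ with $\tau_k\in[\theta_{k-1},\theta_k]$ as the mesh of the partition tends to $0$. For an interval $J \subset \mathbb{R}$ and $p \in [1,\infty)$, $\mathcal{L}^p_{\mathrm{loc}}(J,\mathbb{K}^n)$ is the set of all locally Lebesgue $p$-integrable functions from $J$ to $\mathbb{K}^n$ defined almost everywhere; $\mathcal{L}^\infty_{\mathrm{loc}}(J,\mathbb{K}^n)$ is the set of all locally essentially bounded functions from $J$ to $\mathbb{K}^n$ defined almost everywhere. (Elements are functions, not equivalence classes.) For $p \in [1,\infty]$, $\mathcal{M}^p := \{\phi \in \mathcal{L}^p([-r,0],\mathbb{K}^n) : \phi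 \text{ is defined at } 0\}$. A function on $J$ is locally absolutely continuous if its restriction to every closed and bounded interval contained in $J$ is absolutely continuous. For $x \in \mathcal{L}^1_{\mathrm{loc}}([-r,\infty),\mathbb{K}^n)$ and $t \ge 0$, $\int_0^t x_s\,\mathrm{d}s \in C$ is defined by $\left(\int_0^t x_s\,\mathrm{d}s\right)(\theta) := \int_0^t x(s+\theta)\,\mathrm{d}s$ for $\theta \in [-r,0]$. For $\phi \in \mathcal{M}^1$, a function $x \in \mathcal{L}^1_{\mathrm{loc}}([-r,\infty),\mathbb{K}^n)$ is a mild solution of $\dot{x}(t) = Lx_t$ $(t \ge 0)$ under the initial condition $x_0 = \phi$ if (i) $x$ is defined on $[0,\infty)$ and (ii) $x(t) = \phi(0) + L\int_0^t x_s\,\mathrm{d}s$ for all $t \ge 0$ and $x(t) = \phi(t)$ for a.e. $t \in [-r,0]$. It is known that for each $\phi \in \mathcal{M}^1$ a mild solution exists and is unique; it is denoted by $x(\cdot;\phi) \colon \operatorname{dom}(\phi) \cup [0,\infty) \to \mathbb{K}^n$, and it is continuous on $[0,\infty)$. *)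

theory Defs
  imports "HOL-Analysis.Analysis"
begin

text \<open>
  The scalar field is a type \<open>'k\<close> of sort \<open>{real_normed_field, euclidean_space}\<close>, i.e. a
  finite-dimensional commutative normed division algebra over the reals. Both \<^typ>\<open>real\<close> and
  \<^typ>\<open>complex\<close> are instances, and by Frobenius' theorem there are no others up to isomorphism.
  The space \<open>K^n\<close> is \<open>'k^'n\<close> and \<open>M_n(K)\<close> is \<open>'k^'n^'n\<close>. The chosen norm on \<open>K^n\<close>
  is a parameter \<open>N\<close>; limits and derivatives use the topology of \<open>'k^'n\<close>, which every norm induces.
\<close>

definition is_norm :: "('k::{real_normed_field,euclidean_space}^'n \<Rightarrow> real) \<Rightarrow> bool" where
  "is_norm N \<longleftrightarrow>
     (\<forall>v. N v \<ge> 0) \<and> (\<forall>v. N v = 0 \<longleftrightarrow> v = 0) \<and>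
     (\<forall>c v. N (c *s v) = norm c * N v) \<and>
     (\<forall>v w. N (v + w) \<le> N v + N w)"

section \<open>Continuous linear maps on the space of continuous functions\<close>

text \<open>
  An element of \<open>C([-r,0], K^n)\<close> is represented by any function on the reals that is continuous on
  \<open>[-r,0]\<close>; two such functions denote the same element iff they agree on \<open>[-r,0]\<close>.
\<close>

definition C_space :: "real \<Rightarrow> (real \<Rightarrow> 'k::{real_normed_field,euclidean_space}^'n) set" where
  "C_space r = {\<psi>. continuous_on {-r..0} \<psi>}"

definition sup_norm ::
  "('k::{real_normed_field,euclidean_space}^'n \<Rightarrow> real) \<Rightarrow> real \<Rightarrow> (real \<Rightarrow> 'k^'n) \<Rightarrow> real" where
  "sup_norm N r \<psi> = (SUP \<theta>\<in>{-r..0}. N (\<psi> \<theta>))"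

text \<open>The first conjunct says that \<open>L\<close> is well defined on \<open>C([-r,0], K^n)\<close>.\<close>

definition continuous_linear_on_C ::
  "('k::{real_normed_field,euclidean_space}^'n \<Rightarrow> real) \<Rightarrow> real \<Rightarrow> ((real \<Rightarrow> 'k^'n) \<Rightarrow> 'k^'n) \<Rightarrow> bool" where
  "continuous_linear_on_C N r L \<longleftrightarrow>
     (\<forall>\<psi>\<in>C_space r. \<forall>\<xi>\<in>C_space r. (\<forall>\<theta>\<in>{-r..0}. \<psi> \<theta> = \<xi> \<theta>) \<longrightarrow> L \<psi> = L \<xi>) \<and>
     (\<forall>\<psi>\<in>C_space r. \<forall>\<xi>\<in>C_space r. L (\<lambda>\<theta>. \<psi> \<theta> + \<xi> \<theta>) = L \<psi> + L \<xi>) \<and>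
     (\<forall>c. \<forall>\<psi>\<in>C_space r. L (\<lambda>\<theta>. c *s \<psi> \<theta>) = c *s L \<psi>) \<and>
     (\<forall>\<psi>\<in>C_space r. \<forall>\<epsilon>>0. \<exists>\<delta>>0. \<forall>\<xi>\<in>C_space r.
        sup_norm N r (\<lambda>\<theta>. \<xi> \<theta> - \<psi> \<theta>) < \<delta> \<longrightarrow> N (L \<xi> - L \<psi>) < \<epsilon>)"

section \<open>Bounded variation and Riemann-Stieltjes integrals\<close>

text \<open>
  The points \<open>\<theta> 0 < ... < \<theta> m\<close> partition \<open>[a,b]\<close>. For \<open>a = b\<close> only \<open>m = 0\<close> is possible, so the
  Riemann-Stieltjes integral over a degenerate interval is zero.
\<close>

definition is_partition :: "real \<Rightarrow> real \<Rightarrow> nat \<Rightarrow> (nat \<Rightarrow> real) \<Rightarrow> bool" where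
  "is_partition a b m \<theta> \<longleftrightarrow> \<theta> 0 = a \<and> \<theta> m = b \<and> (\<forall>k<m. \<theta> k < \<theta> (Suc k))"

definition bounded_variation_on ::
  "(real \<Rightarrow> 'k::{real_normed_field,euclidean_space}^'n^'n) \<Rightarrow> real \<Rightarrow> real \<Rightarrow> bool" where
  "bounded_variation_on \<eta> a b \<longleftrightarrow>
     (\<exists>V. \<forall>m \<theta>. is_partition a b m \<theta> \<longrightarrow> (\<Sum>k<m. norm (\<eta> (\<theta> (Suc k)) - \<eta> (\<theta> k))) \<le> V)"

definition has_RS_integral ::
  "(real \<Rightarrow> 'k::{real_normed_field,euclidean_space}^'n^'n) \<Rightarrow> (real \<Rightarrow> 'k^'n) \<Rightarrow> real \<Rightarrow> real \<Rightarrow> 'k^'n \<Rightarrow> bool" where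
  "has_RS_integral \<eta> h a b I \<longleftrightarrow>
     (\<forall>\<epsilon>>0. \<exists>\<delta>>0. \<forall>m \<theta> \<tau>.
        is_partition a b m \<theta> \<and>
        (\<forall>k<m. \<theta> (Suc k) - \<theta> k < \<delta> \<and> \<tau> k \<in> {\<theta> k..\<theta> (Suc k)}) \<longrightarrow>
        dist (\<Sum>k<m. (\<eta> (\<theta> (Suc k)) - \<eta> (\<theta> k)) *v h (\<tau> k)) I < \<epsilon>)"

section \<open>Almost everywhere defined functions\<close>

text \<open>
  Functions defined almost everywhere are partial functions \<open>f :: real \<rightharpoonup> 'k^'n\<close>. Off \<open>dom f\<close> the
  value \<open>the (f t)\<close> is a fixed constant; this set is null, so it does not affect measurability,
  integrability or integrals with respect to Lebesgue measure.
\<close>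

definition Lp ::
  "('k::{real_normed_field,euclidean_space}^'n \<Rightarrow> real) \<Rightarrow> ennreal \<Rightarrow> real set \<Rightarrow> (real \<rightharpoonup> 'k^'n) set" where
  "Lp N p J = {f. dom f \<subseteq> J \<and> (AE t in lebesgue_on J. t \<in> dom f) \<and>
     (\<lambda>t. the (f t)) \<in> borel_measurable (lebesgue_on J) \<and>
     (if p = \<infinity> then \<exists>M. AE t in lebesgue_on J. N (the (f t)) \<le> M
      else integrable (lebesgue_on J) (\<lambda>t. N (the (f t)) powr enn2real p))}"

definition Lp_loc ::
  "('k::{real_normed_field,euclidean_space}^'n \<Rightarrow> real) \<Rightarrow> ennreal \<Rightarrow> real set \<Rightarrow> (real \<rightharpoonup> 'k^'n) set" where
  "Lp_loc N p J = {f. dom f \<subseteq> J \<and> (\<forall>a b. {a..b} \<subseteq> J \<longrightarrow> f |` {a..b} \<in> Lp N p {a..b})}"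

definition Mp ::
  "('k::{real_normed_field,euclidean_space}^'n \<Rightarrow> real) \<Rightarrow> ennreal \<Rightarrow> real \<Rightarrow> (real \<rightharpoonup> 'k^'n) set" where
  "Mp N p r = {\<phi> \<in> Lp N p {-r..0}. 0 \<in> dom \<phi>}"

definition absolutely_continuous_on ::
  "('k::{real_normed_field,euclidean_space}^'n \<Rightarrow> real) \<Rightarrow> real \<Rightarrow> real \<Rightarrow> (real \<Rightarrow> 'k^'n) \<Rightarrow> bool" where
  "absolutely_continuous_on N a b f \<longleftrightarrow>
     (\<forall>\<epsilon>>0. \<exists>\<delta>>0. \<forall>m (u::nat \<Rightarrow> real) v.
        (\<forall>k<m. a \<le> u k \<and> u k \<le> v k \<and> v k \<le> b) \<and>
        (\<forall>i<m. \<forall>j<m. i \<noteq> j \<longrightarrow> {u i<..<v i} \<inter> {u j<..<v j} = {}) \<and>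
        (\<Sum>k<m. v k - u k) < \<delta> \<longrightarrow>
        (\<Sum>k<m. N (f (v k) - f (u k))) < \<epsilon>)"

definition locally_absolutely_continuous_on ::
  "('k::{real_normed_field,euclidean_space}^'n \<Rightarrow> real) \<Rightarrow> real set \<Rightarrow> (real \<Rightarrow> 'k^'n) \<Rightarrow> bool" where
  "locally_absolutely_continuous_on N J f \<longleftrightarrow>
     (\<forall>a b. {a..b} \<subseteq> J \<longrightarrow> absolutely_continuous_on N a b f)"

section \<open>Mild solutions\<close>

text \<open>The argument of \<open>L\<close> is the element \<open>\<integral>\<^sub>0\<^sup>t x\<^sub>s ds\<close> of \<open>C([-r,0], K^n)\<close>.\<close>

definition mild_solution ::
  "('k::{real_normed_field,euclidean_space}^'n \<Rightarrow> real) \<Rightarrow> real \<Rightarrow> ((real \<Rightarrow> 'k^'n) \<Rightarrow> 'k^'n) \<Rightarrow>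
   (real \<rightharpoonup> 'k^'n) \<Rightarrow> (real \<rightharpoonup> 'k^'n) \<Rightarrow> bool" where
  "mild_solution N r L \<phi> x \<longleftrightarrow>
     x \<in> Lp_loc N 1 {-r..} \<and> {0..} \<subseteq> dom x \<and>
     (\<forall>t\<ge>0. the (x t) = the (\<phi> 0) + L (\<lambda>\<theta>. \<integral>s. the (x (s + \<theta>)) \<partial>lebesgue_on {0..t})) \<and>
     (AE t in lebesgue_on {-r..0}. x t = \<phi> t)"

text \<open>The derivative of \<open>x\<close> restricted to \<open>[0,\<infinity>)\<close>, defined exactly where it exists.\<close>

definition half_line_deriv ::
  "(real \<rightharpoonup> 'k::{real_normed_field,euclidean_space}^'n) \<Rightarrow> (real \<rightharpoonup> 'k^'n)" where
  "half_line_deriv x = (\<lambda>t.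
     if t \<ge> 0 \<and> (\<lambda>s. the (x s)) differentiable (at t within {0..})
     then Some (vector_derivative (\<lambda>s. the (x s)) (at t within {0..})) else None)"

end

theory Submission
  imports Defs
begin

text \<open>
  Write \<open>Y t = \<integral>\<^bsub>-r\<^esub>\<^bsup>t\<^esup> x\<close>. The mild solution is \<open>x t = \<phi> 0 + F t\<close> with \<open>F t = L (\<lambda>\<theta>. Y (t + \<theta>) - Y \<theta>)\<close>, and \<open>L\<close> is a
  limit of Riemann-Stieltjes sums with total weight at most a constant \<open>V\<close>. Hence the variation of \<open>F\<close>
  over any family of disjoint intervals is at most \<open>V\<close> times the largest variation of \<open>Y\<close> over the family
  translated by some \<open>\<theta>\<close>. Absolute continuity of \<open>Y\<close> therefore passes to \<open>F\<close>. Replacing \<open>x\<close> by a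
  continuous function that is close in \<open>L\<^sup>1\<close> changes \<open>F\<close> into a differentiable function that is close
  in variation, and a covering argument gives differentiability of \<open>F\<close> almost everywhere. Jensen's
  inequality bounds the \<open>L\<^sup>p\<close> norms of the difference quotients of \<open>F\<close>, hence of the derivative by Fatou's lemma.
  For \<open>t > r\<close> the solution is continuous on a neighbourhood of \<open>[t - r, t]\<close>, so \<open>F' t = L x\<^sub>t\<close> directly, and the forcing term can
  be taken as the difference of the two sides for \<open>t < r\<close> and as zero afterwards.
\<close>

section \<open>Absolute continuity of the integral\<close>

text \<open>The obstacle: \<open>\<eta>\<close> has only bounded variation and the initial segment
  is only in L^p. For \<open>t < r\<close> the segment of \<open>x\<close> at \<open>t\<close> need
  not be continuous, so \<open>L\<close> cannot be applied to it and \<open>F' t\<close> has no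
  direct formula; bounds on \<open>F'\<close> must come from increments of \<open>F\<close>. No
  measure is built from \<open>\<eta>\<close>: each estimate is shown for finite weighted sums of
  point values, uniformly in the number of points, and passes to the limit. The decisive fact is
  that disjoint intervals translated by one common \<open>\<theta>\<close> stay disjoint, so their
  total is controlled at every \<open>\<theta>\<close> by a single L^1 norm. Approximation alone
  would not give differentiability, which limits can destroy; the weak-type estimate converts small
  variation of the error into a small exceptional set. Finally, the hypotheses supply Stieltjes
  integrals over \<open>[-r,0]\<close>, while the equation needs them over \<open>[-t,0]\<close>;
  the integral has to be shortened for \<open>t \<le> r\<close> and lengthened for
  \<open>t > r\<close>.\<close>

lemma sum_integral_disjoint_intervals_le:
  fixes g :: "real \<Rightarrow> real"
  assumes I: "finite I" and uv: "\<And>i. i \<in> I \<Longrightarrow> a \<le> u i \<and> u i \<le> v i \<and> v i \<le> b"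
    and disj: "\<And>i j. \<lbrakk>i \<in> I; j \<in> I; i \<noteq> j\<rbrakk> \<Longrightarrow> {u i<..<v i} \<inter> {u j<..<v j} = {}"
    and g: "g integrable_on {a..b}" "\<And>x. x \<in> {a..b} \<Longrightarrow> 0 \<le> g x"
  shows "(\<Sum>i\<in>I. integral {u i..v i} g) \<le> integral {a..b} g"
proof -
  \<comment> \<open>Only the open intervals are disjoint, so at most one \<open>?h i\<close> is
    nonzero at a point. The omitted endpoints do not affect the integrals.\<close>
  let ?h = "\<lambda>i x. if x \<in> {u i<..<v i} then g x else 0"
  have h: "(?h i has_integral integral {u i..v i} g) {a..b}" if "i \<in> I" for i
  proof -
    have "g integrable_on {u i..v i}"
      using uv[OF that] by (intro integrable_on_subinterval[OF g(1)]) auto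
    then have "(g has_integral integral {u i..v i} g) {u i<..<v i}"
      using has_integral_Icc_iff_Ioo by blast
    then show ?thesis
      using uv[OF that] by (subst has_integral_restrict) auto
  qed
  have "((\<lambda>x. \<Sum>i\<in>I. ?h i x) has_integral (\<Sum>i\<in>I. integral {u i..v i} g)) {a..b}"
    using I h by (rule has_integral_sum)
  moreover have "(\<Sum>i\<in>I. ?h i x) \<le> g x" if x: "x \<in> {a..b}" for x
  proof (cases "\<exists>j\<in>I. x \<in> {u j<..<v j}")
    case True
    then obtain j where j: "j \<in> I" "x \<in> {u j<..<v j}" by blast
    have "(\<Sum>i\<in>I. ?h i x) = ?h j x + (\<Sum>i\<in>I-{j}. ?h i x)"
      by (rule sum.remove[OF I j(1)])
    also have "(\<Sum>i\<in>I-{j}. ?h i x) = 0"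
    proof (rule sum.neutral, rule ballI)
      fix i assume "i \<in> I - {j}"
      then have "{u i<..<v i} \<inter> {u j<..<v j} = {}" using disj j by blast
      then show "?h i x = 0" using j by auto
    qed
    finally show ?thesis using j by auto
  next
    case False
    then have "(\<Sum>i\<in>I. ?h i x) = 0" by (intro sum.neutral) auto
    then show ?thesis using g(2)[OF x] by simp
  qed
  ultimately show ?thesis
    using has_integral_le[OF _ integrable_integral[OF g(1)]] by blast
qed

text \<open>The excess over level \<open>n\<close> vanishes at a point once \<open>n\<close> exceeds
  the value of \<open>g\<close> there, and it is dominated by \<open>g\<close>; dominated
  convergence does the rest.\<close>

lemma integrable_tail_small:
  fixes g :: "real \<Rightarrow> real"
  assumes g: "g integrable_on {a..b}" "\<And>x. x \<in> {a..b} \<Longrightarrow> 0 \<le> g x" and "e > 0"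
  obtains M :: real where "M > 0" "(\<lambda>x. min (g x) M) integrable_on {a..b}"
    "integral {a..b} (\<lambda>x. g x - min (g x) M) < e"
proof -
  have gabs: "g absolutely_integrable_on {a..b}"
    using g by (intro nonnegative_absolutely_integrable_1) auto
  have int: "(\<lambda>x. min (g x) M) integrable_on {a..b}" for M
    by (intro set_lebesgue_integral_eq_integral(1) absolutely_integrable_min_1 gabs absolutely_integrable_on_const) simp
  have "(\<lambda>n. integral {a..b} (\<lambda>x. g x - min (g x) (real n))) \<longlonglongrightarrow> integral {a..b} (\<lambda>x. 0)"
  proof (rule dominated_convergence(2)[where h = g])
    show "(\<lambda>x. g x - min (g x) (real n)) integrable_on {a..b}" for n
      by (intro integrable_diff g int)
    show "norm (g x - min (g x) (real n)) \<le> g x" if "x \<in> {a..b}" for n x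
      using g(2)[OF that] by (auto simp: min_def)
    show "(\<lambda>n. g x - min (g x) (real n)) \<longlonglongrightarrow> 0" if "x \<in> {a..b}" for x
    proof (rule tendsto_eventually)
      obtain m where "g x < real m" using reals_Archimedean2 by blast
      then show "\<forall>\<^sub>F n in sequentially. g x - min (g x) (real n) = 0"
        by (intro eventually_sequentiallyI[of m]) (auto simp: min_def)
    qed
  qed (fact g)
  then have "\<forall>\<^sub>F n in sequentially. integral {a..b} (\<lambda>x. g x - min (g x) (real n)) < e"
    using \<open>e > 0\<close> by (intro order_tendstoD) auto
  then have "\<forall>\<^sub>F n in sequentially. integral {a..b} (\<lambda>x. g x - min (g x) (real n)) < e \<and> n > 0"
    by (intro eventually_conj eventually_gt_at_top)
  then obtain n :: nat where "integral {a..b} (\<lambda>x. g x - min (g x) (real n)) < e" "n > 0"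
    by (auto simp: eventually_sequentially)
  then show ?thesis using that[of "real n"] int by simp
qed

text \<open>Cut \<open>g\<close> at a height \<open>M\<close> whose excess has integral below
  \<open>e / 2\<close>, whatever the intervals. The remaining part contributes at most
  \<open>M\<close> times the total length, which explains the choice
  \<open>d = e / (2 * M)\<close>.\<close>

lemma integral_absolutely_continuous:
  fixes g :: "real \<Rightarrow> real"
  assumes g: "g integrable_on {a..b}" "\<And>x. x \<in> {a..b} \<Longrightarrow> 0 \<le> g x" and "e > 0"
  obtains d where "d > 0"
    "\<And>m u v. \<lbrakk>\<And>k. k < (m::nat) \<Longrightarrow> a \<le> u k \<and> u k \<le> v k \<and> v k \<le> b;
       \<And>i j. \<lbrakk>i < m; j < m; i \<noteq> j\<rbrakk> \<Longrightarrow> {u i<..<v i} \<inter> {u j<..<v j} = {};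
       (\<Sum>k<m. v k - u k) < d\<rbrakk> \<Longrightarrow> (\<Sum>k<m. integral {u k..v k} g) < e"
proof -
  obtain M where M: "M > 0" "(\<lambda>x. min (g x) M) integrable_on {a..b}"
    "integral {a..b} (\<lambda>x. g x - min (g x) M) < e / 2"
    using integrable_tail_small[OF g, of "e / 2"] \<open>e > 0\<close> by auto
  show ?thesis
  proof (rule that[of "e / (2 * M)"])
    show "e / (2 * M) > 0" using \<open>e > 0\<close> M by simp
    fix m :: nat and u v :: "nat \<Rightarrow> real"
    assume uv: "\<And>k. k < m \<Longrightarrow> a \<le> u k \<and> u k \<le> v k \<and> v k \<le> b"
      and disj: "\<And>i j. \<lbrakk>i < m; j < m; i \<noteq> j\<rbrakk> \<Longrightarrow> {u i<..<v i} \<inter> {u j<..<v j} = {}"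
      and less: "(\<Sum>k<m. v k - u k) < e / (2 * M)"
    let ?t = "\<lambda>x. g x - min (g x) M"
    have le: "integral {u k..v k} g \<le> integral {u k..v k} ?t + M * (v k - u k)" if "k < m" for k
    proof -
      have sub: "{u k..v k} \<subseteq> {a..b}" using uv[OF that] by auto
      have i1: "g integrable_on {u k..v k}" "(\<lambda>x. min (g x) M) integrable_on {u k..v k}"
        using integrable_on_subinterval[OF g(1) sub] integrable_on_subinterval[OF M(2) sub] by auto
      have "integral {u k..v k} (\<lambda>x. min (g x) M) \<le> integral {u k..v k} (\<lambda>x. M)"
        using i1 by (intro integral_le) auto
      also have "\<dots> = M * (v k - u k)" using uv[OF that] by simp
      finally show ?thesis using integral_diff[OF i1] by simp
    qed
    have "(\<Sum>k<m. integral {u k..v k} g) \<le> (\<Sum>k<m. integral {u k..v k} ?t + M * (v k - u k))"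
      using le by (intro sum_mono) auto
    also have "\<dots> = (\<Sum>k<m. integral {u k..v k} ?t) + M * (\<Sum>k<m. v k - u k)"
      by (simp add: sum.distrib sum_distrib_left)
    also have "(\<Sum>k<m. integral {u k..v k} ?t) \<le> integral {a..b} ?t"
      using uv disj by (intro sum_integral_disjoint_intervals_le integrable_diff g M) auto
    also have "\<dots> < e / 2" by (rule M)
    also have "M * (\<Sum>k<m. v k - u k) < M * (e / (2 * M))"
      using less M(1) by (rule mult_strict_left_mono)
    also have "\<dots> = e / 2" using M(1) by simp
    finally show "(\<Sum>k<m. integral {u k..v k} g) < e" by simp
  qed
qed

section \<open>Almost everywhere differentiability of limits in variation\<close>

text \<open>Finite sets of pairs are used instead of partitions because a covering argument delivers
  disjoint intervals in no particular order and with gaps between them.\<close>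

definition variation_le :: "(real \<Rightarrow> 'a::real_normed_vector) \<Rightarrow> real \<Rightarrow> real \<Rightarrow> real \<Rightarrow> bool" where
  "variation_le f a b K \<longleftrightarrow>
     (\<forall>C::(real \<times> real) set. finite C \<longrightarrow> (\<forall>(u,v)\<in>C. a \<le> u \<and> u \<le> v \<and> v \<le> b) \<longrightarrow>
        pairwise (\<lambda>(u,v) (u',v'). {u<..<v} \<inter> {u'<..<v'} = {}) C \<longrightarrow>
        (\<Sum>(u,v)\<in>C. norm (f v - f u)) \<le> K)"

text \<open>A weak-type estimate, as for the maximal function: Vitali's covering lemma selects disjoint intervals on
  which \<open>f\<close> moves fast, and there are few of them because the variation is small.\<close>

lemma difference_quotient_weak_bound:
  fixes f :: "real \<Rightarrow> 'a::real_normed_vector"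
  assumes K: "variation_le f a b K" and "\<alpha> > 0"
  obtains U where "U \<in> lmeasurable" "measure lebesgue U \<le> 5 * K / \<alpha>"
    "{t \<in> {a..b}. \<exists>s\<in>{a..b}. \<alpha> * \<bar>s - t\<bar> < norm (f s - f t)} \<subseteq> U"
proof -
  \<comment> \<open>The intervals on which \<open>f\<close> has a slope above
    \<open>\<alpha>\<close>. With midpoint \<open>c\<close> and half-length \<open>\<rho>\<close>
    they become the balls that the covering lemma expects.\<close>
  define Q where "Q = {(u,v). a \<le> u \<and> u < v \<and> v \<le> b \<and> \<alpha> * (v - u) < norm (f v - f u)}"
  define c where "c = (\<lambda>(u::real,v). (u + v) / 2)"
  define \<rho> where "\<rho> = (\<lambda>(u::real,v). (v - u) / 2)"
  have cball: "cball (c (u,v)) (\<rho> (u,v)) = {u..v}" for u v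
    by (auto simp: c_def \<rho>_def cball_eq_atLeastAtMost field_simps)
  let ?S = "{t \<in> {a..b}. \<exists>s\<in>{a..b}. \<alpha> * \<bar>s - t\<bar> < norm (f s - f t)}"
  have S: "?S \<subseteq> (\<Union>i\<in>Q. cball (c i) (\<rho> i))"
  proof clarify
    fix t s assume ts: "t \<in> {a..b}" "s \<in> {a..b}" "\<alpha> * \<bar>s - t\<bar> < norm (f s - f t)"
    then have "s \<noteq> t" by auto
    then have "(min s t, max s t) \<in> Q"
      using ts by (auto simp: Q_def min_def max_def norm_minus_commute abs_if split: if_splits)
    then show "t \<in> (\<Union>i\<in>Q. cball (c i) (\<rho> i))"
      by (intro UN_I[of "(min s t, max s t)"]) (auto simp only: cball atLeastAtMost_iff)
  qed
  obtain C where C: "countable C" "C \<subseteq> Q"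
    and pw: "pairwise (\<lambda>i j. disjnt (cball (c i) (\<rho> i)) (cball (c j) (\<rho> j))) C"
    and cov: "?S \<subseteq> (\<Union>i\<in>C. cball (c i) (5 * \<rho> i))"
  proof (rule Vitali_covering_lemma_cballs[OF S, of "b - a"])
    show "\<And>i. i \<in> Q \<Longrightarrow> 0 < \<rho> i \<and> \<rho> i \<le> b - a"
      by (auto simp: Q_def \<rho>_def)
  qed blast
  \<comment> \<open>The selected family \<open>C\<close> is only countable; a bound common to all
    its finite subfamilies carries over to the union.\<close>
  have bound: "measure lebesgue (\<Union>i\<in>D. cball (c i) (5 * \<rho> i)) \<le> 5 * K / \<alpha>"
    if D: "D \<subseteq> C" "finite D" for D
  proof -
    have DQ: "\<And>u v. (u,v) \<in> D \<Longrightarrow> a \<le> u \<and> u < v \<and> v \<le> b \<and> \<alpha> * (v - u) < norm (f v - f u)"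
      using D C unfolding Q_def by blast
    have "measure lebesgue (\<Union>i\<in>D. cball (c i) (5 * \<rho> i))
        \<le> (\<Sum>i\<in>D. measure lebesgue (cball (c i) (5 * \<rho> i)))"
      by (rule measure_UNION_le) (use D in auto)
    \<comment> \<open>The fivefold enlargement of \<open>[u,v]\<close> has length
      \<open>5 * (v - u)\<close>, and membership in \<open>Q\<close> bounds \<open>v - u\<close> by
      the increment of \<open>f\<close> divided by \<open>\<alpha>\<close>.\<close>
    also have "\<dots> \<le> (\<Sum>(u,v)\<in>D. 5 / \<alpha> * norm (f v - f u))"
    proof (rule sum_mono, clarify)
      fix u v assume "(u,v) \<in> D"
      from DQ[OF this] \<open>\<alpha> > 0\<close> show "measure lebesgue (cball (c (u, v)) (5 * \<rho> (u, v))) \<le> 5 / \<alpha> * norm (f v - f u)"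
        by (simp add: cball_eq_atLeastAtMost \<rho>_def field_simps)
    qed
    also have "\<dots> = 5 / \<alpha> * (\<Sum>(u,v)\<in>D. norm (f v - f u))"
      by (simp add: sum_distrib_left case_prod_unfold)
    also have "\<dots> \<le> 5 / \<alpha> * K"
    proof (rule mult_left_mono)
      have "pairwise (\<lambda>(u,v) (u',v'). {u<..<v} \<inter> {u'<..<v'} = {}) D"
        unfolding case_prod_unfold
      proof (rule pairwiseI)
        fix p q assume "p \<in> D" "q \<in> D" "p \<noteq> q"
        then have "disjnt (cball (c p) (\<rho> p)) (cball (c q) (\<rho> q))"
          using pw D unfolding pairwise_def by blast
        then have "disjnt {fst p..snd p} {fst q..snd q}"
          using cball[of "fst p" "snd p"] cball[of "fst q" "snd q"] by simp
        then show "{fst p<..<snd p} \<inter> {fst q<..<snd q} = {}"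
          unfolding disjnt_def by fastforce
      qed
      moreover have "\<forall>(u,v)\<in>D. a \<le> u \<and> u \<le> v \<and> v \<le> b" using DQ by force
      ultimately show "(\<Sum>(u,v)\<in>D. norm (f v - f u)) \<le> K"
        using K D unfolding variation_le_def by blast
    qed (use \<open>\<alpha> > 0\<close> in auto)
    finally show ?thesis by simp
  qed
  show ?thesis
    using fmeasurable_UN_bound[OF C(1) _ bound] measure_UN_bound[OF C(1) _ bound] cov
    by (intro that[of "\<Union>i\<in>C. cball (c i) (5 * \<rho> i)"]) auto
qed

lemma has_vector_derivative_iff_quotient:
  fixes f :: "real \<Rightarrow> 'a::real_normed_vector"
  shows "(f has_vector_derivative D) (at t) \<longleftrightarrow> ((\<lambda>s. (f s - f t) /\<^sub>R (s - t)) \<longlongrightarrow> D) (at t)"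
proof -
  have "(f has_vector_derivative D) (at t) \<longleftrightarrow>
     ((\<lambda>s. (f s - f t - (s - t) *\<^sub>R D) /\<^sub>R \<bar>s - t\<bar>) \<longlongrightarrow> 0) (at t)"
    unfolding has_vector_derivative_def has_derivative_at_within
    by (simp add: bounded_linear_scaleR_left)
  also have "\<dots> \<longleftrightarrow> ((\<lambda>s. norm ((f s - f t) /\<^sub>R (s - t) - D)) \<longlongrightarrow> 0) (at t)"
  proof (subst tendsto_norm_zero_iff[symmetric], rule filterlim_cong[OF refl refl])
    show "\<forall>\<^sub>F s in at t. norm ((f s - f t - (s - t) *\<^sub>R D) /\<^sub>R \<bar>s - t\<bar>) = norm ((f s - f t) /\<^sub>R (s - t) - D)"
    proof (rule eventually_at_topological[THEN iffD2], intro exI[of _ UNIV] conjI ballI impI)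
      fix s assume "s \<noteq> t"
      then have "(f s - f t) /\<^sub>R (s - t) - D = (f s - f t - (s - t) *\<^sub>R D) /\<^sub>R (s - t)"
        by (simp add: scaleR_diff_right)
      then show "norm ((f s - f t - (s - t) *\<^sub>R D) /\<^sub>R \<bar>s - t\<bar>) = norm ((f s - f t) /\<^sub>R (s - t) - D)"
        by simp
    qed auto
  qed
  also have "\<dots> \<longleftrightarrow> ((\<lambda>s. (f s - f t) /\<^sub>R (s - t)) \<longlongrightarrow> D) (at t)"
    unfolding tendsto_norm_zero_iff by (rule LIM_zero_iff)
  finally show ?thesis .
qed

text \<open>Completeness of the target space removes the limit from the criterion. Its negation is
  an oscillation of fixed size at every scale, which can be measured and exhausted by countably many
  sizes.\<close>

lemma differentiable_iff_cauchy_quotient: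
  fixes f :: "real \<Rightarrow> 'a::euclidean_space"
  shows "f differentiable (at t) \<longleftrightarrow>
    (\<forall>e>0. \<exists>d>0. \<forall>s s'. s \<noteq> t \<and> \<bar>s - t\<bar> < d \<and> s' \<noteq> t \<and> \<bar>s' - t\<bar> < d \<longrightarrow>
       dist ((f s - f t) /\<^sub>R (s - t)) ((f s' - f t) /\<^sub>R (s' - t)) < e)" (is "_ \<longleftrightarrow> ?R")
proof -
  let ?q = "\<lambda>s. (f s - f t) /\<^sub>R (s - t)"
  have "f differentiable (at t) \<longleftrightarrow> (\<exists>D. (f has_vector_derivative D) (at t))"
    using vector_derivative_works differentiableI_vector by blast
  also have "\<dots> \<longleftrightarrow> convergent_filter (filtermap ?q (at t))"
    by (simp add: has_vector_derivative_iff_quotient convergent_filter_iff filterlim_def)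
  also have "\<dots> \<longleftrightarrow> cauchy_filter (filtermap ?q (at t))"
    by (rule convergent_filter_iff_cauchy)
  also have "\<dots> \<longleftrightarrow> ?R"
  proof
    assume C: "cauchy_filter (filtermap ?q (at t))"
    show ?R
    proof (intro allI impI)
      fix e :: real assume "e > 0"
      then obtain P where P: "eventually P (at t)" "\<And>x y. P x \<and> P y \<Longrightarrow> dist (?q x) (?q y) < e"
        using C unfolding cauchy_filter_metric_filtermap by metis
      then show "\<exists>d>0. \<forall>s s'. s \<noteq> t \<and> \<bar>s - t\<bar> < d \<and> s' \<noteq> t \<and> \<bar>s' - t\<bar> < d \<longrightarrow> dist (?q s) (?q s') < e"
      proof -
        obtain d where "d > 0" "\<And>s. s \<noteq> t \<Longrightarrow> \<bar>s - t\<bar> < d \<Longrightarrow> P s"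
          using P(1) unfolding eventually_at dist_real_def by blast
        then show ?thesis using P(2) by blast
      qed
    qed
  next
    assume R: ?R
    show "cauchy_filter (filtermap ?q (at t))"
      unfolding cauchy_filter_metric_filtermap
    proof (intro allI impI)
      fix e :: real assume "e > 0"
      then obtain d where "d > 0" and
        d: "\<forall>s s'. s \<noteq> t \<and> \<bar>s - t\<bar> < d \<and> s' \<noteq> t \<and> \<bar>s' - t\<bar> < d \<longrightarrow> dist (?q s) (?q s') < e"
        using R by metis
      show "\<exists>P. eventually P (at t) \<and> (\<forall>x y. P x \<and> P y \<longrightarrow> dist (?q x) (?q y) < e)"
        using d \<open>d > 0\<close>
        by (intro exI[of _ "\<lambda>s. s \<noteq> t \<and> \<bar>s - t\<bar> < d"]) (auto simp: eventually_at dist_real_def)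
    qed
  qed
  finally show ?thesis .
qed

text \<open>Where \<open>f\<close> is not differentiable its difference quotients oscillate, but those of \<open>g\<close> do not, so
  those of \<open>f - g\<close> must be large.\<close>

lemma variation_limit_differentiable_ae:
  fixes f :: "real \<Rightarrow> 'a::euclidean_space"
  assumes approx: "\<And>K. K > 0 \<Longrightarrow>
    \<exists>g. (\<forall>t\<in>{a<..<b}. g differentiable (at t)) \<and> variation_le (\<lambda>t. f t - g t) a b K"
  shows "negligible {t \<in> {a<..<b}. \<not> f differentiable (at t)}"
proof -
  let ?q = "\<lambda>f t s. (f s - f t) /\<^sub>R (s - t)"
  \<comment> \<open>The points at which the difference quotients of \<open>f\<close> oscillate by at
    least \<open>e\<close> at all scales.\<close>
  define E where "E = (\<lambda>e. {t \<in> {a<..<b}. \<forall>d>0. \<exists>s s'. s \<noteq> t \<and> \<bar>s - t\<bar> < d \<and> s' \<noteq> t \<and> \<bar>s' - t\<bar> < d \<and>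
       dist (?q f t s) (?q f t s') \<ge> e})"
  have neg: "negligible (E e)" if "e > 0" for e
    unfolding negligible_outer_le
  proof (intro allI impI)
    fix \<epsilon> :: real assume "\<epsilon> > 0"
    \<comment> \<open>The tolerance is chosen so that the weak bound at level \<open>e / 4\<close>
      yields exactly \<open>5 * (\<epsilon> * e / 20) / (e / 4) = \<epsilon>\<close>.\<close>
    obtain g where g: "\<And>t. t \<in> {a<..<b} \<Longrightarrow> g differentiable (at t)"
      and var: "variation_le (\<lambda>t. f t - g t) a b (\<epsilon> * e / 20)"
      using approx[of "\<epsilon> * e / 20"] \<open>\<epsilon> > 0\<close> \<open>e > 0\<close> by (metis divide_pos_pos mult_pos_pos zero_less_numeral)
    define h where "h = (\<lambda>t. f t - g t)"
    obtain U where U: "U \<in> lmeasurable" "measure lebesgue U \<le> 5 * (\<epsilon> * e / 20) / (e / 4)"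
      "{t \<in> {a..b}. \<exists>s\<in>{a..b}. e / 4 * \<bar>s - t\<bar> < norm (h s - h t)} \<subseteq> U"
      using difference_quotient_weak_bound[OF var, of "e / 4"] \<open>e > 0\<close> unfolding h_def by auto
    have "E e \<subseteq> U"
    proof
      fix t assume t: "t \<in> E e"
      then have tab: "t \<in> {a<..<b}" by (simp add: E_def)
      obtain d where d: "d > 0" and
        dg: "\<And>s s'. s \<noteq> t \<and> \<bar>s - t\<bar> < d \<and> s' \<noteq> t \<and> \<bar>s' - t\<bar> < d \<longrightarrow> dist (?q g t s) (?q g t s') < e / 2"
        using g[OF tab] \<open>e > 0\<close> unfolding differentiable_iff_cauchy_quotient by (meson half_gt_zero)
      \<comment> \<open>The distances to \<open>a\<close> and \<open>b\<close> keep the test points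
        inside \<open>[a,b]\<close>, where the variation of \<open>h\<close> is controlled.\<close>
      define d' where "d' = min d (min (t - a) (b - t))"
      have "d' > 0" using d tab by (simp add: d'_def)
      then obtain s s' where s: "s \<noteq> t" "\<bar>s - t\<bar> < d'" "s' \<noteq> t" "\<bar>s' - t\<bar> < d'"
        "dist (?q f t s) (?q f t s') \<ge> e"
        using t unfolding E_def by blast
      have q: "?q f t s = ?q g t s + ?q h t s" for s
        by (simp add: h_def algebra_simps)
      have "e \<le> dist (?q g t s) (?q g t s') + norm (?q h t s) + norm (?q h t s')"
      proof -
        have "dist (?q f t s) (?q f t s') = norm ((?q g t s - ?q g t s') + (?q h t s - ?q h t s'))"
          by (simp only: q dist_norm) (simp add: algebra_simps)
        also have "\<dots> \<le> norm (?q g t s - ?q g t s') + norm (?q h t s - ?q h t s')"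
          by (rule norm_triangle_ineq)
        also have "norm (?q h t s - ?q h t s') \<le> norm (?q h t s) + norm (?q h t s')"
          by (rule norm_triangle_ineq4)
        finally show ?thesis using s(5) by (simp add: dist_norm)
      qed
      moreover have "dist (?q g t s) (?q g t s') < e / 2"
      proof -
        have "\<bar>s - t\<bar> < d" "\<bar>s' - t\<bar> < d" using s(2,4) by (auto simp: d'_def)
        then show ?thesis using dg s(1,3) by blast
      qed
      \<comment> \<open>An oscillation of at least \<open>e\<close>, of which \<open>g\<close>
        explains less than \<open>e / 2\<close>, leaves more than \<open>e / 2\<close> to two
        quotients of \<open>h\<close>.\<close>
      ultimately have "norm (?q h t s) > e / 4 \<or> norm (?q h t s') > e / 4" by linarith
      then obtain \<sigma> where \<sigma>: "\<sigma> \<noteq> t" "\<bar>\<sigma> - t\<bar> < d'" "norm (?q h t \<sigma>) > e / 4"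
        using s by blast
      have "e / 4 * \<bar>\<sigma> - t\<bar> < norm (?q h t \<sigma>) * \<bar>\<sigma> - t\<bar>"
        using \<sigma> by (intro mult_strict_right_mono) auto
      also have "\<dots> = norm (h \<sigma> - h t)" using \<sigma>(1) by simp
      finally have "e / 4 * \<bar>\<sigma> - t\<bar> < norm (h \<sigma> - h t)" .
      moreover have "\<sigma> \<in> {a..b}" "t \<in> {a..b}" using \<sigma>(2) tab unfolding d'_def by auto
      ultimately show "t \<in> U" using U(3) by blast
    qed
    moreover have "5 * (\<epsilon> * e / 20) / (e / 4) = \<epsilon>" using \<open>e > 0\<close> by simp
    ultimately show "\<exists>T. E e \<subseteq> T \<and> T \<in> lmeasurable \<and> measure lebesgue T \<le> \<epsilon>"
      using U by metis
  qed
  have "{t \<in> {a<..<b}. \<not> f differentiable (at t)} \<subseteq> (\<Union>n. E (1 / real (Suc n)))"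
  proof
    fix t assume t: "t \<in> {t \<in> {a<..<b}. \<not> f differentiable (at t)}"
    then obtain e where e: "e > 0" and ne: "\<not> (\<exists>d>0. \<forall>s s'. s \<noteq> t \<and> \<bar>s - t\<bar> < d \<and> s' \<noteq> t \<and>
        \<bar>s' - t\<bar> < d \<longrightarrow> dist (?q f t s) (?q f t s') < e)"
      unfolding differentiable_iff_cauchy_quotient mem_Collect_eq by meson
    obtain n where "1 / real (Suc n) < e" using nat_approx_posE[OF e] by blast
    then have n: "e \<le> x \<Longrightarrow> 1 / real (Suc n) \<le> x" for x by linarith
    have "t \<in> E (1 / real (Suc n))"
      unfolding E_def
    proof (intro CollectI conjI allI impI)
      show "t \<in> {a<..<b}" using t by blast
      fix d :: real assume "d > 0"
      with ne obtain s s' where "s \<noteq> t \<and> \<bar>s - t\<bar> < d \<and> s' \<noteq> t \<and> \<bar>s' - t\<bar> < d \<and>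
          \<not> dist (?q f t s) (?q f t s') < e"
        by blast
      then have s: "s \<noteq> t" "\<bar>s - t\<bar> < d" "s' \<noteq> t" "\<bar>s' - t\<bar> < d"
        "dist (?q f t s) (?q f t s') \<ge> e"
        by simp_all
      then show "\<exists>s s'. s \<noteq> t \<and> \<bar>s - t\<bar> < d \<and> s' \<noteq> t \<and> \<bar>s' - t\<bar> < d \<and>
          dist (?q f t s) (?q f t s') \<ge> 1 / real (Suc n)"
        using n[OF s(5)] by (intro exI[of _ s] exI[of _ s'] conjI)
    qed
    then show "t \<in> (\<Union>n. E (1 / real (Suc n)))" by blast
  qed
  moreover have "negligible (\<Union>n. E (1 / real (Suc n)))"
    by (intro negligible_countable_Union) (auto intro!: neg)
  ultimately show ?thesis by (rule negligible_subset[rotated])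
qed

section \<open>Power means and limits of integrals\<close>

text \<open>A convex function lies above its tangents. The point \<open>u = 0\<close> lies outside
  the open half-line on which convexity is used and is checked separately: there the claim reduces
  to \<open>(1 - p) * m powr p \<le> 0\<close>.\<close>

lemma powr_above_tangent:
  fixes u m p :: real
  assumes "p \<ge> 1" "u \<ge> 0" "m > 0"
  shows "m powr p + p * m powr (p - 1) * (u - m) \<le> u powr p"
proof (cases "u = 0")
  case True
  have "m powr (p - 1) * m = m powr p" using \<open>m > 0\<close> by (simp add: powr_diff)
  then have "m powr p + p * m powr (p - 1) * (u - m) = (1 - p) * m powr p"
    using True by (simp add: algebra_simps)
  also have "\<dots> \<le> 0" using \<open>p \<ge> 1\<close> by (intro mult_nonpos_nonneg) auto
  finally show ?thesis using True by simp
next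
  case False
  have "p * m powr (p - 1) * (u - m) \<le> u powr p - m powr p"
  proof (rule convex_on_imp_above_tangent[of "{0<..}" "\<lambda>x. x powr p"])
    show "convex_on {0<..} (\<lambda>x. x powr p)" by (rule powr_convex) fact
    show "((\<lambda>x. x powr p) has_real_derivative p * m powr (p - 1)) (at m within {0<..})"
      by (rule has_field_derivative_at_within[OF has_real_derivative_powr[OF \<open>m > 0\<close>]])
    show "m \<in> interior {0<..}" using \<open>m > 0\<close> by (simp add: interior_open)
    show "connected {0::real<..}" by (rule connected_Ioi)
    show "u \<in> {0<..}" using False \<open>u \<ge> 0\<close> by simp
  qed
  then show ?thesis by simp
qed

text \<open>Jensen's inequality for weights of total mass at most \<open>V\<close>: the tangent
  inequality at \<open>m\<close>, the weighted sum divided by \<open>V\<close>, is summed against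
  the weights.\<close>

lemma sum_powr_le:
  fixes c x :: "'i \<Rightarrow> real"
  assumes "p \<ge> 1" "V > 0" and c: "\<And>i. i \<in> I \<Longrightarrow> 0 \<le> c i" and x: "\<And>i. i \<in> I \<Longrightarrow> 0 \<le> x i"
    and sum: "(\<Sum>i\<in>I. c i) \<le> V"
  shows "(\<Sum>i\<in>I. c i * x i) powr p \<le> V powr (p - 1) * (\<Sum>i\<in>I. c i * x i powr p)"
proof (cases "(\<Sum>i\<in>I. c i * x i) = 0")
  case True
  then show ?thesis using c by (simp add: sum_nonneg)
next
  case False
  define m where "m = (\<Sum>i\<in>I. c i * x i) / V"
  have nn: "(\<Sum>i\<in>I. c i * x i) \<ge> 0" using c x by (intro sum_nonneg) auto
  then have m: "m > 0" using False \<open>V > 0\<close> unfolding m_def by simp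
  have mm: "m powr (p - 1) * m = m powr p" using m by (simp add: powr_diff)
  have "V * m powr p \<le> (\<Sum>i\<in>I. c i) * (m powr p * (1 - p)) + p * m powr (p - 1) * (V * m)"
  proof -
    \<comment> \<open>The mass of the weights may fall short of \<open>V\<close>; since
      \<open>1 - p\<close> is not positive, replacing it by \<open>V\<close> goes in the right
      direction.\<close>
    have "V * (m powr p * (1 - p)) \<le> (\<Sum>i\<in>I. c i) * (m powr p * (1 - p))"
      using sum \<open>p \<ge> 1\<close> by (intro mult_right_mono_neg mult_nonneg_nonpos) auto
    moreover have eq: "p * m powr (p - 1) * (V * m) = p * V * m powr p"
      by (simp add: mm[symmetric])
    ultimately show ?thesis unfolding eq by (simp add: algebra_simps)
  qed
  also have "\<dots> = (\<Sum>i\<in>I. c i * (m powr p + p * m powr (p - 1) * (x i - m)))"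
  proof -
    have "V * m = (\<Sum>i\<in>I. c i * x i)" using \<open>V > 0\<close> by (simp add: m_def)
    then have "(\<Sum>i\<in>I. c i) * (m powr p * (1 - p)) + p * m powr (p - 1) * (V * m)
        = (\<Sum>i\<in>I. c i * (m powr p * (1 - p)) + p * m powr (p - 1) * (c i * x i))"
      by (simp add: sum.distrib sum_distrib_left sum_distrib_right)
    also have "\<dots> = (\<Sum>i\<in>I. c i * (m powr p + p * m powr (p - 1) * (x i - m)))"
      by (intro sum.cong refl) (simp add: mm[symmetric] algebra_simps)
    finally show ?thesis .
  qed
  also have "\<dots> \<le> (\<Sum>i\<in>I. c i * x i powr p)"
    using c x m \<open>p \<ge> 1\<close> by (intro sum_mono mult_left_mono powr_above_tangent) auto
  finally have "V * m powr p \<le> (\<Sum>i\<in>I. c i * x i powr p)" .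
  then have "V powr (p - 1) * (V * m powr p) \<le> V powr (p - 1) * (\<Sum>i\<in>I. c i * x i powr p)"
    by (intro mult_left_mono) auto
  moreover have "V powr (p - 1) * (V * m powr p) = (V * m) powr p"
    using \<open>V > 0\<close> m by (simp add: powr_mult powr_diff)
  moreover have "V * m = (\<Sum>i\<in>I. c i * x i)" using \<open>V > 0\<close> by (simp add: m_def)
  ultimately show ?thesis by simp
qed

text \<open>Jensen's inequality again, with the tangent at the mean value \<open>m\<close> of
  \<open>g\<close>; its linear term integrates to zero.\<close>

lemma integral_powr_le:
  fixes g :: "real \<Rightarrow> real"
  assumes "p \<ge> 1" "u \<le> v" and g: "\<And>x. x \<in> {u..v} \<Longrightarrow> 0 \<le> g x" "g integrable_on {u..v}"
    and gp: "(\<lambda>x. g x powr p) integrable_on {u..v}"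
  shows "(integral {u..v} g) powr p \<le> (v - u) powr (p - 1) * integral {u..v} (\<lambda>x. g x powr p)"
proof (cases "integral {u..v} g = 0")
  case True
  then show ?thesis using gp by (simp add: integral_nonneg)
next
  case False
  have nn: "integral {u..v} g \<ge> 0" using g by (intro integral_nonneg) auto
  have "u < v" using False \<open>u \<le> v\<close> by (cases "u = v") auto
  define V where "V = v - u"
  have V: "V > 0" using \<open>u < v\<close> by (simp add: V_def)
  define m where "m = integral {u..v} g / V"
  have m: "m > 0" using False nn V unfolding m_def by simp
  have mV: "integral {u..v} g = V * m" using V by (simp add: m_def)
  have const: "((\<lambda>_. k) has_integral V *\<^sub>R k) {u..v}" for k :: real
    using has_integral_const_real[of k u v] \<open>u < v\<close> by (simp add: V_def)
  have "((\<lambda>x. m powr p + p * m powr (p - 1) * (g x - m)) has_integral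
      (V *\<^sub>R m powr p + p * m powr (p - 1) * (integral {u..v} g - V *\<^sub>R m))) {u..v}"
    using const g
    by (intro has_integral_add has_integral_mult_right has_integral_diff integrable_integral) auto
  moreover have "V *\<^sub>R m powr p + p * m powr (p - 1) * (integral {u..v} g - V *\<^sub>R m) = V * m powr p"
    by (simp add: mV)
  ultimately have "((\<lambda>x. m powr p + p * m powr (p - 1) * (g x - m)) has_integral V * m powr p) {u..v}"
    by (simp only:)
  then have "V * m powr p \<le> integral {u..v} (\<lambda>x. g x powr p)"
    by (rule has_integral_le[OF _ integrable_integral[OF gp]])
      (rule powr_above_tangent[OF \<open>p \<ge> 1\<close> g(1) m])
  then have "V powr (p - 1) * (V * m powr p) \<le> V powr (p - 1) * integral {u..v} (\<lambda>x. g x powr p)"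
    by (intro mult_left_mono) auto
  moreover have "V powr (p - 1) * (V * m powr p) = (V * m) powr p"
    using V m by (simp add: powr_mult powr_diff)
  ultimately show ?thesis by (simp add: mV V_def)
qed

text \<open>Fatou's lemma. It serves twice: in passing from point sums to the flow, and from
  difference quotients to the derivative.\<close>

lemma integrable_limit_of_bounded_integrals:
  fixes f :: "nat \<Rightarrow> 'a \<Rightarrow> real"
  assumes f: "\<And>n. integrable M (f n)" "\<And>n x. x \<in> space M \<Longrightarrow> 0 \<le> f n x"
    and K: "\<And>n. integral\<^sup>L M (f n) \<le> K"
    and lim: "AE x in M. (\<lambda>n. f n x) \<longlonglongrightarrow> g x" and g: "g \<in> borel_measurable M"
  shows "integrable M g" "integral\<^sup>L M g \<le> K"
proof -
  have nn: "AE x in M. 0 \<le> g x"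
    using lim AE_space
  proof eventually_elim
    case (elim x)
    then show ?case using f(2) by (intro LIMSEQ_le_const) auto
  qed
  have "0 \<le> K"
    using K[of 0] integral_nonneg_AE[of "f 0" M] f(2) by (smt (verit) AE_I2)
  have "(\<integral>\<^sup>+x. ennreal (g x) \<partial>M) = (\<integral>\<^sup>+x. liminf (\<lambda>n. ennreal (f n x)) \<partial>M)"
    using lim
  proof (intro nn_integral_cong_AE, eventually_elim)
    case (elim x)
    from elim have "(\<lambda>n. ennreal (f n x)) \<longlonglongrightarrow> ennreal (g x)" by (intro tendsto_ennrealI)
    then show ?case using lim_imp_Liminf trivial_limit_sequentially by metis
  qed
  also have "\<dots> \<le> liminf (\<lambda>n. \<integral>\<^sup>+x. ennreal (f n x) \<partial>M)"
    by (intro nn_integral_liminf measurable_compose[OF _ measurable_ennreal] borel_measurable_integrable f)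
  also have "\<dots> \<le> liminf (\<lambda>n. ennreal K)"
  proof (intro Liminf_mono always_eventually allI)
    fix n
    have "(\<integral>\<^sup>+x. ennreal (f n x) \<partial>M) = ennreal (integral\<^sup>L M (f n))"
      by (intro nn_integral_eq_integral f AE_I2)
    then show "(\<integral>\<^sup>+x. ennreal (f n x) \<partial>M) \<le> ennreal K"
      using K by (simp add: ennreal_leI)
  qed
  finally have le: "(\<integral>\<^sup>+x. ennreal (g x) \<partial>M) \<le> ennreal K"
    by (simp only: Liminf_const[OF trivial_limit_sequentially])
  then show int: "integrable M g"
    by (intro integrableI_nonneg g nn) (rule le_less_trans, auto)
  show "integral\<^sup>L M g \<le> K"
    using le nn_integral_eq_integral[OF int nn] \<open>0 \<le> K\<close> by simp
qed

text \<open>After the shift everything cancels except two windows of length \<open>h\<close> at the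
  ends. The bound is thus linear in \<open>h\<close> without any smoothness of \<open>U\<close>,
  which is what makes difference quotients bounded later.\<close>

lemma integral_increment_le:
  fixes U :: "real \<Rightarrow> real"
  assumes U: "continuous_on {\<alpha>..\<beta>} U" "mono_on {\<alpha>..\<beta>} U"
    and "\<alpha> \<le> a" "a \<le> b" "0 \<le> h" "b + h \<le> \<beta>"
  shows "integral {a..b} (\<lambda>t. U (t + h) - U t) \<le> h * (U \<beta> - U \<alpha>)"
proof -
  have int: "U integrable_on {x..y}" if "\<alpha> \<le> x" "y \<le> \<beta>" for x y
    using that by (intro integrable_continuous_real continuous_on_subset[OF U(1)]) auto
  have shift: "((\<lambda>t. U (t + h)) has_integral integral {a+h..b+h} U) {a..b}"
    using integrable_integral[OF int[of "a + h" "b + h"]] assms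
      has_integral_shift_real_ivl_iff[of U _ "a + h" "b + h" h] by simp
  have "integral {a..b} (\<lambda>t. U (t + h) - U t) = integral {a+h..b+h} U - integral {a..b} U"
    using has_integral_diff[OF shift integrable_integral[OF int[of a b]]] assms
    by (intro integral_unique) simp
  also have "\<dots> = integral {b..b+h} U - integral {a..a+h} U"
    using Henstock_Kurzweil_Integration.integral_combine[of a b "b + h" U]
      Henstock_Kurzweil_Integration.integral_combine[of a "a + h" "b + h" U]
      int[of a "b + h"] assms by simp
  also have "\<dots> \<le> h * U \<beta> - h * U \<alpha>"
  proof (rule diff_mono)
    have "integral {b..b+h} U \<le> integral {b..b+h} (\<lambda>_. U \<beta>)"
      using assms by (intro integral_le int) (auto intro!: mono_onD[OF U(2)])
    then show "integral {b..b+h} U \<le> h * U \<beta>" using \<open>0 \<le> h\<close> by simp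
    have "integral {a..a+h} (\<lambda>_. U \<alpha>) \<le> integral {a..a+h} U"
      using assms by (intro integral_le int) (auto intro!: mono_onD[OF U(2)])
    then show "h * U \<alpha> \<le> integral {a..a+h} U" using \<open>0 \<le> h\<close> by simp
  qed
  finally show ?thesis by (simp add: algebra_simps)
qed

text \<open>Truncating to norm at most \<open>M\<close> by the continuous map \<open>\<rho> M\<close> makes the almost everywhere
  convergent continuous functions that witness measurability dominated.\<close>

lemma absolutely_integrable_approx_continuous:
  fixes y :: "real \<Rightarrow> 'a::euclidean_space"
  assumes y: "y absolutely_integrable_on {a..b}" and "K > 0"
  obtains z where "continuous_on UNIV z" "integral {a..b} (\<lambda>x. norm (y x - z x)) < K"
proof -
  \<comment> \<open>The radial retraction onto the ball of radius \<open>M\<close>; the maximum in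
    the denominator keeps it continuous at the origin.\<close>
  define \<rho> where "\<rho> = (\<lambda>M (w::'a). (M / max M (norm w)) *\<^sub>R w)"
  have \<rho>_cont: "continuous_on UNIV (\<rho> M)" if "M > 0" for M
    unfolding \<rho>_def using that by (intro continuous_intros) auto
  have \<rho>_le: "norm (\<rho> M w) \<le> M" if "M > 0" for M w
    unfolding \<rho>_def using that by (auto simp: field_simps max_def)
  \<comment> \<open>The error of truncation is exactly the excess over \<open>M\<close>, which
    \<open>integrable_tail_small\<close> makes small in the mean.\<close>
  have \<rho>_diff: "norm (w - \<rho> M w) = norm w - min (norm w) M" if "M > 0" for M w
  proof -
    have "w - \<rho> M w = (1 - M / max M (norm w)) *\<^sub>R w" by (simp add: \<rho>_def algebra_simps)
    moreover have "1 - M / max M (norm w) \<ge> 0" using that by (simp add: field_simps)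
    ultimately have "norm (w - \<rho> M w) = (1 - M / max M (norm w)) * norm w" by simp
    also have "\<dots> = norm w - min (norm w) M"
      using that by (auto simp: max_def min_def field_simps)
    finally show ?thesis .
  qed
  have ny: "(\<lambda>x. norm (y x)) integrable_on {a..b}" "y integrable_on {a..b}"
    using y by (auto simp: absolutely_integrable_on_def)
  obtain M where M: "M > 0" "(\<lambda>x. min (norm (y x)) M) integrable_on {a..b}"
    "integral {a..b} (\<lambda>x. norm (y x) - min (norm (y x)) M) < K / 2"
    using integrable_tail_small[OF ny(1), of "K / 2"] \<open>K > 0\<close> by auto
  have ymeas: "y \<in> borel_measurable (lebesgue_on {a..b})"
    using ny(2) by (rule integrable_imp_measurable)
  then have "y measurable_on {a..b}"
    by (simp add: measurable_on_iff_borel_measurable)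
  then obtain N g where N: "negligible N" and g: "\<And>n. continuous_on UNIV (g n)"
    and lim: "\<And>x. x \<notin> N \<Longrightarrow> (\<lambda>n. g n x) \<longlonglongrightarrow> (if x \<in> {a..b} then y x else 0)"
    unfolding measurable_on_def by metis
  have contg: "continuous_on UNIV (\<lambda>x. \<rho> M (g n x))" for n
    using continuous_on_compose2[OF \<rho>_cont[OF M(1)] g] by simp
  have meas: "(\<lambda>x. \<rho> M (y x)) \<in> borel_measurable (lebesgue_on {a..b})"
    using measurable_compose[OF ymeas borel_measurable_continuous_onI[OF \<rho>_cont[OF M(1)]]] .
  have meas2: "(\<lambda>x. \<rho> M (g n x)) \<in> borel_measurable (lebesgue_on {a..b})" for n
    by (intro continuous_imp_measurable_on_sets_lebesgue continuous_on_subset[OF contg]) auto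
  let ?d = "\<lambda>n x. norm (\<rho> M (y x) - \<rho> M (g n x))"
  have d_le: "norm (?d n x) \<le> 2 * M" for n x
    using norm_triangle_ineq4[of "\<rho> M (y x)" "\<rho> M (g n x)"] \<rho>_le[OF M(1), of "y x"] \<rho>_le[OF M(1), of "g n x"]
    by simp
  have dint: "integrable (lebesgue_on {a..b}) (?d n)" for n
  proof (rule Bochner_Integration.integrable_bound[of _ "\<lambda>_. 2 * M"])
    show "AE x in lebesgue_on {a..b}. norm (?d n x) \<le> norm (2 * M)"
      using d_le M(1) by (intro always_eventually allI) simp
  qed (use meas meas2 in \<open>auto intro!: borel_measurable_norm borel_measurable_diff\<close>)
  have "(\<lambda>n. integral\<^sup>L (lebesgue_on {a..b}) (?d n)) \<longlonglongrightarrow> integral\<^sup>L (lebesgue_on {a..b}) (\<lambda>x. 0)"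
  proof (rule integral_dominated_convergence[where w = "\<lambda>_. 2 * M"])
    show "AE x in lebesgue_on {a..b}. norm (?d n x) \<le> 2 * M" for n
      using d_le by (intro always_eventually allI)
    have "AE x in lebesgue. x \<notin> N" using N by (simp add: negligible_iff_null_sets AE_not_in)
    then have "AE x in lebesgue_on {a..b}. x \<notin> N"
      by (subst AE_restrict_space_iff) (auto elim: eventually_mono)
    moreover have "AE x in lebesgue_on {a..b}. x \<in> {a..b}" by (rule AE_I2) simp
    ultimately show "AE x in lebesgue_on {a..b}. (\<lambda>n. ?d n x) \<longlonglongrightarrow> 0"
    proof eventually_elim
      case (elim x)
      then have "(\<lambda>n. g n x) \<longlonglongrightarrow> y x" using lim[of x] by simp
      then have "(\<lambda>n. \<rho> M (g n x)) \<longlonglongrightarrow> \<rho> M (y x)"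
        by (rule isCont_tendsto_compose[rotated]) (use \<rho>_cont[OF M(1)] in \<open>simp add: continuous_on_eq_continuous_at\<close>)
      from tendsto_norm[OF tendsto_diff[OF tendsto_const this, of "\<rho> M (y x)"]]
      show ?case by simp
    qed
  qed (use dint in \<open>auto intro: borel_measurable_integrable\<close>)
  then have "\<forall>\<^sub>F n in sequentially. integral\<^sup>L (lebesgue_on {a..b}) (?d n) < K / 2"
    using \<open>K > 0\<close> by (intro order_tendstoD) auto
  then obtain n where n: "integral\<^sup>L (lebesgue_on {a..b}) (?d n) < K / 2"
    by (auto simp: eventually_sequentially)
  then have n': "integral {a..b} (?d n) < K / 2" "?d n integrable_on {a..b}"
    using dint by (simp_all add: lebesgue_integral_eq_integral integrable_on_lebesgue_on)
  let ?z = "\<lambda>x. \<rho> M (g n x)"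
  have zabs: "?z absolutely_integrable_on {a..b}"
    by (intro absolutely_integrable_continuous_real continuous_on_subset[OF contg]) simp
  have "integral {a..b} (\<lambda>x. norm (y x - ?z x))
      \<le> integral {a..b} (\<lambda>x. (norm (y x) - min (norm (y x)) M) + ?d n x)"
  proof (rule integral_le)
    show "(\<lambda>x. norm (y x - ?z x)) integrable_on {a..b}"
      using set_integral_diff(1)[OF y zabs] by (simp add: absolutely_integrable_on_def)
    show "(\<lambda>x. (norm (y x) - min (norm (y x)) M) + ?d n x) integrable_on {a..b}"
      by (intro integrable_add integrable_diff ny M n')
    fix x show "norm (y x - ?z x) \<le> (norm (y x) - min (norm (y x)) M) + ?d n x"
      unfolding \<rho>_diff[OF M(1), symmetric]
      using norm_triangle_ineq[of "y x - \<rho> M (y x)" "\<rho> M (y x) - ?z x"] by simp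
  qed
  also have "\<dots> = integral {a..b} (\<lambda>x. norm (y x) - min (norm (y x)) M) + integral {a..b} (?d n)"
    by (intro integral_add integrable_diff ny M n')
  also have "\<dots> < K" using M(3) n'(1) by simp
  finally show ?thesis by (rule that[OF contg])
qed

section \<open>Limits of finite combinations of point evaluations\<close>

lemma norm_indefinite_integral_diff_le:
  fixes y :: "real \<Rightarrow> 'e::euclidean_space"
  assumes y: "y absolutely_integrable_on {a..b}" and "a \<le> u" "u \<le> v" "v \<le> b"
  shows "norm (integral {a..v} y - integral {a..u} y) \<le> integral {u..v} (\<lambda>x. norm (y x))"
proof -
  have int: "y integrable_on {a..v}" "y integrable_on {u..v}" "(\<lambda>x. norm (y x)) integrable_on {u..v}"
    using y assms(2-4) unfolding absolutely_integrable_on_def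
    by (auto intro: integrable_on_subinterval)
  have "integral {a..v} y - integral {a..u} y = integral {u..v} y"
    using Henstock_Kurzweil_Integration.integral_combine[OF assms(2,3) int(1)] by (simp add: algebra_simps)
  then show ?thesis using integral_norm_bound_integral[OF int(2,3)] by simp
qed

text \<open>
  Abstracts the functional \<open>L\<close>: \<open>L\<close> is the pointwise limit of finite sums of operator-weighted point
  evaluations of total mass at most \<open>V\<close>. The Riemann-Stieltjes sums of uniform partitions have this form.
\<close>

locale point_mass_limit =
  fixes r V :: real and L :: "(real \<Rightarrow> 'e::euclidean_space) \<Rightarrow> 'e"
    and m :: "nat \<Rightarrow> nat" and A :: "nat \<Rightarrow> nat \<Rightarrow> 'e \<Rightarrow> 'e" and c s :: "nat \<Rightarrow> nat \<Rightarrow> real"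
  assumes r_pos: "r > 0" and V_pos: "V > 0"
    and linear: "k < m n \<Longrightarrow> linear (A n k)"
    and bound: "k < m n \<Longrightarrow> norm (A n k v) \<le> c n k * norm v"
    and c_nonneg: "k < m n \<Longrightarrow> 0 \<le> c n k"
    and c_sum: "(\<Sum>k<m n. c n k) \<le> V"
    and point: "k < m n \<Longrightarrow> s n k \<in> {-r..0}"
    and lim: "continuous_on {-r..0} \<psi> \<Longrightarrow> (\<lambda>n. \<Sum>k<m n. A n k (\<psi> (s n k))) \<longlonglongrightarrow> L \<psi>"
begin

text \<open>If \<open>Y\<close> is an antiderivative of \<open>x\<close>, the argument of
  \<open>L\<close> is the integrated segment in the definition of a mild solution. Taking
  \<open>Y\<close> as the parameter makes linearity and translation visible.\<close>

definition flow :: "(real \<Rightarrow> 'e) \<Rightarrow> real \<Rightarrow> 'e" where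
  "flow Y t = L (\<lambda>\<theta>. Y (t + \<theta>) - Y \<theta>)"

lemma L_cong:
  assumes "continuous_on {-r..0} \<psi>" "\<And>\<theta>. \<theta> \<in> {-r..0} \<Longrightarrow> \<psi> \<theta> = \<xi> \<theta>"
  shows "L \<psi> = L \<xi>"
proof (rule LIMSEQ_unique[OF lim[OF assms(1)]])
  have "continuous_on {-r..0} \<xi>"
    using assms by (subst continuous_on_cong[OF refl, of _ _ \<psi>]) auto
  from lim[OF this] show "(\<lambda>n. \<Sum>k<m n. A n k (\<psi> (s n k))) \<longlonglongrightarrow> L \<xi>"
    using assms(2)[OF point] by simp
qed

lemma L_diff:
  assumes "continuous_on {-r..0} \<psi>" "continuous_on {-r..0} \<xi>"
  shows "L (\<lambda>\<theta>. \<psi> \<theta> - \<xi> \<theta>) = L \<psi> - L \<xi>"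
proof (rule LIMSEQ_unique[OF lim])
  have "(\<Sum>k<m n. A n k (\<psi> (s n k) - \<xi> (s n k))) =
      (\<Sum>k<m n. A n k (\<psi> (s n k))) - (\<Sum>k<m n. A n k (\<xi> (s n k)))" for n
    unfolding sum_subtractf[symmetric] by (intro sum.cong refl linear_diff linear) simp
  then show "(\<lambda>n. \<Sum>k<m n. A n k (\<psi> (s n k) - \<xi> (s n k))) \<longlonglongrightarrow> L \<psi> - L \<xi>"
    using tendsto_diff[OF lim[OF assms(1)] lim[OF assms(2)]] by simp
qed (intro continuous_intros assms)

lemma L_scaleR:
  assumes "continuous_on {-r..0} \<psi>"
  shows "L (\<lambda>\<theta>. a *\<^sub>R \<psi> \<theta>) = a *\<^sub>R L \<psi>"
proof (rule LIMSEQ_unique[OF lim])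
  have "(\<Sum>k<m n. A n k (a *\<^sub>R \<psi> (s n k))) = a *\<^sub>R (\<Sum>k<m n. A n k (\<psi> (s n k)))" for n
    unfolding scaleR_sum_right by (intro sum.cong refl linear_scale linear) simp
  then show "(\<lambda>n. \<Sum>k<m n. A n k (a *\<^sub>R \<psi> (s n k))) \<longlonglongrightarrow> a *\<^sub>R L \<psi>"
    using tendsto_scaleR[OF tendsto_const lim[OF assms], of a] by simp
qed (intro continuous_intros assms)

lemma norm_point_sum_le: "norm (\<Sum>k<m n. A n k (v k)) \<le> (\<Sum>k<m n. c n k * norm (v k))"
  by (rule order_trans[OF norm_sum sum_mono]) (simp add: bound)

text \<open>Exchanging the two sums puts the whole family at one sample point, so a bound on the
  family at each single \<open>\<theta>\<close> suffices. Estimating each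
  \<open>L (\<psi> i)\<close> by its own supremum would lose the disjointness of commonly translated
  intervals.\<close>

lemma sum_norm_L_le:
  assumes "finite I" and \<psi>: "\<And>i. i \<in> I \<Longrightarrow> continuous_on {-r..0} (\<psi> i)"
    and K: "\<And>\<theta>. \<theta> \<in> {-r..0} \<Longrightarrow> (\<Sum>i\<in>I. norm (\<psi> i \<theta>)) \<le> K"
  shows "(\<Sum>i\<in>I. norm (L (\<psi> i))) \<le> V * K"
proof (rule LIMSEQ_le_const2)
  show "(\<lambda>n. \<Sum>i\<in>I. norm (\<Sum>k<m n. A n k (\<psi> i (s n k)))) \<longlonglongrightarrow> (\<Sum>i\<in>I. norm (L (\<psi> i)))"
    by (intro tendsto_sum tendsto_norm lim \<psi>)
  have "0 \<le> K" using K[of 0] r_pos by (smt (verit) atLeastAtMost_iff norm_ge_zero sum_nonneg)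
  have "(\<Sum>i\<in>I. norm (\<Sum>k<m n. A n k (\<psi> i (s n k)))) \<le> V * K" for n
  proof -
    have "(\<Sum>i\<in>I. norm (\<Sum>k<m n. A n k (\<psi> i (s n k)))) \<le> (\<Sum>i\<in>I. \<Sum>k<m n. c n k * norm (\<psi> i (s n k)))"
      by (intro sum_mono norm_point_sum_le)
    also have "\<dots> = (\<Sum>k<m n. c n k * (\<Sum>i\<in>I. norm (\<psi> i (s n k))))"
      by (subst sum.swap) (simp add: sum_distrib_left)
    also have "\<dots> \<le> (\<Sum>k<m n. c n k * K)"
      by (intro sum_mono mult_left_mono K point c_nonneg) auto
    also have "\<dots> = (\<Sum>k<m n. c n k) * K" by (simp add: sum_distrib_right)
    also have "\<dots> \<le> V * K" by (intro mult_right_mono c_sum \<open>0 \<le> K\<close>)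
    finally show ?thesis .
  qed
  then show "\<exists>N. \<forall>n\<ge>N. (\<Sum>i\<in>I. norm (\<Sum>k<m n. A n k (\<psi> i (s n k)))) \<le> V * K" by blast
qed

lemma norm_L_le:
  assumes "continuous_on {-r..0} \<psi>" "\<And>\<theta>. \<theta> \<in> {-r..0} \<Longrightarrow> norm (\<psi> \<theta>) \<le> K"
  shows "norm (L \<psi>) \<le> V * K"
  using sum_norm_L_le[of "{()}" "\<lambda>_. \<psi>" K] assms by simp

lemma continuous_on_segment:
  assumes "continuous_on {-r..T} Y" "0 \<le> t" "t \<le> T"
  shows "continuous_on {-r..0} (\<lambda>\<theta>. Y (t + \<theta>))"
  by (rule continuous_on_compose2[OF assms(1)]) (use assms in \<open>auto intro!: continuous_intros\<close>)

lemma flow_diff: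
  assumes Y: "continuous_on {-r..T} Y" and "0 \<le> u" "u \<le> T" "0 \<le> v" "v \<le> T"
  shows "flow Y v - flow Y u = L (\<lambda>\<theta>. Y (v + \<theta>) - Y (u + \<theta>))"
proof -
  note c = continuous_on_segment[OF Y]
  have c0: "continuous_on {-r..0} Y" using c[of 0] assms by simp
  show ?thesis
    unfolding flow_def using assms
    by (subst L_diff[symmetric]) (auto intro!: continuous_intros c c0)
qed

lemma flow_variation:
  assumes Y: "continuous_on {-r..T} Y" and "finite I"
    and uv: "\<And>i. i \<in> I \<Longrightarrow> 0 \<le> u i \<and> u i \<le> v i \<and> v i \<le> T"
    and K: "\<And>\<theta>. \<theta> \<in> {-r..0} \<Longrightarrow> (\<Sum>i\<in>I. norm (Y (v i + \<theta>) - Y (u i + \<theta>))) \<le> K"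
  shows "(\<Sum>i\<in>I. norm (flow Y (v i) - flow Y (u i))) \<le> V * K"
proof -
  have "(\<Sum>i\<in>I. norm (flow Y (v i) - flow Y (u i))) =
      (\<Sum>i\<in>I. norm (L (\<lambda>\<theta>. Y (v i + \<theta>) - Y (u i + \<theta>))))"
    by (intro sum.cong refl arg_cong[where f = norm] flow_diff[OF Y]) (use uv in force)+
  also have "\<dots> \<le> V * K"
    by (intro sum_norm_L_le assms(2) K continuous_intros continuous_on_segment[OF Y]) (use uv in force)+
  finally show ?thesis .
qed

lemma flow_lipschitz:
  assumes Y: "continuous_on {-r..T} Y" and "0 \<le> u" "u \<le> v" "v \<le> T"
    and K: "\<And>a b. \<lbrakk>-r \<le> a; a \<le> b; b \<le> T\<rbrakk> \<Longrightarrow> norm (Y b - Y a) \<le> K * (b - a)"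
  shows "norm (flow Y v - flow Y u) \<le> V * (K * (v - u))"
  using flow_variation[OF Y, of "{()}" "\<lambda>_. u" "\<lambda>_. v" "K * (v - u)"] K[of "u + \<theta>" "v + \<theta>" for \<theta>] assms by auto

text \<open>Uniform continuity of \<open>z\<close> on the compact window and the mean value
  inequality make the difference quotients of \<open>Y\<close> at \<open>t + \<theta>\<close>
  converge uniformly in \<open>\<theta>\<close>, and \<open>L\<close> is bounded. The margin
  \<open>\<delta>\<close> keeps the translates inside the window for times near \<open>t\<close>.
  The result is applied to continuous approximations and, beyond time \<open>r\<close>, to the
  solution itself.\<close>

lemma flow_has_vector_derivative:
  assumes Y: "continuous_on {-r..T} Y" and t: "0 < t" "t < T" and "\<delta> > 0"
    and sub: "-r \<le> t - r - \<delta>" "t + \<delta> \<le> T"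
    and z: "continuous_on {t-r-\<delta>..t+\<delta>} z"
    and deriv: "\<And>\<sigma>. \<sigma> \<in> {t-r-\<delta>..t+\<delta>} \<Longrightarrow> (Y has_vector_derivative z \<sigma>) (at \<sigma> within {t-r-\<delta>..t+\<delta>})"
  shows "(flow Y has_vector_derivative L (\<lambda>\<theta>. z (t + \<theta>))) (at t)"
proof -
  let ?J = "{t-r-\<delta>..t+\<delta>}"
  have zc: "continuous_on {-r..0} (\<lambda>\<theta>. z (t + \<theta>))"
    by (rule continuous_on_compose2[OF z]) (use \<open>\<delta> > 0\<close> in \<open>auto intro!: continuous_intros\<close>)
  have "\<exists>d>0. \<forall>w. \<bar>w - t\<bar> < d \<longrightarrow>
      norm (flow Y w - flow Y t - (w - t) *\<^sub>R L (\<lambda>\<theta>. z (t + \<theta>))) \<le> e * \<bar>w - t\<bar>" if "e > 0" for e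
  proof -
    have "uniformly_continuous_on ?J z" by (rule compact_uniformly_continuous[OF z]) simp
    moreover have "e / V > 0" using \<open>e > 0\<close> V_pos by simp
    ultimately obtain d where "d > 0" and
      d: "\<And>a b. a \<in> ?J \<Longrightarrow> b \<in> ?J \<Longrightarrow> dist a b < d \<Longrightarrow> dist (z a) (z b) < e / V"
      unfolding uniformly_continuous_on_def by metis
    \<comment> \<open>The bound by \<open>t\<close> keeps \<open>w\<close> nonnegative and the bound
      by \<open>\<delta>\<close> keeps it below \<open>T\<close>, so that \<open>flow_diff\<close>
      applies.\<close>
    define d' where "d' = min d (min \<delta> t)"
    have "d' > 0" using \<open>d > 0\<close> \<open>\<delta> > 0\<close> t by (simp add: d'_def)
    moreover have "norm (flow Y w - flow Y t - (w - t) *\<^sub>R L (\<lambda>\<theta>. z (t + \<theta>))) \<le> e * \<bar>w - t\<bar>"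
      if w: "\<bar>w - t\<bar> < d'" for w
    proof -
      have w': "0 \<le> w" "w \<le> T" "\<bar>w - t\<bar> < \<delta>" "\<bar>w - t\<bar> < d" using w sub unfolding d'_def by auto
      have c1: "continuous_on {-r..0} (\<lambda>\<theta>. Y (w + \<theta>) - Y (t + \<theta>))"
        using w' t by (intro continuous_intros continuous_on_segment[OF Y]) auto
      have "flow Y w - flow Y t - (w - t) *\<^sub>R L (\<lambda>\<theta>. z (t + \<theta>)) =
          L (\<lambda>\<theta>. Y (w + \<theta>) - Y (t + \<theta>)) - L (\<lambda>\<theta>. (w - t) *\<^sub>R z (t + \<theta>))"
        using flow_diff[OF Y, of t w] L_scaleR[OF zc] w' t by simp
      also have "\<dots> = L (\<lambda>\<theta>. (Y (w + \<theta>) - Y (t + \<theta>)) - (w - t) *\<^sub>R z (t + \<theta>))"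
        by (intro L_diff[symmetric] c1 continuous_intros zc)
      also have "norm \<dots> \<le> V * (\<bar>w - t\<bar> * (e / V))"
      proof (rule norm_L_le)
        show "continuous_on {-r..0} (\<lambda>\<theta>. (Y (w + \<theta>) - Y (t + \<theta>)) - (w - t) *\<^sub>R z (t + \<theta>))"
          by (intro c1 continuous_intros zc)
        fix \<theta> assume \<theta>: "\<theta> \<in> {-r..0}"
        let ?S = "closed_segment (t + \<theta>) (w + \<theta>)"
        have S: "?S \<subseteq> ?J"
          using \<theta> w'(3) by (auto simp: closed_segment_eq_real_ivl split: if_splits)
        have near: "dist \<sigma> (t + \<theta>) < d" if "\<sigma> \<in> ?S" for \<sigma>
          using that w'(4) by (auto simp: closed_segment_eq_real_ivl dist_real_def split: if_splits)
        have "norm (Y (w + \<theta>) - Y (t + \<theta>) - ((w + \<theta>) - (t + \<theta>)) *\<^sub>R z (t + \<theta>))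
            \<le> norm ((w + \<theta>) - (t + \<theta>)) * (e / V)"
        proof (rule vector_differentiable_bound_linearization[where S = ?S])
          show "(Y has_vector_derivative z \<sigma>) (at \<sigma> within ?S)" if "\<sigma> \<in> ?S" for \<sigma>
            using deriv[of \<sigma>] S that by (meson has_vector_derivative_within_subset subsetD)
          show "norm (z \<sigma> - z (t + \<theta>)) \<le> e / V" if "\<sigma> \<in> ?S" for \<sigma>
          proof -
            have "dist (z \<sigma>) (z (t + \<theta>)) < e / V"
              using S that by (intro d near) auto
            then show ?thesis by (simp add: dist_norm)
          qed
        qed auto
        then show "norm (Y (w + \<theta>) - Y (t + \<theta>) - (w - t) *\<^sub>R z (t + \<theta>)) \<le> \<bar>w - t\<bar> * (e / V)"
          by simp
      qed
      also have "\<dots> = e * \<bar>w - t\<bar>" using V_pos by simp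
      finally show ?thesis .
    qed
    ultimately show ?thesis by blast
  qed
  then show ?thesis
    unfolding has_vector_derivative_def has_derivative_within_alt
    by (auto simp: bounded_linear_scaleR_left)
qed

lemma flow_differentiable_ae:
  assumes y: "y absolutely_integrable_on {-r..T}" and "T > 0"
  shows "negligible {t \<in> {0<..<T}. \<not> flow (\<lambda>t. integral {-r..t} y) differentiable (at t)}"
proof (rule variation_limit_differentiable_ae)
  let ?Y = "\<lambda>t. integral {-r..t} y"
  fix K :: real assume "K > 0"
  \<comment> \<open>The accuracy is \<open>K / V\<close> because passing to the flow multiplies
    variation by at most \<open>V\<close>.\<close>
  then obtain z where z: "continuous_on UNIV z" "integral {-r..T} (\<lambda>x. norm (y x - z x)) < K / V"
    using absolutely_integrable_approx_continuous[OF y, of "K / V"] V_pos by auto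
  let ?Z = "\<lambda>t. integral {-r..t} z"
  have zT: "continuous_on {-r..T} z" by (rule continuous_on_subset[OF z(1)]) simp
  have yint: "y integrable_on {-r..T}" and zint: "z integrable_on {-r..T}"
    using y zT by (auto simp: absolutely_integrable_on_def intro: integrable_continuous_real)
  have wabs: "(\<lambda>x. y x - z x) absolutely_integrable_on {-r..T}"
    by (rule set_integral_diff(1)[OF y absolutely_integrable_continuous_real[OF zT]])
  then have nint: "(\<lambda>x. norm (y x - z x)) integrable_on {-r..T}"
    by (simp add: absolutely_integrable_on_def)
  have Yc: "continuous_on {-r..T} ?Y" and Zc: "continuous_on {-r..T} ?Z"
    by (intro indefinite_integral_continuous_1 yint zint)+
  show "\<exists>g. (\<forall>t\<in>{0<..<T}. g differentiable (at t)) \<and> variation_le (\<lambda>t. flow ?Y t - g t) 0 T K"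
  proof (intro exI[of _ "flow ?Z"] conjI ballI)
    fix t assume t: "t \<in> {0<..<T}"
    \<comment> \<open>The largest margin for which the window
      \<open>[t - r - \<delta>, t + \<delta>]\<close> stays in \<open>[-r,T]\<close>.\<close>
    define \<delta> where "\<delta> = min t (T - t)"
    have \<delta>: "\<delta> > 0" "-r \<le> t - r - \<delta>" "t + \<delta> \<le> T" using t by (auto simp: \<delta>_def)
    have "(flow ?Z has_vector_derivative L (\<lambda>\<theta>. z (t + \<theta>))) (at t)"
    proof (rule flow_has_vector_derivative[OF Zc _ _ \<delta>])
      show "continuous_on {t - r - \<delta>..t + \<delta>} z" by (rule continuous_on_subset[OF z(1)]) simp
      fix \<sigma> assume "\<sigma> \<in> {t - r - \<delta>..t + \<delta>}"
      then show "(?Z has_vector_derivative z \<sigma>) (at \<sigma> within {t - r - \<delta>..t + \<delta>})"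
        using \<delta> by (intro has_vector_derivative_within_subset[OF integral_has_vector_derivative[OF zT]]) auto
    qed (use t in auto)
    then show "flow ?Z differentiable (at t)" by (rule differentiableI_vector)
  next
    show "variation_le (\<lambda>t. flow ?Y t - flow ?Z t) 0 T K"
      unfolding variation_le_def
    proof (intro allI impI)
      fix C :: "(real \<times> real) set"
      assume C: "finite C" "\<forall>(u,v)\<in>C. 0 \<le> u \<and> u \<le> v \<and> v \<le> T"
        "pairwise (\<lambda>(u,v) (u',v'). {u<..<v} \<inter> {u'<..<v'} = {}) C"
      let ?W = "\<lambda>t. ?Y t - ?Z t"
      have C2: "\<And>p. p \<in> C \<Longrightarrow> 0 \<le> fst p \<and> fst p \<le> snd p \<and> snd p \<le> T" using C(2) by auto
      have C3: "\<And>p q. p \<in> C \<Longrightarrow> q \<in> C \<Longrightarrow> p \<noteq> q \<Longrightarrow> {fst p<..<snd p} \<inter> {fst q<..<snd q} = {}"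
        using C(3) unfolding pairwise_def case_prod_unfold by blast
      \<comment> \<open>Linearity of \<open>L\<close> turns the error into the flow of
        \<open>?W\<close>, whose increments are integrals of \<open>y - z\<close>.\<close>
      have flowW: "flow ?Y t - flow ?Z t = flow ?W t" if "0 \<le> t" "t \<le> T" for t
      proof -
        have c0: "continuous_on {-r..0} ?Y" "continuous_on {-r..0} ?Z"
          using continuous_on_segment[OF Yc, of 0] continuous_on_segment[OF Zc, of 0] \<open>T > 0\<close> by auto
        have "flow ?Y t - flow ?Z t =
            L (\<lambda>\<theta>. (?Y (t + \<theta>) - ?Y \<theta>) - (?Z (t + \<theta>) - ?Z \<theta>))"
          unfolding flow_def using that
          by (intro L_diff[symmetric] continuous_on_diff continuous_on_segment[OF Yc] continuous_on_segment[OF Zc] c0)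
        also have "\<dots> = flow ?W t"
          unfolding flow_def by (intro arg_cong[where f = L] ext) (simp add: algebra_simps)
        finally show ?thesis .
      qed
      have Wdiff: "norm (?W v - ?W u) \<le> integral {u..v} (\<lambda>x. norm (y x - z x))"
        if "-r \<le> u" "u \<le> v" "v \<le> T" for u v
      proof -
        have "?W t = integral {-r..t} (\<lambda>x. y x - z x)" if "t \<le> T" for t
          using that by (intro integral_diff[symmetric] integrable_on_subinterval[OF yint] integrable_on_subinterval[OF zint]) auto
        then show ?thesis using norm_indefinite_integral_diff_le[OF wabs that] that by simp
      qed
      have "(\<Sum>(u,v)\<in>C. norm ((flow ?Y v - flow ?Z v) - (flow ?Y u - flow ?Z u))) =
          (\<Sum>p\<in>C. norm (flow ?W (snd p) - flow ?W (fst p)))"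
        unfolding case_prod_unfold
        by (intro sum.cong refl arg_cong[where f = norm] arg_cong2[where f = minus] flowW) (use C2 in force)+
      also have "\<dots> \<le> V * (K / V)"
      proof (rule flow_variation[OF _ C(1) C2])
        show "continuous_on {-r..T} ?W" by (intro continuous_on_diff Yc Zc)
        fix \<theta> assume \<theta>: "\<theta> \<in> {-r..0}"
        have "(\<Sum>p\<in>C. norm (?W (snd p + \<theta>) - ?W (fst p + \<theta>)))
            \<le> (\<Sum>p\<in>C. integral {fst p + \<theta>..snd p + \<theta>} (\<lambda>x. norm (y x - z x)))"
          by (intro sum_mono Wdiff) (use C2 \<theta> in force)+
        also have "\<dots> \<le> integral {-r..T} (\<lambda>x. norm (y x - z x))"
        proof (rule sum_integral_disjoint_intervals_le[OF C(1) _ _ nint])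
          show "-r \<le> fst p + \<theta> \<and> fst p + \<theta> \<le> snd p + \<theta> \<and> snd p + \<theta> \<le> T" if "p \<in> C" for p
            using C2[OF that] \<theta> by auto
          show "{fst p + \<theta><..<snd p + \<theta>} \<inter> {fst q + \<theta><..<snd q + \<theta>} = {}"
            if "p \<in> C" "q \<in> C" "p \<noteq> q" for p q
          proof (rule equals0I)
            fix x assume "x \<in> {fst p + \<theta><..<snd p + \<theta>} \<inter> {fst q + \<theta><..<snd q + \<theta>}"
            then have "x - \<theta> \<in> {fst p<..<snd p} \<inter> {fst q<..<snd q}" by auto
            then show False using C3[OF that] by blast
          qed
        qed simp
        also have "\<dots> \<le> K / V" using z(2) by simp
        finally show "(\<Sum>p\<in>C. norm (?W (snd p + \<theta>) - ?W (fst p + \<theta>))) \<le> K / V" .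
      qed
      finally show "(\<Sum>(u,v)\<in>C. norm ((flow ?Y v - flow ?Z v) - (flow ?Y u - flow ?Z u))) \<le> K"
        using V_pos by simp
    qed
  qed
qed

end

section \<open>Local integrability of the derivative\<close>

lemma AE_lebesgue_on_iff:
  "S \<in> sets lebesgue \<Longrightarrow> (AE t in lebesgue_on S. P t) \<longleftrightarrow> (AE t in lebesgue. t \<in> S \<longrightarrow> P t)"
  by (subst AE_restrict_space_iff) auto

lemma integrable_lebesgue_on_iff:
  fixes f :: "'a::euclidean_space \<Rightarrow> 'b::euclidean_space"
  shows "S \<in> sets lebesgue \<Longrightarrow> integrable (lebesgue_on S) f \<longleftrightarrow> f absolutely_integrable_on S"
  by (simp add: integrable_restrict_space set_integrable_def)

text \<open>Completeness of Lebesgue measure; extension by zero reduces the claim to the whole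
  space.\<close>

lemma borel_measurable_lebesgue_on_AE:
  fixes f g :: "'a::euclidean_space \<Rightarrow> 'b::euclidean_space"
  assumes S: "S \<in> sets lebesgue" and f: "f \<in> borel_measurable (lebesgue_on S)"
    and eq: "AE t in lebesgue_on S. f t = g t"
  shows "g \<in> borel_measurable (lebesgue_on S)"
proof (rule borel_measurable_if_D, rule borel_measurable_AE)
  show "(\<lambda>x. if x \<in> S then f x else 0) \<in> borel_measurable lebesgue"
    by (rule borel_measurable_if_I[OF f S])
  show "AE x in lebesgue. (if x \<in> S then f x else 0) = (if x \<in> S then g x else 0)"
    using eq unfolding AE_lebesgue_on_iff[OF S] by (rule eventually_mono) simp
qed

text \<open>A version of \<open>Lp\<close> for total functions and the Euclidean norm; by \<open>Lp_iff_Lp_on\<close> below, the choice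
  of the norm does not matter.\<close>

definition Lp_on :: "ennreal \<Rightarrow> real set \<Rightarrow> (real \<Rightarrow> 'e::euclidean_space) \<Rightarrow> bool" where
  "Lp_on p S g \<longleftrightarrow> g \<in> borel_measurable (lebesgue_on S) \<and>
     (if p = \<infinity> then \<exists>M. AE t in lebesgue_on S. norm (g t) \<le> M
      else integrable (lebesgue_on S) (\<lambda>t. norm (g t) powr enn2real p))"

lemma enn2real_ge_1: "1 \<le> p \<Longrightarrow> p \<noteq> \<infinity> \<Longrightarrow> 1 \<le> enn2real p"
  using enn2real_mono[of 1 p] by (simp add: less_top)

lemma Lp_on_cong_AE:
  assumes S: "S \<in> sets lebesgue" and f: "Lp_on p S f" and eq: "AE t in lebesgue_on S. f t = g t"
  shows "Lp_on p S g"
proof -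
  have fm: "f \<in> borel_measurable (lebesgue_on S)" using f by (simp add: Lp_on_def)
  have gm: "g \<in> borel_measurable (lebesgue_on S)" by (rule borel_measurable_lebesgue_on_AE[OF S fm eq])
  show ?thesis
  proof (cases "p = \<infinity>")
    case True
    then obtain M where M: "AE t in lebesgue_on S. norm (f t) \<le> M" using f by (auto simp: Lp_on_def)
    have "AE t in lebesgue_on S. norm (g t) \<le> M" using M eq by eventually_elim simp
    then show ?thesis using True gm by (auto simp: Lp_on_def)
  next
    case False
    have "integrable (lebesgue_on S) (\<lambda>t. norm (g t) powr enn2real p)"
    proof (rule integrable_cong_AE_imp)
      show "integrable (lebesgue_on S) (\<lambda>t. norm (f t) powr enn2real p)" using f False by (simp add: Lp_on_def)
      show "AE t in lebesgue_on S. norm (f t) powr enn2real p = norm (g t) powr enn2real p"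
        using eq by eventually_elim simp
      show "(\<lambda>t. norm (g t) powr enn2real p) \<in> borel_measurable (lebesgue_on S)"
        using gm by measurable
    qed
    then show ?thesis using False gm by (simp add: Lp_on_def)
  qed
qed

lemma Lp_on_bounded:
  assumes "S \<in> lmeasurable" "f \<in> borel_measurable (lebesgue_on S)" "\<And>t. t \<in> S \<Longrightarrow> norm (f t) \<le> M"
  shows "Lp_on p S f"
proof -
  have S: "S \<in> sets lebesgue" using assms(1) by (rule fmeasurableD)
  have "integrable (lebesgue_on S) (\<lambda>t. norm (f t) powr enn2real p)"
  proof (rule integrableI_bounded_set[where A = S and B = "M powr enn2real p"])
    show "S \<in> sets (lebesgue_on S)" using S by (simp add: sets_restrict_space_iff)
    show "(\<lambda>t. norm (f t) powr enn2real p) \<in> borel_measurable (lebesgue_on S)"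
      using assms(2) by measurable
    show "emeasure (lebesgue_on S) S < \<infinity>"
      using assms(1) S by (subst emeasure_restrict_space) (auto simp: fmeasurable_def)
    show "AE t in lebesgue_on S. t \<in> S \<longrightarrow> norm (norm (f t) powr enn2real p) \<le> M powr enn2real p"
      using assms(3) by (intro always_eventually allI impI) (simp add: powr_mono2)
    show "AE t in lebesgue_on S. t \<notin> S \<longrightarrow> norm (f t) powr enn2real p = 0"
      by (rule AE_I2) simp
  qed
  moreover have "AE t in lebesgue_on S. norm (f t) \<le> M"
    by (rule AE_I2) (use assms(3) in simp)
  ultimately show ?thesis using assms(2) unfolding Lp_on_def by auto
qed

lemma Lp_on_diff:
  assumes f: "Lp_on p S f" and g: "Lp_on p S g"
  shows "Lp_on p S (\<lambda>t. f t - g t)"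
proof -
  have m[measurable]: "f \<in> borel_measurable (lebesgue_on S)" "g \<in> borel_measurable (lebesgue_on S)"
    using f g by (simp_all add: Lp_on_def)
  show ?thesis
  proof (cases "p = \<infinity>")
    case True
    then obtain M M' where M: "AE t in lebesgue_on S. norm (f t) \<le> M" "AE t in lebesgue_on S. norm (g t) \<le> M'"
      using f g by (auto simp: Lp_on_def)
    have "AE t in lebesgue_on S. norm (f t - g t) \<le> M + M'"
      using M
    proof eventually_elim
      case (elim t)
      then show ?case using norm_triangle_ineq4[of "f t" "g t"] by linarith
    qed
    then show ?thesis using True unfolding Lp_on_def by auto
  next
    case False
    define q where "q = enn2real p"
    have "integrable (lebesgue_on S) (\<lambda>t. norm (f t - g t) powr q)"
    proof (rule Bochner_Integration.integrable_bound)
      show "integrable (lebesgue_on S) (\<lambda>t. 2 powr q * (norm (f t) powr q + norm (g t) powr q))"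
        using f g False by (intro integrable_mult_right Bochner_Integration.integrable_add) (simp_all add: Lp_on_def q_def)
      show "AE t in lebesgue_on S. norm (norm (f t - g t) powr q)
          \<le> norm (2 powr q * (norm (f t) powr q + norm (g t) powr q))"
      proof (intro always_eventually allI)
        fix t
        \<comment> \<open>Bounding a sum of two terms by twice the larger one replaces Minkowski's
          inequality, as only finiteness matters.\<close>
        have "norm (f t - g t) powr q \<le> (2 * max (norm (f t)) (norm (g t))) powr q"
          using norm_triangle_ineq4[of "f t" "g t"] by (intro powr_mono2) (auto simp: q_def)
        also have "\<dots> = 2 powr q * max (norm (f t)) (norm (g t)) powr q"
          by (simp add: powr_mult)
        also have "\<dots> \<le> 2 powr q * (norm (f t) powr q + norm (g t) powr q)"
          by (intro mult_left_mono) (auto simp: max_def)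
        finally show "norm (norm (f t - g t) powr q) \<le> norm (2 powr q * (norm (f t) powr q + norm (g t) powr q))"
          by simp
      qed
    qed measurable
    then show ?thesis using False unfolding Lp_on_def q_def by simp
  qed
qed

lemma Lp_on_subset:
  assumes f: "Lp_on p S f" and "T \<subseteq> S" and sets: "S \<in> sets lebesgue" "T \<in> sets lebesgue"
  shows "Lp_on p T f"
proof -
  have "f \<in> borel_measurable (lebesgue_on T)"
    using f measurable_restrict_mono[OF _ \<open>T \<subseteq> S\<close>] by (auto simp: Lp_on_def)
  moreover have "AE t in lebesgue_on T. P t" if "AE t in lebesgue_on S. P t" for P
    using that unfolding AE_lebesgue_on_iff[OF sets(1)] AE_lebesgue_on_iff[OF sets(2)]
    by (rule eventually_mono) (use \<open>T \<subseteq> S\<close> in blast)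
  moreover have "integrable (lebesgue_on T) h" if "integrable (lebesgue_on S) h" for h :: "real \<Rightarrow> real"
    using that unfolding integrable_lebesgue_on_iff[OF sets(1)] integrable_lebesgue_on_iff[OF sets(2)]
    by (rule set_integrable_subset[OF _ sets(2) \<open>T \<subseteq> S\<close>])
  ultimately show ?thesis
    using f unfolding Lp_on_def by (cases "p = \<infinity>") auto
qed

lemma Lp_on_combine:
  fixes f :: "real \<Rightarrow> 'e::euclidean_space"
  assumes m: "f \<in> borel_measurable (lebesgue_on {a..b})"
    and f: "Lp_on p {a..c} f" "Lp_on p {c..b} f" and c: "a \<le> c" "c \<le> b"
  shows "Lp_on p {a..b} f"
proof (cases "p = \<infinity>")
  case True
  then obtain M M' where M: "AE t in lebesgue_on {a..c}. norm (f t) \<le> M" "AE t in lebesgue_on {c..b}. norm (f t) \<le> M'"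
    using f by (auto simp: Lp_on_def)
  then have "AE t in lebesgue. t \<in> {a..c} \<longrightarrow> norm (f t) \<le> M" "AE t in lebesgue. t \<in> {c..b} \<longrightarrow> norm (f t) \<le> M'"
    by (simp_all add: AE_lebesgue_on_iff)
  then have "AE t in lebesgue. t \<in> {a..b} \<longrightarrow> norm (f t) \<le> max M M'"
  proof eventually_elim
    case (elim t)
    then show ?case by (cases "t \<le> c") auto
  qed
  then have "AE t in lebesgue_on {a..b}. norm (f t) \<le> max M M'"
    by (simp add: AE_lebesgue_on_iff)
  then show ?thesis using True m unfolding Lp_on_def by auto
next
  case False
  then have "(\<lambda>t. norm (f t) powr enn2real p) absolutely_integrable_on {a..c}"
    "(\<lambda>t. norm (f t) powr enn2real p) absolutely_integrable_on {c..b}"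
    using f by (simp_all add: Lp_on_def integrable_lebesgue_on_iff)
  then have "(\<lambda>t. norm (f t) powr enn2real p) absolutely_integrable_on {a..b}"
    using c by (rule absolutely_integrable_on_combine)
  then show ?thesis using False m by (simp add: Lp_on_def integrable_lebesgue_on_iff)
qed

text \<open>Measurability of limits and Fatou's lemma need a sequence of quotients. The steps never
  exceed \<open>\<delta>\<close>, so a fixed margin to the right of the interval is enough for all
  of them.\<close>

lemma difference_quotient_seq_tendsto:
  fixes F :: "real \<Rightarrow> 'a::real_normed_vector"
  assumes F: "(F has_vector_derivative D) (at t)" and "\<delta> > 0"
  shows "(\<lambda>n. (F (t + \<delta> / real (Suc n)) - F t) /\<^sub>R (\<delta> / real (Suc n))) \<longlonglongrightarrow> D"
proof -
  have 0: "(\<lambda>n. \<delta> / real (Suc n)) \<longlonglongrightarrow> 0"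
    using tendsto_mult[OF tendsto_const[of \<delta>] LIMSEQ_inverse_real_of_nat] by (simp add: field_simps)
  have lim: "filterlim (\<lambda>n. t + \<delta> / real (Suc n)) (at t) sequentially"
    unfolding filterlim_at using tendsto_add[OF tendsto_const[of t] 0] \<open>\<delta> > 0\<close> by auto
  show ?thesis
    using filterlim_compose[OF F[unfolded has_vector_derivative_iff_quotient] lim] by simp
qed

lemma vector_derivative_measurable:
  fixes F :: "real \<Rightarrow> 'e::euclidean_space"
  assumes F: "continuous_on {a..b + \<delta>} F" and "\<delta> > 0"
    and D: "AE t in lebesgue_on {a..b}. (F has_vector_derivative D t) (at t)"
  shows "D \<in> borel_measurable (lebesgue_on {a..b})"
proof -
  let ?q = "\<lambda>n t. (F (t + \<delta> / real (Suc n)) - F t) /\<^sub>R (\<delta> / real (Suc n))"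
  have small: "0 < \<delta> / real (Suc n)" "\<delta> / real (Suc n) \<le> \<delta>" for n
    using \<open>\<delta> > 0\<close> by (auto simp: field_simps)
  have "continuous_on {a..b} (?q n)" for n
  proof -
    have "continuous_on {a..b} (\<lambda>t. F (t + \<delta> / real (Suc n)))"
      by (rule continuous_on_compose2[OF F]) (use small[of n] in \<open>auto intro!: continuous_intros simp del: of_nat_Suc\<close>)
    moreover have "continuous_on {a..b} F"
      by (rule continuous_on_subset[OF F]) (use \<open>\<delta> > 0\<close> in auto)
    ultimately show ?thesis by (intro continuous_intros)
  qed
  then have "?q n \<in> borel_measurable (lebesgue_on {a..b})" for n
    by (intro continuous_imp_measurable_on_sets_lebesgue) auto
  then have "(\<lambda>t. lim (\<lambda>n. ?q n t)) \<in> borel_measurable (lebesgue_on {a..b})"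
    by (rule borel_measurable_lim_metric)
  moreover have "AE t in lebesgue_on {a..b}. lim (\<lambda>n. ?q n t) = D t"
    using D by (rule eventually_mono) (intro limI difference_quotient_seq_tendsto \<open>\<delta> > 0\<close>)
  ultimately show ?thesis
    by (rule borel_measurable_lebesgue_on_AE[rotated]) simp
qed

context point_mass_limit
begin

lemma continuous_on_flow:
  assumes Y: "continuous_on {-r..T} Y"
  shows "continuous_on {0..T} (flow Y)"
  unfolding continuous_on_iff
proof (intro ballI allI impI)
  fix t e :: real assume t: "t \<in> {0..T}" and "e > 0"
  have "uniformly_continuous_on {-r..T} Y" by (rule compact_uniformly_continuous[OF Y]) simp
  moreover have "e / (2 * V) > 0" using \<open>e > 0\<close> V_pos by simp
  ultimately obtain d where "d > 0" and
    d: "\<And>a b. a \<in> {-r..T} \<Longrightarrow> b \<in> {-r..T} \<Longrightarrow> dist a b < d \<Longrightarrow> dist (Y a) (Y b) < e / (2 * V)"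
    unfolding uniformly_continuous_on_def by metis
  have "dist (flow Y w) (flow Y t) < e" if w: "w \<in> {0..T}" "dist w t < d" for w
  proof -
    have "dist (flow Y w) (flow Y t) = norm (L (\<lambda>\<theta>. Y (w + \<theta>) - Y (t + \<theta>)))"
      using flow_diff[OF Y, of t w] t w by (simp add: dist_norm)
    also have "\<dots> \<le> V * (e / (2 * V))"
    proof (rule norm_L_le)
      show "continuous_on {-r..0} (\<lambda>\<theta>. Y (w + \<theta>) - Y (t + \<theta>))"
        using t w by (intro continuous_intros continuous_on_segment[OF Y]) auto
      fix \<theta> assume "\<theta> \<in> {-r..0}"
      then have "dist (Y (w + \<theta>)) (Y (t + \<theta>)) < e / (2 * V)"
        using t w by (intro d) (auto simp: dist_real_def)
      then show "norm (Y (w + \<theta>) - Y (t + \<theta>)) \<le> e / (2 * V)" by (simp add: dist_norm)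
    qed
    also have "\<dots> < e" using V_pos \<open>e > 0\<close> by simp
    finally show ?thesis .
  qed
  then show "\<exists>d>0. \<forall>x'\<in>{0..T}. dist x' t < d \<longrightarrow> dist (flow Y x') (flow Y t) < e"
    using \<open>d > 0\<close> by blast
qed

text \<open>In the application \<open>U\<close> is an antiderivative of
  \<open>norm (y t) powr p\<close> and \<open>est\<close> is Jensen's inequality on
  \<open>[u,v]\<close>. For point sums, Jensen over the sample points costs
  \<open>V powr (p - 1)\<close>, \<open>est\<close> gives \<open>h powr (p - 1)\<close>, integrating
  the increments of \<open>U\<close> gives another \<open>h\<close>, and summing the weights another
  \<open>V\<close>. Fatou's lemma carries the bound over to \<open>flow Y\<close>.\<close>

lemma integral_flow_increment_powr_le:
  assumes "p \<ge> 1" and Y: "continuous_on {-r..T} Y"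
    and U: "continuous_on {-r..T} U" "mono_on {-r..T} U"
    and est: "\<And>u v. \<lbrakk>-r \<le> u; u \<le> v; v \<le> T\<rbrakk> \<Longrightarrow>
      norm (Y v - Y u) powr p \<le> (v - u) powr (p - 1) * (U v - U u)"
    and ab: "0 \<le> a" "a \<le> b" and h: "0 < h" "b + h \<le> T"
  shows "integrable (lebesgue_on {a..b}) (\<lambda>t. norm (flow Y (t + h) - flow Y t) powr p)"
    and "integral\<^sup>L (lebesgue_on {a..b}) (\<lambda>t. norm (flow Y (t + h) - flow Y t) powr p)
      \<le> (V * h) powr p * (U T - U (-r))"
proof -
  let ?f = "\<lambda>n t. norm (\<Sum>k<m n. A n k (Y (t + h + s n k) - Y (t + s n k))) powr p"
  let ?g = "\<lambda>t. norm (flow Y (t + h) - flow Y t) powr p"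
  have shift: "continuous_on {a..b} (\<lambda>t. Z (t + x))"
    if "continuous_on {-r..T} Z" "-r \<le> x" "x \<le> h" for Z :: "real \<Rightarrow> 'b::topological_space" and x
    by (rule continuous_on_compose2[OF that(1)]) (use that ab h in \<open>auto intro!: continuous_intros\<close>)
  have powr_cont: "continuous_on {a..b} (\<lambda>t. norm (w t) powr p)" if "continuous_on {a..b} w" for w :: "real \<Rightarrow> 'e"
    using that \<open>p \<ge> 1\<close> by (intro continuous_on_powr' continuous_intros) auto
  have fc: "continuous_on {a..b} (?f n)" for n
  proof (rule powr_cont, rule continuous_on_sum)
    fix k assume k: "k \<in> {..<m n}"
    have "continuous_on {a..b} (\<lambda>t. Y (t + (h + s n k)))" "continuous_on {a..b} (\<lambda>t. Y (t + s n k))"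
      using point[of k n] k h by (auto intro!: shift[OF Y])
    then have "continuous_on {a..b} (\<lambda>t. Y (t + h + s n k) - Y (t + s n k))"
      by (intro continuous_on_diff) (simp_all add: add.assoc)
    then show "continuous_on {a..b} (\<lambda>t. A n k (Y (t + h + s n k) - Y (t + s n k)))"
      by (rule bounded_linear.continuous_on[rotated])
        (use linear[of k n] k in \<open>simp add: linear_conv_bounded_linear\<close>)
  qed
  have Fc: "continuous_on {0..T} (flow Y)" by (rule continuous_on_flow[OF Y])
  have gc: "continuous_on {a..b} ?g"
  proof (rule powr_cont, rule continuous_on_diff)
    show "continuous_on {a..b} (\<lambda>t. flow Y (t + h))"
      by (rule continuous_on_compose2[OF Fc]) (use ab h in \<open>auto intro!: continuous_intros\<close>)
    show "continuous_on {a..b} (flow Y)"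
      by (rule continuous_on_subset[OF Fc]) (use ab h in auto)
  qed
  have \<Delta>U: "0 \<le> U T - U (-r)" using mono_onD[OF U(2), of "-r" T] ab h r_pos by auto
  have K: "integral\<^sup>L (lebesgue_on {a..b}) (?f n) \<le> (V * h) powr p * (U T - U (-r))" for n
  proof -
    let ?u = "\<lambda>k t. U (t + h + s n k) - U (t + s n k)"
    let ?B = "\<lambda>t. (V powr (p - 1) * h powr (p - 1)) * (\<Sum>k<m n. c n k * ?u k t)"
    have uc: "continuous_on {a..b} (?u k)" if "k < m n" for k
    proof -
      have "continuous_on {a..b} (\<lambda>t. U (t + (h + s n k)))" "continuous_on {a..b} (\<lambda>t. U (t + s n k))"
        using point[OF that] h by (auto intro!: shift[OF U(1)])
      then show ?thesis by (intro continuous_on_diff) (simp_all add: add.assoc)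
    qed
    have uint: "?u k integrable_on {a..b}" if "k < m n" for k
      by (intro integrable_continuous_real uc that)
    have f_le: "?f n t \<le> ?B t" if t: "t \<in> {a..b}" for t
    proof -
      have "?f n t \<le> (\<Sum>k<m n. c n k * norm (Y (t + h + s n k) - Y (t + s n k))) powr p"
        using \<open>p \<ge> 1\<close> by (intro powr_mono2 norm_point_sum_le) auto
      also have "\<dots> \<le> V powr (p - 1) * (\<Sum>k<m n. c n k * norm (Y (t + h + s n k) - Y (t + s n k)) powr p)"
        by (rule sum_powr_le[OF \<open>p \<ge> 1\<close> V_pos]) (auto simp: c_nonneg c_sum)
      also have "\<dots> \<le> V powr (p - 1) * (\<Sum>k<m n. c n k * (h powr (p - 1) * ?u k t))"
      proof (intro mult_left_mono sum_mono)
        fix k assume k: "k \<in> {..<m n}"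
        show "norm (Y (t + h + s n k) - Y (t + s n k)) powr p \<le> h powr (p - 1) * ?u k t"
          using est[of "t + s n k" "t + h + s n k"] point[of k n] k t ab h by auto
      qed (auto simp: c_nonneg)
      also have "\<dots> = ?B t" by (simp add: sum_distrib_left mult_ac)
      finally show ?thesis .
    qed
    have "integral\<^sup>L (lebesgue_on {a..b}) (?f n) = integral {a..b} (?f n)"
      by (intro lebesgue_integral_eq_integral continuous_imp_integrable_real fc) auto
    also have "\<dots> \<le> integral {a..b} ?B"
      by (intro integral_le integrable_continuous_real fc f_le)
        (auto intro!: continuous_intros uc)
    also have "\<dots> = (V powr (p - 1) * h powr (p - 1)) * (\<Sum>k<m n. c n k * integral {a..b} (?u k))"
      by (intro integral_unique has_integral_mult_right has_integral_sum integrable_integral uint) auto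
    also have "\<dots> \<le> (V powr (p - 1) * h powr (p - 1)) * (\<Sum>k<m n. c n k * (h * (U T - U (-r))))"
    proof (intro mult_left_mono sum_mono)
      fix k assume k: "k \<in> {..<m n}"
      \<comment> \<open>The window translated by the sample point stays inside
        \<open>[-r,T]\<close>, hence a bound common to all sample points.\<close>
      have "integral {a + s n k..b + s n k} (\<lambda>t. U (t + h) - U t) \<le> h * (U T - U (-r))"
        using point[of k n] k ab h by (intro integral_increment_le[OF U]) auto
      moreover have "integral {a..b} (?u k) = integral {a + s n k..b + s n k} (\<lambda>t. U (t + h) - U t)"
        using integral_shift_real_ivl[of "a + s n k" "s n k" "b + s n k" "\<lambda>t. U (t + h) - U t"]
        by (simp add: add_ac)
      ultimately show "integral {a..b} (?u k) \<le> h * (U T - U (-r))" by simp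
    qed (auto simp: c_nonneg)
    also have "\<dots> = (V powr (p - 1) * h powr (p - 1) * h * (U T - U (-r))) * (\<Sum>k<m n. c n k)"
      by (simp add: sum_distrib_left mult_ac)
    also have "\<dots> \<le> (V powr (p - 1) * h powr (p - 1) * h * (U T - U (-r))) * V"
      using h \<Delta>U by (intro mult_left_mono c_sum) auto
    also have "\<dots> = (V * h) powr p * (U T - U (-r))"
      using V_pos h by (simp add: powr_mult powr_diff)
    finally show ?thesis .
  qed
  have lim: "(\<lambda>n. ?f n t) \<longlonglongrightarrow> ?g t" if t: "t \<in> {a..b}" for t
  proof -
    have "flow Y (t + h) - flow Y t = L (\<lambda>\<theta>. Y (t + h + \<theta>) - Y (t + \<theta>))"
      using t ab h by (intro flow_diff[OF Y]) auto
    moreover have "(\<lambda>n. \<Sum>k<m n. A n k (Y (t + h + s n k) - Y (t + s n k)))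
        \<longlonglongrightarrow> L (\<lambda>\<theta>. Y (t + h + \<theta>) - Y (t + \<theta>))"
      using t ab h by (intro lim continuous_intros continuous_on_segment[OF Y]) auto
    ultimately have "(\<lambda>n. \<Sum>k<m n. A n k (Y (t + h + s n k) - Y (t + s n k))) \<longlonglongrightarrow> flow Y (t + h) - flow Y t"
      by simp
    then show ?thesis using \<open>p \<ge> 1\<close> by (intro tendsto_powr' tendsto_norm tendsto_const) auto
  qed
  have meas: "?g \<in> borel_measurable (lebesgue_on {a..b})"
    by (intro continuous_imp_measurable_on_sets_lebesgue gc) simp
  have AElim: "AE t in lebesgue_on {a..b}. (\<lambda>n. ?f n t) \<longlonglongrightarrow> ?g t"
    by (rule AE_I2) (use lim in simp)
  have fint: "integrable (lebesgue_on {a..b}) (?f n)" for n by (rule continuous_imp_integrable_real[OF fc])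
  show "integrable (lebesgue_on {a..b}) ?g"
    by (rule integrable_limit_of_bounded_integrals(1)[OF fint _ K AElim meas]) simp
  show "integral\<^sup>L (lebesgue_on {a..b}) ?g \<le> (V * h) powr p * (U T - U (-r))"
    by (rule integrable_limit_of_bounded_integrals(2)[OF fint _ K AElim meas]) simp
qed

text \<open>Division by \<open>h n\<close> cancels the factor \<open>h n powr p\<close> in the bound
  for the increments, so the quotients stay bounded in L^p as the step shrinks. The gap between
  \<open>b\<close> and \<open>T\<close> makes room for quotients taken to the right.\<close>

lemma flow_derivative_powr_integrable:
  assumes "p \<ge> 1" and Y: "continuous_on {-r..T} Y"
    and U: "continuous_on {-r..T} U" "mono_on {-r..T} U"
    and est: "\<And>u v. \<lbrakk>-r \<le> u; u \<le> v; v \<le> T\<rbrakk> \<Longrightarrow>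
      norm (Y v - Y u) powr p \<le> (v - u) powr (p - 1) * (U v - U u)"
    and ab: "0 \<le> a" "a \<le> b" "b < T"
    and D: "AE t in lebesgue_on {a..b}. (flow Y has_vector_derivative D t) (at t)"
  shows "integrable (lebesgue_on {a..b}) (\<lambda>t. norm (D t) powr p)"
proof -
  define \<delta> where "\<delta> = T - b"
  have \<delta>: "\<delta> > 0" using ab by (simp add: \<delta>_def)
  define h where "h = (\<lambda>n. \<delta> / real (Suc n))"
  have h: "0 < h n" "b + h n \<le> T" for n
  proof -
    have "h n \<le> \<delta>" using \<delta> by (simp add: h_def field_simps)
    then show "b + h n \<le> T" by (simp add: \<delta>_def)
    show "0 < h n" using \<delta> by (simp add: h_def)
  qed
  let ?f = "\<lambda>n t. norm ((flow Y (t + h n) - flow Y t) /\<^sub>R h n) powr p"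
  have f: "?f n t = (1 / h n) powr p * norm (flow Y (t + h n) - flow Y t) powr p" for n t
    using h(1)[of n] by (simp add: powr_mult[symmetric] divide_inverse mult.commute)
  note incr = integral_flow_increment_powr_le[OF \<open>p \<ge> 1\<close> Y U est ab(1,2) h]
  show ?thesis
  proof (rule integrable_limit_of_bounded_integrals(1)[where f = ?f and K = "V powr p * (U T - U (-r))"])
    show "integrable (lebesgue_on {a..b}) (?f n)" for n
      unfolding f by (intro integrable_mult_right incr(1))
    show "integral\<^sup>L (lebesgue_on {a..b}) (?f n) \<le> V powr p * (U T - U (-r))" for n
    proof -
      have "integral\<^sup>L (lebesgue_on {a..b}) (?f n) =
          (1 / h n) powr p * integral\<^sup>L (lebesgue_on {a..b}) (\<lambda>t. norm (flow Y (t + h n) - flow Y t) powr p)"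
        unfolding f by (rule integral_mult_right_zero)
      also have "\<dots> \<le> (1 / h n) powr p * ((V * h n) powr p * (U T - U (-r)))"
        by (intro mult_left_mono incr(2)) auto
      also have "\<dots> = (1 / h n * (V * h n)) powr p * (U T - U (-r))"
        using h(1)[of n] V_pos by (simp add: powr_mult[symmetric])
      also have "1 / h n * (V * h n) = V" using h(1)[of n] by simp
      finally show ?thesis .
    qed
    show "AE t in lebesgue_on {a..b}. (\<lambda>n. ?f n t) \<longlonglongrightarrow> norm (D t) powr p"
      using D
    proof eventually_elim
      case (elim t)
      from difference_quotient_seq_tendsto[OF this \<delta>]
      have "(\<lambda>n. (flow Y (t + h n) - flow Y t) /\<^sub>R h n) \<longlonglongrightarrow> D t" by (simp add: h_def)
      then show ?case using \<open>p \<ge> 1\<close> by (intro tendsto_powr' tendsto_norm tendsto_const) auto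
    qed
    have "continuous_on {a..b + \<delta>} (flow Y)"
      by (rule continuous_on_subset[OF continuous_on_flow[OF Y]]) (use ab in \<open>auto simp: \<delta>_def\<close>)
    from vector_derivative_measurable[OF this \<delta> D]
    show "(\<lambda>t. norm (D t) powr p) \<in> borel_measurable (lebesgue_on {a..b})" by measurable
  qed simp
qed

text \<open>Every right-hand quotient is at most \<open>V * K\<close> in norm because the flow
  inherits the Lipschitz property. This serves the case \<open>p = \<infinity>\<close>.\<close>

lemma flow_derivative_bounded:
  assumes Y: "continuous_on {-r..T} Y"
    and K: "\<And>a b. \<lbrakk>-r \<le> a; a \<le> b; b \<le> T\<rbrakk> \<Longrightarrow> norm (Y b - Y a) \<le> K * (b - a)"
    and t: "0 \<le> t" "t < T" and D: "(flow Y has_vector_derivative D) (at t)"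
  shows "norm D \<le> V * K"
proof (rule LIMSEQ_le_const2)
  define \<delta> where "\<delta> = T - t"
  have \<delta>: "\<delta> > 0" using t by (simp add: \<delta>_def)
  let ?h = "\<lambda>n. \<delta> / real (Suc n)"
  show "(\<lambda>n. norm ((flow Y (t + ?h n) - flow Y t) /\<^sub>R ?h n)) \<longlonglongrightarrow> norm D"
    by (intro tendsto_norm difference_quotient_seq_tendsto D \<delta>)
  have "norm ((flow Y (t + ?h n) - flow Y t) /\<^sub>R ?h n) \<le> V * K" for n
  proof -
    have h: "0 < ?h n" "t + ?h n \<le> T"
    proof -
      have "?h n \<le> \<delta>" using \<delta> by (simp add: field_simps)
      then show "t + ?h n \<le> T" by (simp add: \<delta>_def)
      show "0 < ?h n" using \<delta> by simp
    qed
    have "norm (flow Y (t + ?h n) - flow Y t) \<le> V * K * ?h n"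
      using flow_lipschitz[OF Y, of t "t + ?h n" K] K t h by (simp add: mult.assoc)
    then have "norm (flow Y (t + ?h n) - flow Y t) / ?h n \<le> V * K"
      using h(1) pos_divide_le_eq by blast
    moreover have "norm (w /\<^sub>R \<eta>) = norm w / \<eta>" if "\<eta> > 0" for w :: 'e and \<eta> :: real
      using that by (simp add: divide_inverse mult.commute)
    ultimately show ?thesis using h(1) by metis
  qed
  then show "\<exists>N. \<forall>n\<ge>N. norm ((flow Y (t + ?h n) - flow Y t) /\<^sub>R ?h n) \<le> V * K" by blast
qed

end

section \<open>Norms on the coordinate space and matrices\<close>

lemma is_norm_scaleR:
  fixes N :: "'k::{real_normed_field,euclidean_space}^'n \<Rightarrow> real"
  assumes "is_norm N"
  shows "N (a *\<^sub>R v) = \<bar>a\<bar> * N v"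
proof -
  have "a *\<^sub>R v = of_real a *s v"
    by (simp add: vec_eq_iff vector_scalar_mult_def scaleR_conv_of_real[where 'a = 'k])
  then show ?thesis using assms by (simp add: is_norm_def)
qed

lemma is_norm_le:
  fixes N :: "'k::{real_normed_field,euclidean_space}^'n \<Rightarrow> real"
  assumes N: "is_norm N"
  obtains C where "C > 0" "\<And>v. N v \<le> C * norm v"
proof -
  have N0: "0 \<le> N v" for v using N by (simp add: is_norm_def)
  \<comment> \<open>Coordinates in the real basis are bounded by the norm; the \<open>+ 1\<close>
    secures positivity.\<close>
  define C where "C = (\<Sum>b\<in>(Basis :: ('k^'n) set). N b) + 1"
  have "N v \<le> C * norm v" for v
  proof -
    have "N v = N (\<Sum>b\<in>Basis. (v \<bullet> b) *\<^sub>R b)" by (simp add: euclidean_representation)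
    also have "\<dots> \<le> (\<Sum>b\<in>Basis. N ((v \<bullet> b) *\<^sub>R b))"
    proof -
      have "N (\<Sum>b\<in>B. (v \<bullet> b) *\<^sub>R b) \<le> (\<Sum>b\<in>B. N ((v \<bullet> b) *\<^sub>R b))" if "finite B" for B
        using that
      proof (induction B rule: finite_induct)
        case empty
        have "N 0 = 0" using N by (simp add: is_norm_def)
        then show ?case by simp
      next
        case (insert i I)
        have "N ((v \<bullet> i) *\<^sub>R i + (\<Sum>b\<in>I. (v \<bullet> b) *\<^sub>R b)) \<le> N ((v \<bullet> i) *\<^sub>R i) + N (\<Sum>b\<in>I. (v \<bullet> b) *\<^sub>R b)"
          using N by (simp add: is_norm_def)
        then show ?case using insert by simp
      qed
      then show ?thesis by simp
    qed
    also have "\<dots> \<le> (\<Sum>b\<in>(Basis :: ('k^'n) set). norm v * N b)"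
      by (intro sum_mono) (simp add: is_norm_scaleR[OF N] N0 mult_right_mono Basis_le_norm)
    also have "\<dots> \<le> C * norm v"
      unfolding C_def sum_distrib_left[symmetric] by (simp add: algebra_simps)
    finally show ?thesis .
  qed
  moreover have "C > 0" unfolding C_def using N0 by (smt (verit) sum_nonneg)
  ultimately show ?thesis using that by blast
qed

lemma is_norm_continuous:
  fixes N :: "'k::{real_normed_field,euclidean_space}^'n \<Rightarrow> real"
  assumes N: "is_norm N"
  shows "continuous_on UNIV N"
proof -
  obtain C where C: "C > 0" "\<And>v. N v \<le> C * norm v" using is_norm_le[OF N] by blast
  have "\<bar>N v - N w\<bar> \<le> C * norm (v - w)" for v w
  proof -
    have tri: "N (a + b) \<le> N a + N b" for a b using N by (simp add: is_norm_def)
    have "N v \<le> N (v - w) + N w" "N w \<le> N (w - v) + N v"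
      using tri[of "v - w" w] tri[of "w - v" v] by simp_all
    then show ?thesis using C(2)[of "v - w"] C(2)[of "w - v"] by (simp add: norm_minus_commute abs_le_iff)
  qed
  then show ?thesis
    by (intro lipschitz_on_continuous_on[of C] lipschitz_onI) (use C(1) in \<open>auto simp: dist_norm\<close>)
qed

text \<open>Compactness of the Euclidean unit sphere: the continuous function \<open>N\<close> has a
  positive minimum there, and homogeneity extends the bound to all vectors.\<close>

lemma is_norm_ge:
  fixes N :: "'k::{real_normed_field,euclidean_space}^'n \<Rightarrow> real"
  assumes N: "is_norm N"
  obtains c where "c > 0" "\<And>v. c * norm v \<le> N v"
proof -
  have "\<exists>u\<in>sphere (0 :: 'k^'n) 1. \<forall>v\<in>sphere 0 1. N u \<le> N v"
  proof (rule continuous_attains_inf)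
    obtain b :: "'k^'n" where "b \<in> Basis" using nonempty_Basis by blast
    then have "b \<in> sphere 0 1" by simp
    then show "sphere (0 :: 'k^'n) 1 \<noteq> {}" by blast
  qed (auto intro: continuous_on_subset[OF is_norm_continuous[OF N]])
  then obtain u where u: "norm u = 1" "\<And>v. norm v = 1 \<Longrightarrow> N u \<le> N v" by auto
  have "N u > 0" using N u(1) unfolding is_norm_def by (metis norm_zero zero_neq_one order_le_less)
  moreover have "N u * norm v \<le> N v" for v
  proof (cases "v = 0")
    case True
    then show ?thesis using N by (simp add: is_norm_def)
  next
    case False
    have "N u \<le> N (v /\<^sub>R norm v)" using False by (intro u(2)) simp
    also have "\<dots> = N v / norm v" using False by (simp add: is_norm_scaleR[OF N] divide_inverse mult.commute)
    finally show ?thesis using False by (simp add: pos_le_divide_eq)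
  qed
  ultimately show ?thesis using that by blast
qed

lemma Lp_iff_Lp_on:
  fixes N :: "'k::{real_normed_field,euclidean_space}^'n \<Rightarrow> real"
  assumes N: "is_norm N"
  shows "f \<in> Lp N p J \<longleftrightarrow> dom f \<subseteq> J \<and> (AE t in lebesgue_on J. t \<in> dom f) \<and> Lp_on p J (\<lambda>t. the (f t))"
proof -
  let ?g = "\<lambda>t. the (f t)"
  obtain C where C: "C > 0" "\<And>v. N v \<le> C * norm v" using is_norm_le[OF N] by blast
  obtain c where c: "c > 0" "\<And>v. c * norm v \<le> N v" using is_norm_ge[OF N] by blast
  have N0: "0 \<le> N v" for v using N by (simp add: is_norm_def)
  have le: "norm v \<le> (1 / c) * N v" for v using c by (simp add: field_simps)
  define q where "q = enn2real p"
  have q0: "0 \<le> q" by (simp add: q_def)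
  \<comment> \<open>Applied in both directions of the equivalence, with \<open>N\<close> and the
    Euclidean norm exchanging roles.\<close>
  have powr_bound: "integrable (lebesgue_on J) (\<lambda>t. b t powr q)"
    if int: "integrable (lebesgue_on J) (\<lambda>t. a t powr q)" and "b \<in> borel_measurable (lebesgue_on J)"
      and ab: "\<And>t. 0 \<le> b t" "\<And>t. b t \<le> K * a t" "K > 0" "\<And>t. 0 \<le> a t" for a b :: "real \<Rightarrow> real" and K
  proof (rule Bochner_Integration.integrable_bound)
    show "integrable (lebesgue_on J) (\<lambda>t. K powr q * a t powr q)" using int by simp
    have "b t powr q \<le> K powr q * a t powr q" for t
      using powr_mono2[OF q0 ab(1) ab(2)] ab(3,4) by (simp add: powr_mult)
    then show "AE t in lebesgue_on J. norm (b t powr q) \<le> norm (K powr q * a t powr q)"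
      by (intro always_eventually allI) simp
    show "(\<lambda>t. b t powr q) \<in> borel_measurable (lebesgue_on J)"
      using that(2) by measurable
  qed
  have "(if p = \<infinity> then \<exists>M. AE t in lebesgue_on J. N (?g t) \<le> M
      else integrable (lebesgue_on J) (\<lambda>t. N (?g t) powr enn2real p)) \<longleftrightarrow>
    (if p = \<infinity> then \<exists>M. AE t in lebesgue_on J. norm (?g t) \<le> M
      else integrable (lebesgue_on J) (\<lambda>t. norm (?g t) powr enn2real p))"
    if m: "?g \<in> borel_measurable (lebesgue_on J)"
  proof (cases "p = \<infinity>")
    case True
    have "\<exists>M. AE t in lebesgue_on J. norm (?g t) \<le> M" if "AE t in lebesgue_on J. N (?g t) \<le> M" for M
      using that by (intro exI[of _ "1 / c * M"], elim eventually_mono)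
        (use le c(1) in \<open>meson mult_left_mono order_trans less_imp_le zero_less_divide_1_iff\<close>)
    moreover have "\<exists>M. AE t in lebesgue_on J. N (?g t) \<le> M" if "AE t in lebesgue_on J. norm (?g t) \<le> M" for M
      using that by (intro exI[of _ "C * M"], elim eventually_mono)
        (use C in \<open>meson mult_left_mono order_trans less_imp_le\<close>)
    ultimately show ?thesis using True by auto
  next
    case False
    have Nm: "(\<lambda>t. N (?g t)) \<in> borel_measurable (lebesgue_on J)"
      using measurable_compose[OF m borel_measurable_continuous_onI[OF is_norm_continuous[OF N]]] .
    have nm: "(\<lambda>t. norm (?g t)) \<in> borel_measurable (lebesgue_on J)" using m by measurable
    have "integrable (lebesgue_on J) (\<lambda>t. N (?g t) powr q) \<longleftrightarrow> integrable (lebesgue_on J) (\<lambda>t. norm (?g t) powr q)"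
      using powr_bound[OF _ nm, of "\<lambda>t. N (?g t)" "1 / c"] powr_bound[OF _ Nm, of "\<lambda>t. norm (?g t)" C] le C c N0 by auto
    then show ?thesis using False by (simp add: q_def)
  qed
  then show ?thesis unfolding Lp_def Lp_on_def by auto
qed

text \<open>Each coordinate is a sum of \<open>CARD('n)\<close> products and there are
  \<open>CARD('n)\<close> coordinates. The constant is crude, but only its finiteness
  matters.\<close>

lemma norm_matrix_vector_mult_le:
  fixes M :: "'k::{real_normed_field,euclidean_space}^'n^'n"
  shows "norm (M *v v) \<le> (real CARD('n))\<^sup>2 * norm M * norm v"
proof -
  have "norm (M *v v) \<le> (\<Sum>i\<in>UNIV. norm ((M *v v) $ i))"
    unfolding norm_vec_def by (intro L2_set_le_sum) simp
  also have "\<dots> \<le> (\<Sum>i\<in>(UNIV::'n set). \<Sum>j\<in>(UNIV::'n set). norm M * norm v)"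
  proof (intro sum_mono)
    fix i
    have "norm ((M *v v) $ i) \<le> (\<Sum>j\<in>UNIV. norm (M $ i $ j * v $ j))"
      unfolding matrix_vector_mult_def by (simp add: norm_sum)
    also have "\<dots> \<le> (\<Sum>j\<in>(UNIV::'n set). norm M * norm v)"
    proof (intro sum_mono)
      fix j
      have "norm (M $ i $ j) \<le> norm M"
        using Finite_Cartesian_Product.norm_nth_le[of "M $ i" j] Finite_Cartesian_Product.norm_nth_le[of M i] by linarith
      then show "norm (M $ i $ j * v $ j) \<le> norm M * norm v"
        by (simp add: norm_mult mult_mono Finite_Cartesian_Product.norm_nth_le)
    qed
    finally show "norm ((M *v v) $ i) \<le> (\<Sum>j\<in>(UNIV::'n set). norm M * norm v)" .
  qed
  also have "\<dots> = (real CARD('n))\<^sup>2 * norm M * norm v" by (simp add: power2_eq_square)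
  finally show ?thesis .
qed

lemma linear_matrix_vector_mult_right:
  fixes M :: "'k::{real_normed_field,euclidean_space}^'n^'n"
  shows "linear (\<lambda>v. M *v v)"
proof (rule linearI)
  show "M *v (a + b) = M *v a + M *v b" for a b by (rule matrix_vector_right_distrib)
  show "M *v (c *\<^sub>R a) = c *\<^sub>R (M *v a)" for c a
    by (simp add: matrix_vector_mult_def vec_eq_iff scaleR_sum_right)
qed

lemma linear_matrix_vector_mult_left:
  fixes v :: "'k::{real_normed_field,euclidean_space}^'n"
  shows "linear (\<lambda>M::'k^'n^'n. M *v v)"
proof (rule linearI)
  show "(A + B) *v v = A *v v + B *v v" for A B :: "'k^'n^'n" by (rule matrix_vector_mult_add_rdistrib)
  show "(c *\<^sub>R A) *v v = c *\<^sub>R (A *v v)" for c and A :: "'k^'n^'n"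
    by (simp add: matrix_vector_mult_def vec_eq_iff scaleR_sum_right)
qed

section \<open>Riemann-Stieltjes integrals\<close>

lemma uniform_partition_step:
  "(a + real (Suc k) * (b - a) / real (Suc n)) - (a + real k * (b - a) / real (Suc n)) = (b - a) / real (Suc n)"
proof -
  have "real (Suc k) * (b - a) - real k * (b - a) = b - a" by (simp add: algebra_simps)
  then show ?thesis by (metis add_diff_cancel_left diff_divide_distrib)
qed

lemma is_partition_uniform:
  assumes "a < b"
  shows "is_partition a b (Suc n) (\<lambda>k. a + real k * (b - a) / real (Suc n))"
  unfolding is_partition_def
proof (intro conjI allI impI)
  fix k
  have "0 < (b - a) / real (Suc n)" using assms by simp
  then show "a + real k * (b - a) / real (Suc n) < a + real (Suc k) * (b - a) / real (Suc n)"
    using uniform_partition_step[of a k b n] by linarith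
qed (simp_all del: of_nat_Suc)

lemma is_partition_mono:
  assumes "is_partition a b m \<theta>" "i \<le> j" "j \<le> m"
  shows "\<theta> i \<le> \<theta> j"
  using assms(2,3)
proof (induction j rule: dec_induct)
  case (step k)
  then have "\<theta> k < \<theta> (Suc k)" using assms(1) by (simp add: is_partition_def)
  then show ?case using step by simp
qed simp

lemma is_partition_bounds:
  assumes "is_partition a b m \<theta>" "k \<le> m"
  shows "a \<le> \<theta> k" "\<theta> k \<le> b"
  using is_partition_mono[OF assms(1), of 0 k] is_partition_mono[OF assms(1), of k m] assms
  by (simp_all add: is_partition_def)

text \<open>Uniform partitions tagged at their left endpoints reduce the limit over the mesh to a
  sequence of point sums; \<open>Suc n\<close> avoids division by zero.\<close>

lemma has_RS_integral_imp_tendsto: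
  assumes I: "has_RS_integral \<eta> h a b I" and "a < b"
  defines "\<theta> \<equiv> \<lambda>n k. a + real k * (b - a) / real (Suc n)"
  shows "(\<lambda>n. \<Sum>k<Suc n. (\<eta> (\<theta> n (Suc k)) - \<eta> (\<theta> n k)) *v h (\<theta> n k)) \<longlonglongrightarrow> I"
proof (rule metric_LIMSEQ_I)
  fix \<epsilon> :: real assume "\<epsilon> > 0"
  then obtain \<delta> where "\<delta> > 0" and \<delta>: "\<And>m \<theta> \<tau>. is_partition a b m \<theta> \<and>
        (\<forall>k<m. \<theta> (Suc k) - \<theta> k < \<delta> \<and> \<tau> k \<in> {\<theta> k..\<theta> (Suc k)}) \<Longrightarrow>
        dist (\<Sum>k<m. (\<eta> (\<theta> (Suc k)) - \<eta> (\<theta> k)) *v h (\<tau> k)) I < \<epsilon>"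
    using I unfolding has_RS_integral_def by meson
  obtain n0 where n0: "(b - a) / \<delta> < real n0" using reals_Archimedean2 by blast
  show "\<exists>n0. \<forall>n\<ge>n0. dist (\<Sum>k<Suc n. (\<eta> (\<theta> n (Suc k)) - \<eta> (\<theta> n k)) *v h (\<theta> n k)) I < \<epsilon>"
  proof (intro exI[of _ n0] allI impI)
    fix n assume n: "n0 \<le> n"
    have step: "\<theta> n (Suc k) - \<theta> n k = (b - a) / real (Suc n)" for k
      unfolding \<theta>_def by (rule uniform_partition_step)
    have "is_partition a b (Suc n) (\<theta> n)" unfolding \<theta>_def by (rule is_partition_uniform) fact
    moreover have "\<theta> n (Suc k) - \<theta> n k < \<delta>" for k
    proof -
      have "(b - a) / \<delta> < real (Suc n)" using n0 n by linarith
      then have "b - a < \<delta> * real (Suc n)" using \<open>\<delta> > 0\<close> by (simp add: pos_divide_less_eq mult.commute)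
      then show ?thesis unfolding step by (simp add: pos_divide_less_eq)
    qed
    moreover have "\<theta> n k \<in> {\<theta> n k..\<theta> n (Suc k)}" for k
    proof -
      have "0 \<le> (b - a) / real (Suc n)" using \<open>a < b\<close> by simp
      then show ?thesis using step[of k] by simp
    qed
    ultimately show "dist (\<Sum>k<Suc n. (\<eta> (\<theta> n (Suc k)) - \<eta> (\<theta> n k)) *v h (\<theta> n k)) I < \<epsilon>"
      by (intro \<delta>) blast
  qed
qed

lemma has_RS_integral_cong:
  assumes I: "has_RS_integral \<eta> h a b I" and eq: "\<And>s. a \<le> s \<Longrightarrow> s \<le> b \<Longrightarrow> h s = h' s"
  shows "has_RS_integral \<eta> h' a b I"
  unfolding has_RS_integral_def
proof (intro allI impI)
  fix \<epsilon> :: real assume "\<epsilon> > 0"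
  then obtain \<delta> where "\<delta> > 0" and \<delta>: "\<And>m \<theta> \<tau>. is_partition a b m \<theta> \<and>
        (\<forall>k<m. \<theta> (Suc k) - \<theta> k < \<delta> \<and> \<tau> k \<in> {\<theta> k..\<theta> (Suc k)}) \<Longrightarrow>
        dist (\<Sum>k<m. (\<eta> (\<theta> (Suc k)) - \<eta> (\<theta> k)) *v h (\<tau> k)) I < \<epsilon>"
    using I unfolding has_RS_integral_def by meson
  show "\<exists>\<delta>>0. \<forall>m \<theta> \<tau>. is_partition a b m \<theta> \<and>
        (\<forall>k<m. \<theta> (Suc k) - \<theta> k < \<delta> \<and> \<tau> k \<in> {\<theta> k..\<theta> (Suc k)}) \<longrightarrow>
        dist (\<Sum>k<m. (\<eta> (\<theta> (Suc k)) - \<eta> (\<theta> k)) *v h' (\<tau> k)) I < \<epsilon>"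
  proof (intro exI[of _ \<delta>] conjI allI impI \<open>\<delta> > 0\<close>)
    fix m \<theta> \<tau> assume p: "is_partition a b m \<theta> \<and> (\<forall>k<m. \<theta> (Suc k) - \<theta> k < \<delta> \<and> \<tau> k \<in> {\<theta> k..\<theta> (Suc k)})"
    have "h (\<tau> k) = h' (\<tau> k)" if "k < m" for k
    proof (rule eq)
      show "a \<le> \<tau> k" using is_partition_bounds(1)[of a b m \<theta> k] p that by force
      show "\<tau> k \<le> b" using is_partition_bounds(2)[of a b m \<theta> "Suc k"] p that by force
    qed
    then have "(\<Sum>k<m. (\<eta> (\<theta> (Suc k)) - \<eta> (\<theta> k)) *v h' (\<tau> k)) = (\<Sum>k<m. (\<eta> (\<theta> (Suc k)) - \<eta> (\<theta> k)) *v h (\<tau> k))"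
      by (intro sum.cong) auto
    then show "dist (\<Sum>k<m. (\<eta> (\<theta> (Suc k)) - \<eta> (\<theta> k)) *v h' (\<tau> k)) I < \<epsilon>" using \<delta>[OF p] by simp
  qed
qed

lemma sum_lessThan_add: "(\<Sum>k<M + m. f k) = (\<Sum>k<M. f k) + (\<Sum>k<m. f (M + k))"
  for f :: "nat \<Rightarrow> 'a::comm_monoid_add"
  by (induction m) (simp_all add: add_ac)

lemma exists_fine_partition:
  assumes "a \<le> b" "\<delta> > 0"
  obtains m \<theta> where "is_partition a b m \<theta>" "\<And>k. k < m \<Longrightarrow> \<theta> (Suc k) - \<theta> k < \<delta>"
proof (cases "a = b")
  case True
  then show ?thesis using that[of 0 "\<lambda>_. a"] by (simp add: is_partition_def)
next
  case False
  then have "a < b" using assms by simp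
  obtain n where "(b - a) / \<delta> < real n" using reals_Archimedean2 by blast
  then have "b - a < \<delta> * real (Suc n)" using \<open>\<delta> > 0\<close> by (simp add: field_simps)
  then have "(b - a) / real (Suc n) < \<delta>" by (simp add: pos_divide_less_eq)
  then show ?thesis
    using that[OF is_partition_uniform[OF \<open>a < b\<close>, of n]] unfolding uniform_partition_step by blast
qed

text \<open>A partition of \<open>[c,b]\<close> is prolonged by a fixed fine partition of
  \<open>[a,c]\<close>. On the added part \<open>h\<close> is constant and the sum telescopes
  exactly, so the two sums differ by a fixed vector. This shortens \<open>[-r,0]\<close> to
  \<open>[-t,0]\<close> when \<open>t \<le> r\<close>.\<close>

lemma has_RS_integral_drop_constant:
  fixes \<eta> :: "real \<Rightarrow> 'a::{real_normed_field,euclidean_space}^'b^'b"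
  assumes I: "has_RS_integral \<eta> h a b I" and "a \<le> c" "c \<le> b"
    and const: "\<And>s. a \<le> s \<Longrightarrow> s \<le> c \<Longrightarrow> h s = v"
  shows "has_RS_integral \<eta> h c b (I - (\<eta> c - \<eta> a) *v v)"
  unfolding has_RS_integral_def
proof (intro allI impI)
  fix \<epsilon> :: real assume "\<epsilon> > 0"
  then obtain \<delta> where "\<delta> > 0" and \<delta>: "\<And>m \<theta> \<tau>. is_partition a b m \<theta> \<and>
        (\<forall>k<m. \<theta> (Suc k) - \<theta> k < \<delta> \<and> \<tau> k \<in> {\<theta> k..\<theta> (Suc k)}) \<Longrightarrow>
        dist (\<Sum>k<m. (\<eta> (\<theta> (Suc k)) - \<eta> (\<theta> k)) *v h (\<tau> k)) I < \<epsilon>"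
    using I unfolding has_RS_integral_def by meson
  obtain M \<theta>0 where p0: "is_partition a c M \<theta>0" and mesh0: "\<And>k. k < M \<Longrightarrow> \<theta>0 (Suc k) - \<theta>0 k < \<delta>"
    using exists_fine_partition[OF \<open>a \<le> c\<close> \<open>\<delta> > 0\<close>] by blast
  show "\<exists>\<delta>>0. \<forall>m \<theta> \<tau>. is_partition c b m \<theta> \<and>
        (\<forall>k<m. \<theta> (Suc k) - \<theta> k < \<delta> \<and> \<tau> k \<in> {\<theta> k..\<theta> (Suc k)}) \<longrightarrow>
        dist (\<Sum>k<m. (\<eta> (\<theta> (Suc k)) - \<eta> (\<theta> k)) *v h (\<tau> k)) (I - (\<eta> c - \<eta> a) *v v) < \<epsilon>"
  proof (intro exI[of _ \<delta>] conjI allI impI \<open>\<delta> > 0\<close>)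
    fix m \<theta> \<tau> assume p: "is_partition c b m \<theta> \<and> (\<forall>k<m. \<theta> (Suc k) - \<theta> k < \<delta> \<and> \<tau> k \<in> {\<theta> k..\<theta> (Suc k)})"
    have glue: "\<theta>0 M = c" "\<theta> 0 = c" using p p0 by (auto simp: is_partition_def)
    \<comment> \<open>Both partitions take the value \<open>c\<close> at the junction index
      \<open>M\<close>, so the case distinction joins them without a gap.\<close>
    define \<theta>' where "\<theta>' = (\<lambda>k. if k < M then \<theta>0 k else \<theta> (k - M))"
    define \<tau>' where "\<tau>' = (\<lambda>k. if k < M then \<theta>0 k else \<tau> (k - M))"
    have lo: "\<theta>' k = \<theta>0 k" if "k \<le> M" for k using that glue by (auto simp: \<theta>'_def)
    have hi: "\<theta>' (M + k) = \<theta> k" for k by (simp add: \<theta>'_def)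
    have hi': "\<theta>' (Suc (M + k)) = \<theta> (Suc k)" for k using hi[of "Suc k"] by simp
    have step: "\<theta>' k < \<theta>' (Suc k) \<and> \<theta>' (Suc k) - \<theta>' k < \<delta> \<and> \<tau>' k \<in> {\<theta>' k..\<theta>' (Suc k)}" if "k < M + m" for k
    proof (cases "k < M")
      case True
      have "\<theta>0 k < \<theta>0 (Suc k)" using p0 True by (simp add: is_partition_def)
      then show ?thesis using True lo[of k] lo[of "Suc k"] mesh0[OF True] by (simp add: \<tau>'_def)
    next
      case False
      then obtain j where j: "k = M + j" using le_Suc_ex not_less by blast
      have "j < m" using that j by simp
      then show ?thesis using p hi[of j] hi'[of j] by (simp add: j is_partition_def \<tau>'_def)
    qed
    have "is_partition a b (M + m) \<theta>'"
      unfolding is_partition_def using step lo[of 0] hi[of m] p p0 by (simp add: is_partition_def)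
    then have "dist (\<Sum>k<M + m. (\<eta> (\<theta>' (Suc k)) - \<eta> (\<theta>' k)) *v h (\<tau>' k)) I < \<epsilon>"
      using step by (intro \<delta>) blast
    moreover have "(\<Sum>k<M. (\<eta> (\<theta>' (Suc k)) - \<eta> (\<theta>' k)) *v h (\<tau>' k)) = (\<eta> c - \<eta> a) *v v"
    proof -
      have "(\<Sum>k<M. (\<eta> (\<theta>' (Suc k)) - \<eta> (\<theta>' k)) *v h (\<tau>' k)) =
          (\<Sum>k<M. \<eta> (\<theta>0 (Suc k)) *v v - \<eta> (\<theta>0 k) *v v)"
      proof (intro sum.cong refl)
        fix k assume "k \<in> {..<M}"
        then have "h (\<tau>' k) = v"
          using is_partition_bounds[OF p0, of k] by (simp add: \<tau>'_def const)
        then show "(\<eta> (\<theta>' (Suc k)) - \<eta> (\<theta>' k)) *v h (\<tau>' k) = \<eta> (\<theta>0 (Suc k)) *v v - \<eta> (\<theta>0 k) *v v"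
          using \<open>k \<in> {..<M}\<close> lo[of k] lo[of "Suc k"] by (simp add: matrix_vector_mult_diff_rdistrib)
      qed
      also have "\<dots> = \<eta> (\<theta>0 M) *v v - \<eta> (\<theta>0 0) *v v" by (rule sum_lessThan_telescope)
      also have "\<dots> = (\<eta> c - \<eta> a) *v v"
        using p0 by (simp add: is_partition_def matrix_vector_mult_diff_rdistrib)
      finally show ?thesis .
    qed
    moreover have "(\<Sum>k<m. (\<eta> (\<theta>' (Suc (M + k))) - \<eta> (\<theta>' (M + k))) *v h (\<tau>' (M + k))) =
        (\<Sum>k<m. (\<eta> (\<theta> (Suc k)) - \<eta> (\<theta> k)) *v h (\<tau> k))"
      unfolding hi hi' by (simp add: \<tau>'_def)
    ultimately have "dist ((\<eta> c - \<eta> a) *v v + (\<Sum>k<m. (\<eta> (\<theta> (Suc k)) - \<eta> (\<theta> k)) *v h (\<tau> k))) I < \<epsilon>"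
      by (simp only: sum_lessThan_add)
    moreover have "dist (w + w') I = dist w' (I - w)" for w w' :: "'a^'b"
      by (simp add: dist_norm algebra_simps)
    ultimately show "dist (\<Sum>k<m. (\<eta> (\<theta> (Suc k)) - \<eta> (\<theta> k)) *v h (\<tau> k)) (I - (\<eta> c - \<eta> a) *v v) < \<epsilon>"
      by simp
  qed
qed

text \<open>A partition of \<open>[a,b]\<close> need not contain \<open>c\<close>; moving its last point below \<open>c\<close> up to \<open>c\<close>
  changes a single summand.\<close>

lemma has_RS_integral_extend_constant:
  fixes \<eta> :: "real \<Rightarrow> 'k::{real_normed_field,euclidean_space}^'n^'n"
  assumes I: "has_RS_integral \<eta> h c b I" and "a \<le> c" "c < b"
    and const: "\<And>s. s \<le> c \<Longrightarrow> \<eta> s = \<eta> c"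
    and W: "\<And>s. c \<le> s \<Longrightarrow> s \<le> b \<Longrightarrow> norm (\<eta> s - \<eta> c) \<le> W"
    and cont: "continuous (at c within {a..b}) h"
  shows "has_RS_integral \<eta> h a b I"
  unfolding has_RS_integral_def
proof (intro allI impI)
  fix \<epsilon> :: real assume "\<epsilon> > 0"
  define B where "B = (real CARD('n))\<^sup>2"
  have "0 \<le> W" using W[of c] \<open>c < b\<close> by simp
  have "B > 0" by (simp add: B_def)
  have "\<epsilon> / 2 > 0" using \<open>\<epsilon> > 0\<close> by simp
  then obtain \<delta>1 where "\<delta>1 > 0" and \<delta>1: "\<And>m \<theta> \<tau>. is_partition c b m \<theta> \<and>
        (\<forall>k<m. \<theta> (Suc k) - \<theta> k < \<delta>1 \<and> \<tau> k \<in> {\<theta> k..\<theta> (Suc k)}) \<Longrightarrow>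
        dist (\<Sum>k<m. (\<eta> (\<theta> (Suc k)) - \<eta> (\<theta> k)) *v h (\<tau> k)) I < \<epsilon> / 2"
    using I unfolding has_RS_integral_def by meson
  \<comment> \<open>The \<open>+ 1\<close> keeps the denominator positive when \<open>W\<close> is
    zero.\<close>
  define \<epsilon>' where "\<epsilon>' = \<epsilon> / (2 * (B * W + 1))"
  have BW: "B * W + 1 > 0" using \<open>0 \<le> W\<close> \<open>B > 0\<close> by (simp add: add_nonneg_pos)
  have "\<epsilon>' > 0" using \<open>\<epsilon> > 0\<close> BW by (simp add: \<epsilon>'_def)
  then obtain \<delta>2 where "\<delta>2 > 0" and \<delta>2: "\<And>s. s \<in> {a..b} \<Longrightarrow> dist s c < \<delta>2 \<Longrightarrow> dist (h s) (h c) < \<epsilon>'"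
    using cont unfolding continuous_within_eps_delta by metis
  define \<delta> where "\<delta> = min \<delta>1 \<delta>2"
  have "\<delta> > 0" using \<open>\<delta>1 > 0\<close> \<open>\<delta>2 > 0\<close> by (simp add: \<delta>_def)
  show "\<exists>\<delta>>0. \<forall>m \<theta> \<tau>. is_partition a b m \<theta> \<and>
        (\<forall>k<m. \<theta> (Suc k) - \<theta> k < \<delta> \<and> \<tau> k \<in> {\<theta> k..\<theta> (Suc k)}) \<longrightarrow>
        dist (\<Sum>k<m. (\<eta> (\<theta> (Suc k)) - \<eta> (\<theta> k)) *v h (\<tau> k)) I < \<epsilon>"
  proof (intro exI[of _ \<delta>] conjI allI impI \<open>\<delta> > 0\<close>)
    fix m \<theta> \<tau> assume p: "is_partition a b m \<theta> \<and> (\<forall>k<m. \<theta> (Suc k) - \<theta> k < \<delta> \<and> \<tau> k \<in> {\<theta> k..\<theta> (Suc k)})"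
    then have part: "is_partition a b m \<theta>" and mesh: "\<And>k. k < m \<Longrightarrow> \<theta> (Suc k) - \<theta> k < \<delta>"
      and tag: "\<And>k. k < m \<Longrightarrow> \<theta> k \<le> \<tau> k \<and> \<tau> k \<le> \<theta> (Suc k)" by auto
    have ends: "\<theta> 0 = a" "\<theta> m = b" and step: "\<And>k. k < m \<Longrightarrow> \<theta> k < \<theta> (Suc k)"
      using part by (auto simp: is_partition_def)
    \<comment> \<open>The last partition point not beyond \<open>c\<close>. The subintervals before
      it lie where \<open>\<eta>\<close> is constant and contribute nothing.\<close>
    define k0 where "k0 = Max {k. k \<le> m \<and> \<theta> k \<le> c}"
    have fin: "finite {k. k \<le> m \<and> \<theta> k \<le> c}" by simp
    have "0 \<in> {k. k \<le> m \<and> \<theta> k \<le> c}" using ends \<open>a \<le> c\<close> by simp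
    then have "k0 \<in> {k. k \<le> m \<and> \<theta> k \<le> c}" unfolding k0_def by (intro Max_in fin) blast
    then have k0: "k0 \<le> m" "\<theta> k0 \<le> c" by auto
    then have "k0 < m" using ends \<open>c < b\<close> by (cases "k0 = m") auto
    have above: "c < \<theta> (Suc k0)"
    proof (rule ccontr)
      assume "\<not> c < \<theta> (Suc k0)"
      then have "Suc k0 \<le> k0" unfolding k0_def using \<open>k0 < m\<close> unfolding k0_def by (intro Max_ge fin) auto
      then show False by simp
    qed
    obtain m'' where m'': "m = k0 + Suc m''" using \<open>k0 < m\<close> less_natE by (metis add_Suc_right)
    \<comment> \<open>Putting \<open>c\<close> in place of the point \<open>\<theta> k0\<close> only
      shortens the first remaining subinterval. The maximum moves its tag inside; later tags already
      lie beyond \<open>c\<close>.\<close>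
    define \<theta>' where "\<theta>' = (\<lambda>j. if j = 0 then c else \<theta> (k0 + j))"
    define \<tau>' where "\<tau>' = (\<lambda>j. max c (\<tau> (k0 + j)))"
    have far: "c < \<theta> (k0 + Suc j)" if "j \<le> m''" for j
      using is_partition_mono[OF part, of "Suc k0" "k0 + Suc j"] above that m'' by simp
    have "is_partition c b (Suc m'') \<theta>' \<and>
        (\<forall>k<Suc m''. \<theta>' (Suc k) - \<theta>' k < \<delta>1 \<and> \<tau>' k \<in> {\<theta>' k..\<theta>' (Suc k)})"
    proof (intro conjI allI impI)
      show "is_partition c b (Suc m'') \<theta>'"
        unfolding is_partition_def
      proof (intro conjI allI impI)
        show "\<theta>' (Suc m'') = b" using ends m'' by (simp add: \<theta>'_def)
        fix k assume "k < Suc m''"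
        then show "\<theta>' k < \<theta>' (Suc k)" using above step[of "k0 + k"] m'' by (simp add: \<theta>'_def)
      qed (simp add: \<theta>'_def)
      fix k assume k: "k < Suc m''"
      then have km: "k0 + k < m" using m'' by simp
      show "\<theta>' (Suc k) - \<theta>' k < \<delta>1"
        using mesh[OF km] k0 by (auto simp: \<theta>'_def \<delta>_def)
      show "\<tau>' k \<in> {\<theta>' k..\<theta>' (Suc k)}"
        using tag[OF km] above far[of "k - 1"] k by (cases k) (auto simp: \<theta>'_def \<tau>'_def)
    qed
    then have near: "dist (\<Sum>k<Suc m''. (\<eta> (\<theta>' (Suc k)) - \<eta> (\<theta>' k)) *v h (\<tau>' k)) I < \<epsilon> / 2"
      by (rule \<delta>1)
    let ?S = "\<Sum>k<m. (\<eta> (\<theta> (Suc k)) - \<eta> (\<theta> k)) *v h (\<tau> k)"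
    let ?S' = "\<Sum>k<Suc m''. (\<eta> (\<theta>' (Suc k)) - \<eta> (\<theta>' k)) *v h (\<tau>' k)"
    let ?R = "\<Sum>k<m''. (\<eta> (\<theta> (k0 + Suc (Suc k))) - \<eta> (\<theta> (k0 + Suc k))) *v h (\<tau> (k0 + Suc k))"
    have S: "?S = (\<eta> (\<theta> (Suc k0)) - \<eta> c) *v h (\<tau> k0) + ?R"
    proof -
      have "(\<Sum>k<k0. (\<eta> (\<theta> (Suc k)) - \<eta> (\<theta> k)) *v h (\<tau> k)) = 0"
      proof (intro sum.neutral ballI)
        fix k assume "k \<in> {..<k0}"
        then have "\<theta> k \<le> c" "\<theta> (Suc k) \<le> c"
          using is_partition_mono[OF part, of k k0] is_partition_mono[OF part, of "Suc k" k0] k0 by auto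
        then have "\<eta> (\<theta> k) = \<eta> c" "\<eta> (\<theta> (Suc k)) = \<eta> c" using const by blast+
        then show "(\<eta> (\<theta> (Suc k)) - \<eta> (\<theta> k)) *v h (\<tau> k) = 0" by simp
      qed
      moreover have "\<eta> (\<theta> k0) = \<eta> c" using const[OF k0(2)] .
      ultimately show ?thesis
        unfolding m'' sum_lessThan_add sum.lessThan_Suc_shift by simp
    qed
    have S': "?S' = (\<eta> (\<theta> (Suc k0)) - \<eta> c) *v h (max c (\<tau> k0)) + ?R"
    proof -
      have "(\<Sum>k<m''. (\<eta> (\<theta>' (Suc (Suc k))) - \<eta> (\<theta>' (Suc k))) *v h (\<tau>' (Suc k))) = ?R"
      proof (intro sum.cong refl)
        fix k assume k: "k \<in> {..<m''}"
        then have "\<tau>' (Suc k) = \<tau> (k0 + Suc k)"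
          using far[of k] tag[of "k0 + Suc k"] m'' by (simp add: \<tau>'_def)
        then show "(\<eta> (\<theta>' (Suc (Suc k))) - \<eta> (\<theta>' (Suc k))) *v h (\<tau>' (Suc k)) =
            (\<eta> (\<theta> (k0 + Suc (Suc k))) - \<eta> (\<theta> (k0 + Suc k))) *v h (\<tau> (k0 + Suc k))"
          by (simp add: \<theta>'_def)
      qed
      then show ?thesis unfolding sum.lessThan_Suc_shift by (simp add: \<theta>'_def \<tau>'_def)
    qed
    \<comment> \<open>The sums differ only in the tag of summand \<open>k0\<close>, and only if that
      tag lies below \<open>c\<close>; it is then within the mesh of \<open>c\<close>, where
      \<open>h\<close> is continuous.\<close>
    have "norm (?S - ?S') = norm ((\<eta> (\<theta> (Suc k0)) - \<eta> c) *v (h (\<tau> k0) - h (max c (\<tau> k0))))"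
      unfolding S S' by (simp add: matrix_vector_mult_diff_distrib)
    also have "\<dots> \<le> B * norm (\<eta> (\<theta> (Suc k0)) - \<eta> c) * norm (h (\<tau> k0) - h (max c (\<tau> k0)))"
      unfolding B_def by (rule norm_matrix_vector_mult_le)
    also have "\<dots> \<le> B * W * \<epsilon>'"
    proof (intro mult_mono mult_left_mono)
      show "norm (\<eta> (\<theta> (Suc k0)) - \<eta> c) \<le> W"
        using above is_partition_bounds(2)[OF part, of "Suc k0"] \<open>k0 < m\<close> by (intro W) auto
      show "norm (h (\<tau> k0) - h (max c (\<tau> k0))) \<le> \<epsilon>'"
      proof (cases "c \<le> \<tau> k0")
        case True
        then show ?thesis using \<open>\<epsilon>' > 0\<close> by (simp add: max_absorb2)
      next
        case False
        have "dist (h (\<tau> k0)) (h c) < \<epsilon>'"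
        proof (rule \<delta>2)
          show "\<tau> k0 \<in> {a..b}"
            using tag[OF \<open>k0 < m\<close>] is_partition_bounds[OF part, of k0] k0 False \<open>c < b\<close> by auto
          show "dist (\<tau> k0) c < \<delta>2"
            using tag[OF \<open>k0 < m\<close>] mesh[OF \<open>k0 < m\<close>] k0 above False by (auto simp: dist_real_def \<delta>_def)
        qed
        then show ?thesis using False by (simp add: dist_norm)
      qed
    qed (use \<open>B > 0\<close> \<open>0 \<le> W\<close> in auto)
    also have "\<dots> \<le> (B * W + 1) * \<epsilon>'" using \<open>\<epsilon>' > 0\<close> by simp
    also have "\<dots> = \<epsilon> / 2"
      unfolding \<epsilon>'_def using BW by (metis less_irrefl mult.commute nonzero_mult_divide_mult_cancel_left times_divide_eq_right)
    finally have "dist ?S ?S' \<le> \<epsilon> / 2" by (simp add: dist_norm)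
    then show "dist ?S I < \<epsilon>" using near dist_triangle[of ?S I ?S'] by linarith
  qed
qed

text \<open>The majorant \<open>v\<close> is the total variation of \<open>\<eta>\<close> on \<open>[a,s]\<close> as a function of \<open>s\<close>.\<close>

lemma bounded_variation_majorant:
  fixes \<eta> :: "real \<Rightarrow> 'k::{real_normed_field,euclidean_space}^'n^'n"
  assumes bv: "bounded_variation_on \<eta> a b"
  obtains v where "\<And>s t. \<lbrakk>a \<le> s; s \<le> t; t \<le> b\<rbrakk> \<Longrightarrow> norm (\<eta> t - \<eta> s) \<le> v t - v s"
proof -
  obtain K where K: "\<And>m \<theta>. is_partition a b m \<theta> \<Longrightarrow> (\<Sum>k<m. norm (\<eta> (\<theta> (Suc k)) - \<eta> (\<theta> k))) \<le> K"
    using bv unfolding bounded_variation_on_def by meson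
  define S where "S = (\<lambda>s. {\<Sum>k<m. norm (\<eta> (\<theta> (Suc k)) - \<eta> (\<theta> k)) | m \<theta>. is_partition a s m \<theta>})"
  \<comment> \<open>Partitions increase strictly, so the new endpoint can be appended only when
    \<open>s < t\<close>; \<open>grow\<close> treats equality apart.\<close>
  have extend: "is_partition a t (Suc m) (\<lambda>k. if k \<le> m then \<theta> k else t) \<and>
      (\<Sum>k<Suc m. norm (\<eta> ((\<lambda>k. if k \<le> m then \<theta> k else t) (Suc k)) - \<eta> ((\<lambda>k. if k \<le> m then \<theta> k else t) k)))
        = (\<Sum>k<m. norm (\<eta> (\<theta> (Suc k)) - \<eta> (\<theta> k))) + norm (\<eta> t - \<eta> s)"
    if "is_partition a s m \<theta>" "s < t" for s t m \<theta>
  proof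
    show "is_partition a t (Suc m) (\<lambda>k. if k \<le> m then \<theta> k else t)"
      using that by (auto simp: is_partition_def less_Suc_eq)
    have "(\<Sum>k<m. norm (\<eta> (if Suc k \<le> m then \<theta> (Suc k) else t) - \<eta> (if k \<le> m then \<theta> k else t)))
        = (\<Sum>k<m. norm (\<eta> (\<theta> (Suc k)) - \<eta> (\<theta> k)))"
      by (intro sum.cong) auto
    then show "(\<Sum>k<Suc m. norm (\<eta> ((\<lambda>k. if k \<le> m then \<theta> k else t) (Suc k)) - \<eta> ((\<lambda>k. if k \<le> m then \<theta> k else t) k)))
        = (\<Sum>k<m. norm (\<eta> (\<theta> (Suc k)) - \<eta> (\<theta> k))) + norm (\<eta> t - \<eta> s)"
      using that by (simp add: is_partition_def)
  qed
  have grow: "\<exists>w\<in>S t. u + norm (\<eta> t - \<eta> s) \<le> w" if us: "u \<in> S s" and "s \<le> t" for s t u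
  proof (cases "s = t")
    case True
    then show ?thesis using that by auto
  next
    case False
    then have "s < t" using that by simp
    obtain m \<theta> where p: "is_partition a s m \<theta>" and u: "u = (\<Sum>k<m. norm (\<eta> (\<theta> (Suc k)) - \<eta> (\<theta> k)))"
      using us by (auto simp: S_def)
    have "u + norm (\<eta> t - \<eta> s) \<in> S t"
      unfolding S_def mem_Collect_eq u using extend[OF p \<open>s < t\<close>]
      by (intro exI[of _ "Suc m"] exI[of _ "\<lambda>k. if k \<le> m then \<theta> k else t"]) (simp only: simp_thms)
    then show ?thesis by blast
  qed
  have ne: "S s \<noteq> {}" if s: "a \<le> s" for s
  proof -
    obtain m \<theta> where "is_partition a s m \<theta>" using exists_fine_partition[OF s zero_less_one] by metis
    then show ?thesis unfolding S_def by blast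
  qed
  \<comment> \<open>A sum over \<open>[a,s]\<close> is enlarged to one over \<open>[a,b]\<close>,
    where the hypothesis gives the bound \<open>K\<close>.\<close>
  have bdd: "bdd_above (S s)" if sb: "s \<le> b" for s
  proof (rule bdd_aboveI)
    fix u assume "u \<in> S s"
    then obtain w where w: "w \<in> S b" "u + norm (\<eta> b - \<eta> s) \<le> w" using grow[OF _ sb] by blast
    then have "w \<le> K" unfolding S_def using K by blast
    then show "u \<le> K" using w(2) norm_ge_zero[of "\<eta> b - \<eta> s"] by linarith
  qed
  show ?thesis
  proof (rule that[of "\<lambda>s. Sup (S s)"])
    fix s t assume st: "a \<le> s" "s \<le> t" "t \<le> b"
    have "Sup (S s) \<le> Sup (S t) - norm (\<eta> t - \<eta> s)"
    proof (rule cSup_least[OF ne[OF st(1)]])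
      fix u assume "u \<in> S s"
      then obtain w where "w \<in> S t" "u + norm (\<eta> t - \<eta> s) \<le> w" using grow st by blast
      moreover have "w \<le> Sup (S t)" by (rule cSup_upper[OF \<open>w \<in> S t\<close> bdd[OF st(3)]])
      ultimately show "u \<le> Sup (S t) - norm (\<eta> t - \<eta> s)" by linarith
    qed
    then show "norm (\<eta> t - \<eta> s) \<le> Sup (S t) - Sup (S s)" by linarith
  qed
qed

text \<open>Jordan decomposition by coordinates: each coordinate is the difference of the increasing
  functions \<open>f t \<bullet> i + v t\<close> and \<open>v t\<close>, and increasing functions
  are measurable.\<close>

lemma borel_measurable_of_increasing_majorant:
  fixes f :: "real \<Rightarrow> 'e::euclidean_space"
  assumes v: "\<And>s t. \<lbrakk>a \<le> s; s \<le> t; t \<le> b\<rbrakk> \<Longrightarrow> norm (f t - f s) \<le> v t - v s"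
  shows "f \<in> borel_measurable (lebesgue_on {a..b})"
proof (subst borel_measurable_euclidean_space, rule ballI)
  have mono_meas: "g \<in> borel_measurable (lebesgue_on {a..b})" if "mono_on {a..b} g" for g :: "real \<Rightarrow> real"
  proof -
    have "g integrable_on {a..b}" using that by (rule integrable_on_mono_on)
    then show ?thesis by (rule integrable_imp_measurable)
  qed
  fix i :: 'e assume i: "i \<in> Basis"
  have "mono_on {a..b} v"
    by (rule mono_onI) (smt (verit) v atLeastAtMost_iff norm_ge_zero)
  moreover have "mono_on {a..b} (\<lambda>t. f t \<bullet> i + v t)"
  proof (rule mono_onI)
    fix s t assume "s \<in> {a..b}" "t \<in> {a..b}" "s \<le> t"
    then have "norm (f t - f s) \<le> v t - v s" by (intro v) auto
    moreover have "\<bar>(f t - f s) \<bullet> i\<bar> \<le> norm (f t - f s)" using i by (rule Basis_le_norm)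
    ultimately show "f s \<bullet> i + v s \<le> f t \<bullet> i + v t" by (simp add: inner_diff_left)
  qed
  ultimately have "(\<lambda>t. (f t \<bullet> i + v t) - v t) \<in> borel_measurable (lebesgue_on {a..b})"
    by (intro borel_measurable_diff mono_meas)
  then show "(\<lambda>t. f t \<bullet> i) \<in> borel_measurable (lebesgue_on {a..b})" by simp
qed

section \<open>Mild solutions\<close>

lemma Lp_on_1_imp_absolutely_integrable:
  assumes "Lp_on 1 S f" "S \<in> sets lebesgue"
  shows "f absolutely_integrable_on S"
  using assms by (simp add: absolutely_integrable_measurable Lp_on_def o_def)

lemma Lp_on_extend_zero:
  assumes f: "Lp_on p S f" and S: "S \<in> sets lebesgue" and T: "T \<in> sets lebesgue"
  shows "Lp_on p T (\<lambda>t. if t \<in> S then f t else 0)"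
proof -
  let ?g = "\<lambda>t. if t \<in> S then f t else 0"
  have restrict: "integrable (lebesgue_on T) h" if "integrable lebesgue h" for h :: "real \<Rightarrow> real"
  proof -
    have "h absolutely_integrable_on UNIV" using that by (simp add: set_integrable_def)
    then have "h absolutely_integrable_on T" by (rule set_integrable_subset) (use T in auto)
    then show ?thesis by (simp add: integrable_lebesgue_on_iff[OF T])
  qed
  have "?g \<in> borel_measurable lebesgue"
    using f S by (intro borel_measurable_if_I) (simp_all add: Lp_on_def)
  then have m: "?g \<in> borel_measurable (lebesgue_on T)" by (rule measurable_restrict_space1)
  show ?thesis
  proof (cases "p = \<infinity>")
    case True
    then obtain M where M: "AE t in lebesgue_on S. norm (f t) \<le> M" using f by (auto simp: Lp_on_def)
    \<comment> \<open>On a null set \<open>S\<close> the essential bound \<open>M\<close> may be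
      negative, hence the maximum with zero.\<close>
    have "AE t in lebesgue. t \<in> T \<longrightarrow> norm (?g t) \<le> max M 0"
      using M unfolding AE_lebesgue_on_iff[OF S] by (rule eventually_mono) auto
    then have "\<exists>M. AE t in lebesgue_on T. norm (?g t) \<le> M" unfolding AE_lebesgue_on_iff[OF T] by (rule exI)
    then show ?thesis using m True unfolding Lp_on_def by (simp only: if_True simp_thms)
  next
    case False
    have "integrable lebesgue (\<lambda>t. indicator S t *\<^sub>R (norm (f t) powr enn2real p))"
      using f False S by (simp add: Lp_on_def integrable_lebesgue_on_iff set_integrable_def)
    moreover have "(\<lambda>t. indicator S t *\<^sub>R (norm (f t) powr enn2real p)) = (\<lambda>t. norm (?g t) powr enn2real p)"
      by (auto simp: fun_eq_iff indicator_def)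
    ultimately show ?thesis using m False restrict by (simp add: Lp_on_def)
  qed
qed

lemma Lp_loc_imp_Lp_on:
  assumes N: "is_norm N" and f: "f \<in> Lp_loc N p J" and sub: "{a..b} \<subseteq> J"
  shows "Lp_on p {a..b} (\<lambda>t. the (f t))"
proof -
  have "f |` {a..b} \<in> Lp N p {a..b}" using f sub by (simp add: Lp_loc_def)
  then have "Lp_on p {a..b} (\<lambda>t. the ((f |` {a..b}) t))" by (simp add: Lp_iff_Lp_on[OF N])
  then show ?thesis by (rule Lp_on_cong_AE[rotated]) (auto intro: AE_I2)
qed

text \<open>Reduces local integrability of a partial function to a total representative on the
  intervals \<open>[0,T]\<close>.\<close>

lemma Lp_loc_half_lineI:
  assumes N: "is_norm N" and dom: "dom f \<subseteq> {0..}"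
    and eq: "AE t in lebesgue_on {0..}. f t = Some (g t)"
    and g: "\<And>T. 0 \<le> T \<Longrightarrow> Lp_on p {0..T} g"
  shows "f \<in> Lp_loc N p {0..}"
  unfolding Lp_loc_def
proof (intro CollectI conjI allI impI dom)
  fix a b :: real assume sub: "{a..b} \<subseteq> {0..}"
  \<comment> \<open>The maximum with zero covers an empty interval whose right end \<open>b\<close>
    is negative.\<close>
  have Lp_g: "Lp_on p {a..b} g"
    by (rule Lp_on_subset[OF g[of "max b 0"]]) (use sub in auto)
  have eq': "AE t in lebesgue_on {a..b}. (f |` {a..b}) t = Some (g t)"
  proof -
    have "AE t in lebesgue. t \<in> {0..} \<longrightarrow> f t = Some (g t)" using eq by (simp add: AE_lebesgue_on_iff)
    then have "AE t in lebesgue. t \<in> {a..b} \<longrightarrow> (f |` {a..b}) t = Some (g t)"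
      by (rule eventually_mono) (use sub in auto)
    then show ?thesis by (simp add: AE_lebesgue_on_iff)
  qed
  have "AE t in lebesgue_on {a..b}. g t = the ((f |` {a..b}) t)"
    using eq' by (rule eventually_mono) simp
  from Lp_on_cong_AE[OF _ Lp_g this]
  have "Lp_on p {a..b} (\<lambda>t. the ((f |` {a..b}) t))" by simp
  moreover have "AE t in lebesgue_on {a..b}. t \<in> dom (f |` {a..b})"
    using eq' by (rule eventually_mono) blast
  ultimately show "f |` {a..b} \<in> Lp N p {a..b}"
    by (simp add: Lp_iff_Lp_on[OF N])
qed

context point_mass_limit
begin

lemma flow_absolutely_continuous:
  assumes y: "y absolutely_integrable_on {-r..T}" and "\<epsilon> > 0"
  obtains \<delta> where "\<delta> > 0"
    "\<And>m u v. \<lbrakk>\<And>k. k < (m::nat) \<Longrightarrow> 0 \<le> u k \<and> u k \<le> v k \<and> v k \<le> T;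
       \<And>i j. \<lbrakk>i < m; j < m; i \<noteq> j\<rbrakk> \<Longrightarrow> {u i<..<v i} \<inter> {u j<..<v j} = {};
       (\<Sum>k<m. v k - u k) < \<delta>\<rbrakk> \<Longrightarrow>
       (\<Sum>k<m. norm (flow (\<lambda>t. integral {-r..t} y) (v k) - flow (\<lambda>t. integral {-r..t} y) (u k))) \<le> \<epsilon>"
proof -
  let ?Y = "\<lambda>t. integral {-r..t} y"
  have ny: "(\<lambda>x. norm (y x)) integrable_on {-r..T}" and yi: "y integrable_on {-r..T}"
    using y by (auto simp: absolutely_integrable_on_def)
  have Y: "continuous_on {-r..T} ?Y" by (rule indefinite_integral_continuous_1[OF yi])
  have "\<epsilon> / V > 0" using \<open>\<epsilon> > 0\<close> V_pos by simp
  from integral_absolutely_continuous[OF ny norm_ge_zero this]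
  obtain \<delta> where "\<delta> > 0" and
    \<delta>: "\<And>m u v. \<lbrakk>\<And>k. k < (m::nat) \<Longrightarrow> -r \<le> u k \<and> u k \<le> v k \<and> v k \<le> T;
       \<And>i j. \<lbrakk>i < m; j < m; i \<noteq> j\<rbrakk> \<Longrightarrow> {u i<..<v i} \<inter> {u j<..<v j} = {};
       (\<Sum>k<m. v k - u k) < \<delta>\<rbrakk> \<Longrightarrow> (\<Sum>k<m. integral {u k..v k} (\<lambda>x. norm (y x))) < \<epsilon> / V"
    by blast
  show ?thesis
  proof (rule that[OF \<open>\<delta> > 0\<close>])
    fix m :: nat and u v :: "nat \<Rightarrow> real"
    assume uv: "\<And>k. k < m \<Longrightarrow> 0 \<le> u k \<and> u k \<le> v k \<and> v k \<le> T"
      and disj: "\<And>i j. \<lbrakk>i < m; j < m; i \<noteq> j\<rbrakk> \<Longrightarrow> {u i<..<v i} \<inter> {u j<..<v j} = {}"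
      and less: "(\<Sum>k<m. v k - u k) < \<delta>"
    have "(\<Sum>k<m. norm (flow ?Y (v k) - flow ?Y (u k))) \<le> V * (\<epsilon> / V)"
    proof (rule flow_variation[OF Y])
      fix \<theta> assume \<theta>: "\<theta> \<in> {-r..0}"
      have "(\<Sum>k<m. norm (?Y (v k + \<theta>) - ?Y (u k + \<theta>)))
          \<le> (\<Sum>k<m. integral {u k + \<theta>..v k + \<theta>} (\<lambda>x. norm (y x)))"
        by (intro sum_mono norm_indefinite_integral_diff_le[OF y]) (use uv \<theta> in force)+
      also have "\<dots> < \<epsilon> / V"
      proof (rule \<delta>)
        show "-r \<le> u k + \<theta> \<and> u k + \<theta> \<le> v k + \<theta> \<and> v k + \<theta> \<le> T" if "k < m" for k
          using uv[OF that] \<theta> by auto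
        show "{u i + \<theta><..<v i + \<theta>} \<inter> {u j + \<theta><..<v j + \<theta>} = {}" if "i < m" "j < m" "i \<noteq> j" for i j
        proof (rule equals0I)
          fix x assume "x \<in> {u i + \<theta><..<v i + \<theta>} \<inter> {u j + \<theta><..<v j + \<theta>}"
          then have "x - \<theta> \<in> {u i<..<v i} \<inter> {u j<..<v j}" by auto
          then show False using disj[OF that] by blast
        qed
        show "(\<Sum>k<m. v k + \<theta> - (u k + \<theta>)) < \<delta>" using less by simp
      qed
      finally show "(\<Sum>k<m. norm (?Y (v k + \<theta>) - ?Y (u k + \<theta>))) \<le> \<epsilon> / V" by simp
    qed (use uv in auto)
    then show "(\<Sum>k<m. norm (flow ?Y (v k) - flow ?Y (u k))) \<le> \<epsilon>" using V_pos by simp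
  qed
qed

text \<open>For \<open>p = \<infinity>\<close> the antiderivative of \<open>y\<close> is Lipschitz.
  For finite \<open>p\<close>, Jensen's inequality compares powers of its increments with increments
  of an antiderivative of the power of \<open>norm (y t)\<close>, the form that
  \<open>flow_derivative_powr_integrable\<close> requires.\<close>

lemma flow_derivative_Lp_on:
  assumes y: "y absolutely_integrable_on {-r..T}" and Lp: "Lp_on p {-r..T} y" and "1 \<le> p"
    and b: "0 \<le> b" "b < T"
    and D: "AE t in lebesgue_on {0..b}. (flow (\<lambda>t. integral {-r..t} y) has_vector_derivative D t) (at t)"
  shows "Lp_on p {0..b} D"
proof -
  let ?Y = "\<lambda>t. integral {-r..t} y"
  have ny: "(\<lambda>x. norm (y x)) integrable_on {-r..T}" and yi: "y integrable_on {-r..T}"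
    using y by (auto simp: absolutely_integrable_on_def)
  have Y: "continuous_on {-r..T} ?Y" by (rule indefinite_integral_continuous_1[OF yi])
  have "continuous_on {0..b + (T - b)} (flow ?Y)" using continuous_on_flow[OF Y] by simp
  then have Dm: "D \<in> borel_measurable (lebesgue_on {0..b})"
    using b D by (intro vector_derivative_measurable[of 0 b "T - b"]) auto
  show ?thesis
  proof (cases "p = \<infinity>")
    case True
    then obtain M where M: "AE t in lebesgue_on {-r..T}. norm (y t) \<le> M" using Lp by (auto simp: Lp_on_def)
    have lip: "norm (?Y v - ?Y u) \<le> M * (v - u)" if uv: "-r \<le> u" "u \<le> v" "v \<le> T" for u v
    proof -
      have sub: "{u..v} \<subseteq> {-r..T}" using uv by auto
      have "norm (?Y v - ?Y u) \<le> integral {u..v} (\<lambda>x. norm (y x))"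
        by (rule norm_indefinite_integral_diff_le[OF y uv])
      also have "\<dots> \<le> integral {u..v} (\<lambda>x. M)"
      proof -
        have "AE t in lebesgue. t \<in> {-r..T} \<longrightarrow> norm (y t) \<le> M" using M by (simp add: AE_lebesgue_on_iff)
        then have "AE t in lebesgue. t \<in> {u..v} \<longrightarrow> norm (y t) \<le> M"
          by (rule eventually_mono) (use sub in auto)
        then have AEM: "AE t in lebesgue_on {u..v}. norm (y t) \<le> M" by (simp add: AE_lebesgue_on_iff)
        have "(\<lambda>x. norm (y x)) absolutely_integrable_on {-r..T}" using absolutely_integrable_norm[OF y] by (simp add: o_def)
        then have "(\<lambda>x. norm (y x)) absolutely_integrable_on {u..v}" by (rule set_integrable_subset) (use sub in auto)
        then have i1: "integrable (lebesgue_on {u..v}) (\<lambda>x. norm (y x))" by (simp add: integrable_lebesgue_on_iff)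
        have Icc: "{u..v} \<in> sets lebesgue" by simp
        have i2: "integrable (lebesgue_on {u..v}) (\<lambda>x. M)" by (intro continuous_imp_integrable_real) simp
        show ?thesis
          using integral_mono_AE[OF i1 i2 AEM]
          unfolding lebesgue_integral_eq_integral[OF i1 Icc] lebesgue_integral_eq_integral[OF i2 Icc] .
      qed
      also have "\<dots> = M * (v - u)" using uv by simp
      finally show ?thesis .
    qed
    have "AE t in lebesgue_on {0..b}. norm (D t) \<le> V * M"
      using D AE_space
    proof eventually_elim
      case (elim t)
      then show ?case using b by (intro flow_derivative_bounded[OF Y lip, of t]) auto
    qed
    then show ?thesis using True Dm by (auto simp: Lp_on_def)
  next
    case False
    define q where "q = enn2real p"
    have q: "q \<ge> 1" unfolding q_def by (rule enn2real_ge_1[OF \<open>1 \<le> p\<close> False])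
    have "integrable (lebesgue_on {-r..T}) (\<lambda>t. norm (y t) powr q)" using Lp False by (simp add: Lp_on_def q_def)
    then have up: "(\<lambda>t. norm (y t) powr q) integrable_on {-r..T}" by (rule integrable_on_lebesgue_on) simp
    let ?U = "\<lambda>t. integral {-r..t} (\<lambda>t. norm (y t) powr q)"
    have sub: "(\<lambda>t. norm (y t) powr q) integrable_on {u..v}" if "-r \<le> u" "v \<le> T" for u v
      by (rule integrable_on_subinterval[OF up]) (use that in auto)
    have Udiff: "?U v - ?U u = integral {u..v} (\<lambda>t. norm (y t) powr q)" if "-r \<le> u" "u \<le> v" "v \<le> T" for u v
      using Henstock_Kurzweil_Integration.integral_combine[OF that(1,2) sub[of "-r" v]] that by simp
    have "integrable (lebesgue_on {0..b}) (\<lambda>t. norm (D t) powr q)"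
    proof (rule flow_derivative_powr_integrable[OF q Y])
      show "continuous_on {-r..T} ?U" by (rule indefinite_integral_continuous_1[OF up])
      show "mono_on {-r..T} ?U"
      proof (rule mono_onI)
        fix u v assume "u \<in> {-r..T}" "v \<in> {-r..T}" "u \<le> v"
        then have "0 \<le> ?U v - ?U u" by (subst Udiff) (auto intro!: integral_nonneg sub)
        then show "?U u \<le> ?U v" by simp
      qed
      fix u v assume uv: "-r \<le> u" "u \<le> v" "v \<le> T"
      have "norm (?Y v - ?Y u) powr q \<le> (integral {u..v} (\<lambda>x. norm (y x))) powr q"
        using q by (intro powr_mono2 norm_indefinite_integral_diff_le[OF y uv]) auto
      also have "\<dots> \<le> (v - u) powr (q - 1) * integral {u..v} (\<lambda>x. norm (y x) powr q)"
        using uv by (intro integral_powr_le q sub integrable_on_subinterval[OF ny]) auto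
      finally show "norm (?Y v - ?Y u) powr q \<le> (v - u) powr (q - 1) * (?U v - ?U u)"
        by (simp only: Udiff[OF uv])
    qed (use b D in auto)
    then show ?thesis using False Dm by (simp add: Lp_on_def q_def)
  qed
qed

text \<open>The point sums are continuous in \<open>t\<close> and converge pointwise.\<close>

lemma borel_measurable_L_shift:
  assumes z: "continuous_on UNIV z" and S: "S \<in> sets lebesgue"
  shows "(\<lambda>t. L (\<lambda>\<theta>. z (t + \<theta>))) \<in> borel_measurable (lebesgue_on S)"
proof (rule borel_measurable_LIMSEQ_metric)
  have shift: "continuous_on X (\<lambda>t. z (f t))" if "continuous_on X f" for f X
    by (rule continuous_on_compose2[OF z that]) simp
  fix n
  have "continuous_on S (\<lambda>t. \<Sum>k<m n. A n k (z (t + s n k)))"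
  proof (rule continuous_on_sum)
    fix k assume "k \<in> {..<m n}"
    then have "bounded_linear (A n k)" using linear[of k n] by (simp add: linear_conv_bounded_linear)
    then show "continuous_on S (\<lambda>t. A n k (z (t + s n k)))"
      by (rule bounded_linear.continuous_on) (intro shift continuous_intros)
  qed
  then show "(\<lambda>t. \<Sum>k<m n. A n k (z (t + s n k))) \<in> borel_measurable (lebesgue_on S)"
    by (rule continuous_imp_measurable_on_sets_lebesgue[OF _ S])
next
  fix t
  have "continuous_on {-r..0} (\<lambda>\<theta>. z (t + \<theta>))"
    by (rule continuous_on_compose2[OF z]) (auto intro!: continuous_intros)
  then show "(\<lambda>n. \<Sum>k<m n. A n k (z (t + s n k))) \<longlonglongrightarrow> L (\<lambda>\<theta>. z (t + \<theta>))"
    by (rule lim)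
qed

end

text \<open>The weights are increments of \<open>\<eta>\<close> in norm, up to a dimensional factor;
  the majorant \<open>v\<close> telescopes along each partition and bounds their total
  uniformly.\<close>

lemma RS_functional_point_mass_limit:
  fixes \<eta> :: "real \<Rightarrow> 'k::{real_normed_field,euclidean_space}^'n^'n"
  assumes "r > 0" and v: "\<And>s t. \<lbrakk>-r \<le> s; s \<le> t; t \<le> 0\<rbrakk> \<Longrightarrow> norm (\<eta> t - \<eta> s) \<le> v t - v s"
    and L: "\<And>\<psi>. continuous_on {-r..0} \<psi> \<Longrightarrow> has_RS_integral \<eta> \<psi> (-r) 0 (L \<psi>)"
  shows "\<exists>V m A c s. point_mass_limit r V L m A c s"
proof -
  define \<theta> where "\<theta> = (\<lambda>n k. -r + real k * (0 - (-r)) / real (Suc n))"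
  define B where "B = (real CARD('n))\<^sup>2"
  have B: "B \<ge> 0" by (simp add: B_def)
  have part: "is_partition (-r) 0 (Suc n) (\<theta> n)" for n
    unfolding \<theta>_def using \<open>r > 0\<close> by (intro is_partition_uniform) simp
  have v0: "v (-r) \<le> v 0" using v[of "-r" 0] norm_ge_zero[of "\<eta> 0 - \<eta> (-r)"] \<open>r > 0\<close> by linarith
  \<comment> \<open>The factor \<open>B\<close> comes from the matrix-vector estimate, and
    \<open>+ 1\<close> makes the mass positive even for constant \<open>\<eta>\<close>.\<close>
  have "point_mass_limit r (B * (v 0 - v (-r)) + 1) L Suc
      (\<lambda>n k w. (\<eta> (\<theta> n (Suc k)) - \<eta> (\<theta> n k)) *v w) (\<lambda>n k. B * norm (\<eta> (\<theta> n (Suc k)) - \<eta> (\<theta> n k))) \<theta>"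
  proof (rule point_mass_limit.intro)
    show "0 < B * (v 0 - v (-r)) + 1" using B v0 by (simp add: add_nonneg_pos)
    fix n
    have "(\<Sum>k<Suc n. norm (\<eta> (\<theta> n (Suc k)) - \<eta> (\<theta> n k))) \<le> (\<Sum>k<Suc n. v (\<theta> n (Suc k)) - v (\<theta> n k))"
    proof (rule sum_mono)
      fix k assume "k \<in> {..<Suc n}"
      then show "norm (\<eta> (\<theta> n (Suc k)) - \<eta> (\<theta> n k)) \<le> v (\<theta> n (Suc k)) - v (\<theta> n k)"
        using is_partition_bounds[OF part, of k n] is_partition_bounds[OF part, of "Suc k" n]
          is_partition_mono[OF part, of k "Suc k" n] by (intro v) auto
    qed
    also have "\<dots> = v 0 - v (-r)" 
      using part[of n] sum_lessThan_telescope[of "\<lambda>k. v (\<theta> n k)" "Suc n"] by (simp only: is_partition_def)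
    finally show "(\<Sum>k<Suc n. B * norm (\<eta> (\<theta> n (Suc k)) - \<eta> (\<theta> n k))) \<le> B * (v 0 - v (-r)) + 1"
      using mult_left_mono[OF _ B] unfolding sum_distrib_left[symmetric] by (smt (verit))
    fix k assume k: "k < Suc n"
    show "norm ((\<eta> (\<theta> n (Suc k)) - \<eta> (\<theta> n k)) *v w) \<le> B * norm (\<eta> (\<theta> n (Suc k)) - \<eta> (\<theta> n k)) * norm w" for w
      unfolding B_def by (rule norm_matrix_vector_mult_le)
    show "linear (\<lambda>w. (\<eta> (\<theta> n (Suc k)) - \<eta> (\<theta> n k)) *v w)" by (rule linear_matrix_vector_mult_right)
    show "\<theta> n k \<in> {-r..0}" using is_partition_bounds[OF part, of k n] k by auto
  next
    fix \<psi> :: "real \<Rightarrow> 'k^'n" assume "continuous_on {-r..0} \<psi>"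
    from has_RS_integral_imp_tendsto[OF L[OF this]] \<open>r > 0\<close>
    show "(\<lambda>n. \<Sum>k<Suc n. (\<eta> (\<theta> n (Suc k)) - \<eta> (\<theta> n k)) *v \<psi> (\<theta> n k)) \<longlonglongrightarrow> L \<psi>"
      unfolding \<theta>_def by simp
  qed (use \<open>r > 0\<close> B in auto)
  then show ?thesis by blast
qed

theorem theorem1p3:
  fixes N :: "'k::{real_normed_field,euclidean_space}^'n \<Rightarrow> real"
    and r :: real
    and L :: "(real \<Rightarrow> 'k^'n) \<Rightarrow> 'k^'n"
    and \<eta> :: "real \<Rightarrow> 'k^'n^'n"
    and p :: ennreal
    and \<phi> x :: "real \<rightharpoonup> 'k^'n"
  assumes "is_norm N"
    and "r > 0"
    and "continuous_linear_on_C N r L"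
    and "bounded_variation_on \<eta> (-r) 0"
    and "\<forall>\<theta>\<le>-r. \<eta> \<theta> = \<eta> (-r)"
    and "\<forall>\<psi>\<in>C_space r. has_RS_integral \<eta> \<psi> (-r) 0 (L \<psi>)"
    and "1 \<le> p"
    and "\<phi> \<in> Mp N p r"
    and "mild_solution N r L \<phi> x"
  shows "locally_absolutely_continuous_on N {0..} (\<lambda>t. the (x t)) \<and>
    ((AE t in lebesgue_on {0..}. (\<lambda>s. the (x s)) differentiable (at t within {0..})) \<and>
      half_line_deriv x \<in> Lp_loc N p {0..}) \<and>
    (\<exists>f \<in> Lp_loc N p {0..}. (\<forall>t\<ge>r. f t = Some 0) \<and>
      (AE t in lebesgue_on {0..}. t \<in> dom (half_line_deriv x) \<and> t \<in> dom f \<and>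
        (\<exists>I. has_RS_integral \<eta> (\<lambda>\<theta>. the (x (t + \<theta>))) (-t) 0 I \<and>
          the (half_line_deriv x t) = I + the (f t))))"
proof -
  note N = \<open>is_norm N\<close> and r = \<open>r > 0\<close>
  have const: "\<eta> \<theta> = \<eta> (-r)" if "\<theta> \<le> -r" for \<theta> using assms(5) that by blast
  have L_RS: "has_RS_integral \<eta> \<psi> (-r) 0 (L \<psi>)" if "continuous_on {-r..0} \<psi>" for \<psi>
    using assms(6) that by (simp add: C_space_def)
  obtain v where v: "\<And>s t. \<lbrakk>-r \<le> s; s \<le> t; t \<le> 0\<rbrakk> \<Longrightarrow> norm (\<eta> t - \<eta> s) \<le> v t - v s"
    using bounded_variation_majorant[OF assms(4)] by blast
  obtain V m A c s where "point_mass_limit r V L m A c s"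
    using RS_functional_point_mass_limit[OF r v L_RS] by blast
  then interpret point_mass_limit r V L m A c s .

  \<comment> \<open>The solution as a constant plus the flow of its antiderivative\<close>
  define y where "y = (\<lambda>t. the (x t))"
  define Y where "Y = (\<lambda>t. integral {-r..t} y)"
  have x_loc: "x \<in> Lp_loc N 1 {-r..}"
    and x_eq: "\<And>t. t \<ge> 0 \<Longrightarrow> y t = the (\<phi> 0) + L (\<lambda>\<theta>. \<integral>s. y (s + \<theta>) \<partial>lebesgue_on {0..t})"
    and x_init: "AE t in lebesgue_on {-r..0}. x t = \<phi> t"
    using assms(9) unfolding mild_solution_def y_def by blast+
  have y_abs: "y absolutely_integrable_on {-r..T}" for T
    unfolding y_def by (intro Lp_on_1_imp_absolutely_integrable Lp_loc_imp_Lp_on[OF N x_loc]) auto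
  have y_int: "y integrable_on {a..b}" if "-r \<le> a" for a b
    using y_abs[of b] that by (auto simp: absolutely_integrable_on_def intro: integrable_on_subinterval)
  have Y_cont: "continuous_on {-r..T} Y" for T
    unfolding Y_def by (intro indefinite_integral_continuous_1 y_int) simp
  \<comment> \<open>Since \<open>Y\<close> starts at \<open>-r\<close>, both \<open>\<theta>\<close>
    and \<open>t + \<theta>\<close> lie in its range, and the integral of the translate is an
    increment of \<open>Y\<close>.\<close>
  have y_flow: "y t = the (\<phi> 0) + flow Y t" if t: "t \<ge> 0" for t
  proof -
    have "(\<integral>s. y (s + \<theta>) \<partial>lebesgue_on {0..t}) = Y (t + \<theta>) - Y \<theta>" if \<theta>: "\<theta> \<in> {-r..0}" for \<theta>
    proof -
      have "y absolutely_integrable_on {\<theta>..t + \<theta>}"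
        by (rule set_integrable_subset[OF y_abs[of "t + \<theta>"]]) (use \<theta> in auto)
      then have "(\<lambda>s. y (s + \<theta>)) absolutely_integrable_on {0..t}"
        using integrable_shift_real_ivl[of y \<theta> "t + \<theta>" \<theta>] integrable_shift_real_ivl[of "\<lambda>s. norm (y s)" \<theta> "t + \<theta>" \<theta>]
        by (simp add: absolutely_integrable_on_def)
      then have "(\<integral>s. y (s + \<theta>) \<partial>lebesgue_on {0..t}) = integral {0..t} (\<lambda>s. y (s + \<theta>))"
        by (intro lebesgue_integral_eq_integral) (simp_all add: integrable_lebesgue_on_iff)
      also have "\<dots> = integral {\<theta>..t + \<theta>} y"
        using integral_shift_real_ivl[of \<theta> \<theta> "t + \<theta>" y] by simp
      also have "\<dots> = Y (t + \<theta>) - Y \<theta>"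
        using Henstock_Kurzweil_Integration.integral_combine[of "-r" \<theta> "t + \<theta>" y] y_int[of "-r" "t + \<theta>"] \<theta> t
        unfolding Y_def by (simp add: algebra_simps)
      finally show ?thesis .
    qed
    then have "flow Y t = L (\<lambda>\<theta>. \<integral>s. y (s + \<theta>) \<partial>lebesgue_on {0..t})"
      unfolding flow_def using t continuous_on_segment[OF Y_cont, of t t] Y_cont[of 0]
      by (intro L_cong continuous_intros) auto
    then show ?thesis using x_eq[OF t] by simp
  qed
  have y_diff: "y t - y u = flow Y t - flow Y u" if "t \<ge> 0" "u \<ge> 0" for t u
    using y_flow[OF that(1)] y_flow[OF that(2)] by simp
  have y_cont: "continuous_on {0..} y"
  proof -
    have "continuous_on {0..T} y" for T
    proof -
      have "continuous_on {0..T} (\<lambda>t. the (\<phi> 0) + flow Y t)"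
        by (intro continuous_intros continuous_on_flow[OF Y_cont])
      then show ?thesis by (subst continuous_on_cong[OF refl y_flow]) auto
    qed
    then have "continuous (at t within {0..}) y" if "t \<in> {0..}" for t
    proof -
      have "continuous (at t within {0..t + 1}) y"
        using \<open>continuous_on {0..t + 1} y\<close> that by (simp add: continuous_on_eq_continuous_within)
      moreover have "at t within {0..} = at t within {0..t + 1}"
        by (rule at_within_nhd[of t "{..<t + 1}"]) auto
      ultimately show ?thesis by simp
    qed
    then show ?thesis by (simp add: continuous_on_eq_continuous_within)
  qed
  \<comment> \<open>Before time zero the solution is merely in L^p and may jump at zero;
    \<open>z\<close> forgets that part, which makes every segment of it a legitimate argument of
    \<open>L\<close>.\<close>
  define z where "z = (\<lambda>t. y (max 0 t))"
  have z_cont: "continuous_on UNIV z"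
    unfolding z_def by (rule continuous_on_compose2[OF y_cont]) (auto intro!: continuous_intros)
  have z_shift: "continuous_on X (\<lambda>\<theta>. z (t + \<theta>))" for X t
    by (rule continuous_on_compose2[OF z_cont]) (auto intro!: continuous_intros)

  \<comment> \<open>Local absolute continuity\<close>
  have AC: "locally_absolutely_continuous_on N {0..} y"
    unfolding locally_absolutely_continuous_on_def absolutely_continuous_on_def
  proof (intro allI impI)
    fix a b \<epsilon> :: real assume sub: "{a..b} \<subseteq> {0..}" and "\<epsilon> > 0"
    obtain C where C: "C > 0" "\<And>v. N v \<le> C * norm v" using is_norm_le[OF N] by blast
    \<comment> \<open>\<open>C\<close> converts the Euclidean norm to \<open>N\<close>, and the
      factor 2 turns the weak inequality for the flow into a strict one.\<close>
    have "\<epsilon> / (2 * C) > 0" using C \<open>\<epsilon> > 0\<close> by simp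
    from flow_absolutely_continuous[OF y_abs[of b] this] obtain \<delta> where "\<delta> > 0" and
      \<delta>: "\<And>m u v. \<lbrakk>\<And>k. k < (m::nat) \<Longrightarrow> 0 \<le> u k \<and> u k \<le> v k \<and> v k \<le> b;
       \<And>i j. \<lbrakk>i < m; j < m; i \<noteq> j\<rbrakk> \<Longrightarrow> {u i<..<v i} \<inter> {u j<..<v j} = {};
       (\<Sum>k<m. v k - u k) < \<delta>\<rbrakk> \<Longrightarrow> (\<Sum>k<m. norm (flow Y (v k) - flow Y (u k))) \<le> \<epsilon> / (2 * C)"
      unfolding Y_def by blast
    show "\<exists>\<delta>>0. \<forall>m (u::nat \<Rightarrow> real) v.
        (\<forall>k<m. a \<le> u k \<and> u k \<le> v k \<and> v k \<le> b) \<and>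
        (\<forall>i<m. \<forall>j<m. i \<noteq> j \<longrightarrow> {u i<..<v i} \<inter> {u j<..<v j} = {}) \<and>
        (\<Sum>k<m. v k - u k) < \<delta> \<longrightarrow> (\<Sum>k<m. N (y (v k) - y (u k))) < \<epsilon>"
    proof (intro exI[of _ \<delta>] conjI allI impI \<open>\<delta> > 0\<close>)
      fix m and u v :: "nat \<Rightarrow> real"
      assume *: "(\<forall>k<m. a \<le> u k \<and> u k \<le> v k \<and> v k \<le> b) \<and>
        (\<forall>i<m. \<forall>j<m. i \<noteq> j \<longrightarrow> {u i<..<v i} \<inter> {u j<..<v j} = {}) \<and> (\<Sum>k<m. v k - u k) < \<delta>"
      have nn: "0 \<le> u k \<and> u k \<le> v k \<and> v k \<le> b" if "k < m" for k
      proof -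
        have k: "a \<le> u k" "u k \<le> v k" "v k \<le> b" using * that by blast+
        then have "u k \<in> {a..b}" by auto
        then show ?thesis using k sub by auto
      qed
      have "(\<Sum>k<m. N (y (v k) - y (u k))) \<le> (\<Sum>k<m. C * norm (flow Y (v k) - flow Y (u k)))"
      proof (rule sum_mono)
        fix k assume "k \<in> {..<m}"
        then have "y (v k) - y (u k) = flow Y (v k) - flow Y (u k)"
          using nn[of k] by (intro y_diff) auto
        then show "N (y (v k) - y (u k)) \<le> C * norm (flow Y (v k) - flow Y (u k))" using C(2) by simp
      qed
      also have "\<dots> = C * (\<Sum>k<m. norm (flow Y (v k) - flow Y (u k)))" by (simp add: sum_distrib_left)
      also have "\<dots> \<le> C * (\<epsilon> / (2 * C))"
        using * nn C(1) by (intro mult_left_mono \<delta>) auto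
      also have "\<dots> < \<epsilon>" using C(1) \<open>\<epsilon> > 0\<close> by simp
      finally show "(\<Sum>k<m. N (y (v k) - y (u k))) < \<epsilon>" .
    qed
  qed

  \<comment> \<open>Differentiability almost everywhere\<close>
  have inner: "at t within {0..} = at t" if "t > 0" for t :: real
    by (rule at_within_nhd[of t "{0<..}"]) (use that in auto)
  have half_line: "{0::real..} \<in> sets lebesgue" by simp
  define D where "D = (\<lambda>t. vector_derivative (flow Y) (at t))"
  \<comment> \<open>Time zero is excluded because only at interior points does the derivative within
    the half-line agree with the two-sided one.\<close>
  define good where "good = (\<lambda>t. t > 0 \<and> (flow Y has_vector_derivative D t) (at t))"
  have AE_good: "AE t in lebesgue_on {0..}. good t"
  proof -
    let ?B = "\<lambda>n. {t \<in> {0<..<real (Suc n)}. \<not> flow Y differentiable (at t)}"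
    have "negligible (?B n)" for n
      unfolding Y_def by (rule flow_differentiable_ae[OF y_abs]) simp
    then have "negligible (insert 0 (\<Union>n. ?B n))"
      by (simp add: negligible_insert) blast
    then have "AE t in lebesgue. t \<notin> insert 0 (\<Union>n. ?B n)"
      by (simp only: negligible_iff_null_sets AE_not_in)
    then have "AE t in lebesgue. t \<in> {0..} \<longrightarrow> good t"
    proof (rule eventually_mono, intro impI)
      fix t assume t: "t \<notin> insert 0 (\<Union>n. ?B n)" "t \<in> {0..}"
      obtain n where "t < real n" using reals_Archimedean2 by blast
      then have "t \<in> {0<..<real (Suc n)}" using t by auto
      then have "flow Y differentiable (at t)" using t by blast
      then show "good t" using t unfolding good_def D_def by (auto simp: vector_derivative_works)
    qed
    then show ?thesis by (simp add: AE_lebesgue_on_iff)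
  qed
  have good_deriv: "(y has_vector_derivative D t) (at t within {0..})" if "good t" for t
  proof -
    have "((\<lambda>t. the (\<phi> 0) + flow Y t) has_vector_derivative 0 + D t) (at t)"
      using that unfolding good_def by (intro has_vector_derivative_add has_vector_derivative_const) blast
    then have "(y has_vector_derivative 0 + D t) (at t)"
      by (rule has_vector_derivative_transform_within_open[of _ _ _ "{0<..}"])
        (use that y_flow in \<open>auto simp: good_def\<close>)
    then show ?thesis by (simp add: has_vector_derivative_at_within)
  qed
  have deriv_eq: "half_line_deriv x t = Some (D t)" if "good t" for t
  proof -
    have "t > 0" using that by (simp add: good_def)
    have "at t within {0..} \<noteq> bot" unfolding inner[OF \<open>t > 0\<close>] by (rule at_neq_bot)
    then have "vector_derivative y (at t within {0..}) = D t"
      by (rule vector_derivative_within[OF _ good_deriv[OF that]])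
    moreover have "y differentiable (at t within {0..})"
      by (rule differentiableI_vector[OF good_deriv[OF that]])
    ultimately show ?thesis using \<open>t > 0\<close> unfolding half_line_deriv_def y_def by simp
  qed

  \<comment> \<open>Local L^p integrability of the derivative\<close>
  have y_Lp: "Lp_on p {-r..T} y" if "T \<ge> 0" for T
  proof (rule Lp_on_combine[of y "-r" T p 0])
    show "y \<in> borel_measurable (lebesgue_on {-r..T})"
      by (rule absolutely_integrable_imp_borel_measurable[OF y_abs]) simp
    \<comment> \<open>Here the integrability of \<open>\<phi>\<close> enters; on
      \<open>[0,T]\<close> continuity of the solution takes over.\<close>
    have "Lp_on p {-r..0} (\<lambda>t. the (\<phi> t))" using assms(8) by (simp add: Mp_def Lp_iff_Lp_on[OF N])
    moreover have "AE t in lebesgue_on {-r..0}. the (\<phi> t) = y t"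
      using x_init by (rule eventually_mono) (simp add: y_def)
    ultimately show "Lp_on p {-r..0} y" by (rule Lp_on_cong_AE[rotated]) simp
    have cont: "continuous_on {0..T} y" by (rule continuous_on_subset[OF y_cont]) auto
    have "bounded (y ` {0..T})" by (intro compact_imp_bounded compact_continuous_image cont) simp
    then obtain M where "\<And>t. t \<in> {0..T} \<Longrightarrow> norm (y t) \<le> M" unfolding bounded_iff by blast
    then show "Lp_on p {0..T} y"
      by (intro Lp_on_bounded continuous_imp_measurable_on_sets_lebesgue cont) auto
  qed (use r that in auto)
  have D_Lp: "Lp_on p {0..T} D" if "T \<ge> 0" for T
  \<comment> \<open>The extra unit of time leaves room for right-hand difference quotients up to
    \<open>T\<close>.\<close>
  proof (rule flow_derivative_Lp_on[where y = y and T = "T + 1"])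
    have "AE t in lebesgue. t \<in> {0..T} \<longrightarrow> (flow Y has_vector_derivative D t) (at t)"
      using AE_good unfolding AE_lebesgue_on_iff[OF half_line] by (rule eventually_mono) (auto simp: good_def)
    then show "AE t in lebesgue_on {0..T}. (flow (\<lambda>t. integral {-r..t} y) has_vector_derivative D t) (at t)"
      unfolding Y_def by (simp add: AE_lebesgue_on_iff)
  qed (use y_abs y_Lp \<open>1 \<le> p\<close> that in auto)
  have deriv_Lp: "half_line_deriv x \<in> Lp_loc N p {0..}"
  proof (rule Lp_loc_half_lineI[OF N])
    show "dom (half_line_deriv x) \<subseteq> {0..}" by (auto simp: half_line_deriv_def split: if_splits)
    show "AE t in lebesgue_on {0..}. half_line_deriv x t = Some (D t)"
      using AE_good by (rule eventually_mono) (rule deriv_eq)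
  qed (rule D_Lp)

  \<comment> \<open>\<open>J t\<close> is the integral over \<open>[-t,0]\<close>: extend \<open>y\<close> to the left of \<open>0\<close> by \<open>y 0\<close> and subtract the
    contribution of the constant part.\<close>
  define J where "J = (\<lambda>t. L (\<lambda>\<theta>. z (t + \<theta>)) - (\<eta> (-t) - \<eta> (-r)) *v y 0)"
  \<comment> \<open>If \<open>t \<le> r\<close>, then \<open>z (t + \<theta>)\<close> is the
    constant \<open>y 0\<close> for \<open>\<theta>\<close> in \<open>[-r,-t]\<close>, and this
    stretch is cut off. If \<open>t > r\<close>, the interval is lengthened across a stretch where
    \<open>\<eta>\<close> is constant. On \<open>[-t,0]\<close> the functions \<open>z\<close> and
    \<open>y\<close> agree.\<close>
  have J_RS: "has_RS_integral \<eta> (\<lambda>\<theta>. y (t + \<theta>)) (-t) 0 (J t)" if t: "t \<ge> 0" for t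
  proof (cases "t \<le> r")
    case True
    have "has_RS_integral \<eta> (\<lambda>\<theta>. z (t + \<theta>)) (-t) 0 (J t)"
      unfolding J_def
      by (rule has_RS_integral_drop_constant[OF L_RS[OF z_shift]]) (use t True in \<open>auto simp: z_def\<close>)
    then show ?thesis by (rule has_RS_integral_cong) (simp add: z_def)
  next
    case False
    have "\<eta> (-t) = \<eta> (-r)" using False by (intro const) simp
    then have "J t = L (\<lambda>\<theta>. z (t + \<theta>))" by (simp add: J_def)
    then have "has_RS_integral \<eta> (\<lambda>\<theta>. z (t + \<theta>)) (-r) 0 (J t)" using L_RS[OF z_shift] by simp
    then have "has_RS_integral \<eta> (\<lambda>\<theta>. z (t + \<theta>)) (-t) 0 (J t)"
    proof (rule has_RS_integral_extend_constant)
      show "norm (\<eta> s - \<eta> (-r)) \<le> v 0 - v (-r)" if "-r \<le> s" "s \<le> 0" for s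
        using v[of "-r" s] v[of s 0] norm_ge_zero[of "\<eta> 0 - \<eta> s"] that by linarith
      show "continuous (at (-r) within {-t..0}) (\<lambda>\<theta>. z (t + \<theta>))"
        using z_shift[of "{-t..0}" t] False r by (simp add: continuous_on_eq_continuous_within)
      show "\<eta> s = \<eta> (-r)" if "s \<le> -r" for s using that by (rule const)
    qed (use False r in auto)
    then show ?thesis by (rule has_RS_integral_cong) (simp add: z_def)
  qed
  have J_Lp: "Lp_on p {0..<r} J"
  proof -
    have "(\<lambda>t. \<eta> (-t)) \<in> borel_measurable (lebesgue_on {0..r})"
    \<comment> \<open>Time reversal turns the increasing majorant \<open>v\<close> into the
      increasing function \<open>- v (-t)\<close>.\<close>
    proof (rule borel_measurable_of_increasing_majorant[where v = "\<lambda>t. - v (-t)"])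
      fix s t assume "0 \<le> s" "s \<le> t" "t \<le> r"
      then show "norm (\<eta> (-t) - \<eta> (-s)) \<le> - v (-t) - - v (-s)"
        using v[of "-t" "-s"] by (simp add: norm_minus_commute)
    qed
    moreover have "continuous_on UNIV (\<lambda>M. (M - \<eta> (-r)) *v y 0)"
    proof -
      have "bounded_linear (\<lambda>M::'k^'n^'n. M *v y 0)"
        using linear_matrix_vector_mult_left by (simp add: linear_conv_bounded_linear)
      then show ?thesis by (rule bounded_linear.continuous_on) (intro continuous_intros)
    qed
    ultimately have "(\<lambda>t. (\<eta> (-t) - \<eta> (-r)) *v y 0) \<in> borel_measurable (lebesgue_on {0..r})"
      by (rule measurable_compose[OF _ borel_measurable_continuous_onI])
    then have Jm: "J \<in> borel_measurable (lebesgue_on {0..r})"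
      unfolding J_def by (intro borel_measurable_diff borel_measurable_L_shift z_cont) auto
    have "bounded (z ` {-r..r})"
      by (intro compact_imp_bounded compact_continuous_image continuous_on_subset[OF z_cont]) auto
    then obtain M where M: "\<And>t. t \<in> {-r..r} \<Longrightarrow> norm (z t) \<le> M" unfolding bounded_iff by blast
    have "Lp_on p {0..r} J"
    proof (rule Lp_on_bounded[OF _ Jm])
      fix t assume t: "t \<in> {0..r}"
      have 1: "norm (L (\<lambda>\<theta>. z (t + \<theta>))) \<le> V * M"
        using t by (intro norm_L_le z_shift M) auto
      have 2: "norm ((\<eta> (-t) - \<eta> (-r)) *v y 0) \<le> (real CARD('n))\<^sup>2 * (v 0 - v (-r)) * norm (y 0)"
      proof (rule order_trans[OF norm_matrix_vector_mult_le])
        have "0 \<le> v 0 - v (-t)" by (rule order_trans[OF norm_ge_zero v]) (use t in auto)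
        then have "norm (\<eta> (-t) - \<eta> (-r)) \<le> v 0 - v (-r)" using v[of "-r" "-t"] t by auto
        then show "(real CARD('n))\<^sup>2 * norm (\<eta> (-t) - \<eta> (-r)) * norm (y 0)
            \<le> (real CARD('n))\<^sup>2 * (v 0 - v (-r)) * norm (y 0)"
          by (intro mult_right_mono mult_left_mono) auto
      qed
      show "norm (J t) \<le> V * M + (real CARD('n))\<^sup>2 * (v 0 - v (-r)) * norm (y 0)"
        unfolding J_def using norm_triangle_ineq4 1 2 by (rule order_trans[OF _ add_mono])
    qed simp
    then show ?thesis by (rule Lp_on_subset) auto
  qed

  \<comment> \<open>The equation beyond the delay and the forcing term\<close>
  have deriv_J: "D t = J t" if "good t" "t > r" for t
  proof -
    \<comment> \<open>Half the distance to \<open>r\<close> keeps the whole window \<open>?J\<close>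
      at positive times, where \<open>y\<close> is continuous and hence the derivative of
      \<open>Y\<close>.\<close>
    define \<delta> where "\<delta> = (t - r) / 2"
    have \<delta>: "\<delta> > 0" "0 < t - r - \<delta>" using that by (auto simp: \<delta>_def field_simps)
    let ?J = "{t - r - \<delta>..t + \<delta>}"
    have sub: "?J \<subseteq> {-r..t + \<delta>}" "?J \<subseteq> {0..}" using \<delta> r by auto
    have "(flow Y has_vector_derivative L (\<lambda>\<theta>. y (t + \<theta>))) (at t)"
    proof (rule flow_has_vector_derivative[OF Y_cont[of "t + \<delta>"], of t \<delta> y])
      show "continuous_on ?J y" by (rule continuous_on_subset[OF y_cont sub(2)])
      fix \<sigma> assume \<sigma>: "\<sigma> \<in> ?J"
      then have "\<sigma> > 0" using \<delta> by auto
      have "continuous (at \<sigma> within {0..}) y" using y_cont \<open>\<sigma> > 0\<close> by (simp add: continuous_on_eq_continuous_within)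
      then have "isCont y \<sigma>" unfolding inner[OF \<open>\<sigma> > 0\<close>] .
      \<comment> \<open>The rule applied next permits an exceptional set of points, which is empty
        here.\<close>
      then have "continuous (at \<sigma> within ({-r..t + \<delta>} - {})) y" by (rule continuous_at_imp_continuous_within)
      from integral_has_vector_derivative_continuous_at[OF y_int _ _ this]
      have "(Y has_vector_derivative y \<sigma>) (at \<sigma> within {-r..t + \<delta>})"
        unfolding Y_def using sub \<sigma> by auto
      then show "(Y has_vector_derivative y \<sigma>) (at \<sigma> within ?J)"
        by (rule has_vector_derivative_within_subset[OF _ sub(1)])
    qed (use \<delta> that r in auto)
    then have "D t = L (\<lambda>\<theta>. y (t + \<theta>))" unfolding D_def by (rule vector_derivative_at)
    also have "\<dots> = L (\<lambda>\<theta>. z (t + \<theta>))"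
      by (rule L_cong[symmetric, OF z_shift]) (use that in \<open>auto simp: z_def\<close>)
    also have "\<dots> = J t" unfolding J_def using const[of "-t"] that by simp
    finally show ?thesis .
  qed

  \<comment> \<open>With \<open>f\<close> defined as the difference of the two sides, only its vanishing past \<open>r\<close> (\<open>deriv_J\<close>) and its
    integrability have to be shown.\<close>
  define f where "f = (\<lambda>t. if t \<ge> r then Some 0 else if t \<ge> 0 then Some (D t - J t) else None)"
  have f_Lp: "f \<in> Lp_loc N p {0..}"
  proof (rule Lp_loc_half_lineI[OF N])
    show "dom f \<subseteq> {0..}" using r by (auto simp: f_def split: if_splits)
    show "AE t in lebesgue_on {0..}. f t = Some (if t \<in> {0..<r} then D t - J t else 0)"
      by (rule AE_I2) (auto simp: f_def)
    have "Lp_on p {0..<r} D" by (rule Lp_on_subset[OF D_Lp[of r]]) (use r in auto)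
    then show "Lp_on p {0..T} (\<lambda>t. if t \<in> {0..<r} then D t - J t else 0)" for T
      by (intro Lp_on_extend_zero Lp_on_diff J_Lp) auto
  qed
  have "AE t in lebesgue_on {0..}. t \<in> dom (half_line_deriv x) \<and> t \<in> dom f \<and>
        (\<exists>I. has_RS_integral \<eta> (\<lambda>\<theta>. y (t + \<theta>)) (-t) 0 I \<and> the (half_line_deriv x t) = I + the (f t))"
  proof -
    \<comment> \<open>At \<open>t = r\<close> the forcing term is already zero, while
      \<open>deriv_J\<close> speaks only of later times; this single point is discarded.\<close>
    have "AE t in lebesgue. t \<noteq> r" using AE_not_in[of "{r}" lebesgue] by (simp add: negligible_iff_null_sets[symmetric])
    then have "AE t in lebesgue_on {0..}. t \<noteq> r" by (simp add: AE_lebesgue_on_iff) (auto elim: eventually_mono)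
    with AE_good show ?thesis
    proof eventually_elim
      case (elim t)
      have t: "t > 0" using elim by (simp add: good_def)
      have "D t = J t + the (f t)"
        using deriv_J[OF elim(1)] elim(2) t by (auto simp: f_def)
      moreover have "t \<in> dom f" using t by (auto simp: f_def)
      ultimately show ?case using deriv_eq[OF elim(1)] J_RS[of t] t by auto
    qed
  qed
  moreover have "AE t in lebesgue_on {0..}. y differentiable (at t within {0..})"
    using AE_good by (rule eventually_mono) (rule differentiableI_vector[OF good_deriv])
  moreover have "\<forall>t\<ge>r. f t = Some 0" by (simp add: f_def)
  ultimately show ?thesis using AC deriv_Lp f_Lp unfolding y_def by blast
qed

end
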